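(* Let $M$ be a connected, compact Riemannian manifold, let $N$ be a Riemannian manifold, and let $u:M\to N$ be a smooth map. Let $\tilde\nabla$ be the pull-back connection on $u^{-1}TN$ of the Levi-Civita connection on $N$, and regard $\mathrm{d}u$ as an element of $\Omega^1(M,u^{-1}TN)$. If for some Morse function $f$ on $M$ one has $\mathcal{L}^{\tilde\nabla}_{\nabla f}\mathrm{d}u=0$, then $u$ is a constant map.
   Context: Manifolds are smooth and without boundary. A Morse function on $M$ is a smooth function $f:M\to\mathbb{R}$ all of whose critical points are non-degenerate (the Hessian of $f$ at each critical point is non-degenerate). The gradient $\nabla f$ is taken with respect to the Riemannian metric of $M$. The pull-back bundle $u^{-1}TN\to M$ has fibre $T_{u(x)}N$ at $x$; the pull-back connection $\tilde\nabla$ of the Levi-Civita connection $\nabla^N$ is determined by $\tilde\nabla_X(u^*s)=u^*(\nabla^N_{\mathrm{d}u(X)}s)$ for sections $s$ of $TN$, where $u^*s$ is the pulled-back section $x\mapsto s_{u(x)}$. Connection Lie derivative: let $F\to M$ be a vector bundle with a connection $\nabla^F$, let $X$ be a vector field on $M$ with flow $\phi_t$, and let $\tilde\phi_t$ be the horizontal lift of $\phi_t$ with respect to $\nabla^F$, i.e. $\tilde\phi_t:F_x\to F_{\phi_t(x)}$ is $\nabla^F$-parallel transport along the flow line $s\mapsto\phi_s(x)$ from time $0$ to time $t$. For $\omega\in\Omega^r(M,F)$ and vector fields $Y_1,\dots,Y_r$ on $M$, the connection Lie derivative is $$\mathcal{L}^{\nabla^F}_X\omega(Y_1,\dots,Y_r)=\frac{\mathrm{d}}{\mathrm{d}t}\Big|_{t=0}\tilde\phi_{-t}\Big(\omega\big(\mathrm{d}\phi_t(Y_1),\dots,\mathrm{d}\phi_t(Y_r)\big)\Big).$$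 In the claim this is applied with $F=u^{-1}TN$, $\nabla^F=\tilde\nabla$, $X=\nabla f$, $\omega=\mathrm{d}u$, $r=1$. *)

theory Defs
  imports "HOL-Analysis.Analysis"
begin

section \<open>Smoothness in normed spaces\<close>

text \<open>
  Meant for an open set S in a finite-dimensional space, where this is the usual notion:
  all iterated directional derivatives along constant vectors exist and are continuous.
\<close>

primrec Ck_on :: "nat \<Rightarrow> 'a::real_normed_vector set \<Rightarrow> ('a \<Rightarrow> 'b::real_normed_vector) \<Rightarrow> bool" where
  "Ck_on 0 S f \<longleftrightarrow> continuous_on S f"
| "Ck_on (Suc k) S f \<longleftrightarrow>
     (\<forall>x\<in>S. f differentiable (at x)) \<and> (\<forall>v. Ck_on k S (\<lambda>x. frechet_derivative f (at x) v))"

definition smooth_on :: "'a::real_normed_vector set \<Rightarrow> ('a \<Rightarrow> 'b::real_normed_vector) \<Rightarrow> bool" where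
  "smooth_on S f \<longleftrightarrow> (\<forall>k. Ck_on k S f)"

section \<open>Manifolds\<close>

text \<open>
  The underlying set of a manifold is a whole Hausdorff, second countable type.  The model space is
  a type of sort '{real_normed_vector, heine_borel}': a locally compact, hence (Riesz)
  finite-dimensional, real normed space.  Unlike 'euclidean_space', this sort does not
  exclude dimension 0.  A smooth structure is given by an atlas, not required to be maximal.
\<close>

type_synonym ('m, 'e) chart = "'m set \<times> ('m \<Rightarrow> 'e)"

abbreviation cdom :: "('m, 'e) chart \<Rightarrow> 'm set" where
  "cdom c \<equiv> fst c"

abbreviation cmap :: "('m, 'e) chart \<Rightarrow> 'm \<Rightarrow> 'e" where
  "cmap c \<equiv> snd c"

definition cinv :: "('m, 'e) chart \<Rightarrow> 'e \<Rightarrow> 'm" where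
  "cinv c = inv_into (cdom c) (cmap c)"

definition smooth_atlas ::
  "('m::{t2_space,second_countable_topology}, 'e::{real_normed_vector,heine_borel}) chart set \<Rightarrow> bool" where
  "smooth_atlas A \<longleftrightarrow>
     (\<Union>c\<in>A. cdom c) = UNIV \<and>
     (\<forall>c\<in>A. open (cdom c) \<and> open (cmap c ` cdom c) \<and>
        homeomorphism (cdom c) (cmap c ` cdom c) (cmap c) (cinv c)) \<and>
     (\<forall>c\<in>A. \<forall>d\<in>A. smooth_on (cmap c ` (cdom c \<inter> cdom d)) (\<lambda>y. cmap d (cinv c y)))"

definition chart_at :: "('m, 'e) chart set \<Rightarrow> 'm \<Rightarrow> ('m, 'e) chart" where
  "chart_at A x = (SOME c. c \<in> A \<and> x \<in> cdom c)"

definition smooth_fun ::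
  "('m, 'e::real_normed_vector) chart set \<Rightarrow> 'm set \<Rightarrow> ('m \<Rightarrow> 'b::real_normed_vector) \<Rightarrow> bool" where
  "smooth_fun A U f \<longleftrightarrow> (\<forall>c\<in>A. smooth_on (cmap c ` (cdom c \<inter> U)) (\<lambda>y. f (cinv c y)))"

definition smooth_map ::
  "('m::topological_space, 'a::real_normed_vector) chart set \<Rightarrow>
   ('n::topological_space, 'b::real_normed_vector) chart set \<Rightarrow> ('m \<Rightarrow> 'n) \<Rightarrow> bool" where
  "smooth_map A B u \<longleftrightarrow> continuous_on UNIV u \<and>
     (\<forall>c\<in>A. \<forall>d\<in>B. smooth_on (cmap c ` (cdom c \<inter> u -` cdom d)) (\<lambda>y. cmap d (u (cinv c y))))"

section \<open>Vector bundles\<close>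

text \<open>
  A vector bundle is described by its cocycle: a family of trivialising open sets and the
  transition functions between the trivialisations ('btrans E i j x' passes from
  trivialisation i to trivialisation j at x).  An element of the fibre over x is the family of its
  components in all the trivialisations; components in trivialisations not defined at x are 0.
  Fibres are vector spaces under the pointwise operations, and evaluation at any i with
  'x \<in> bdom E i' identifies the fibre over x with the model fibre.
\<close>

record ('m, 'i, 'f) vbundle =
  bdom :: "'i \<Rightarrow> 'm set"
  btrans :: "'i \<Rightarrow> 'i \<Rightarrow> 'm \<Rightarrow> 'f \<Rightarrow> 'f"

definition fibre :: "('m, 'i, 'f::real_normed_vector) vbundle \<Rightarrow> 'm \<Rightarrow> ('i \<Rightarrow> 'f) set" where
  "fibre E x = {v. (\<forall>i. x \<notin> bdom E i \<longrightarrow> v i = 0) \<and>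
     (\<forall>i j. x \<in> bdom E i \<inter> bdom E j \<longrightarrow> v j = btrans E i j x (v i))}"

definition smooth_section ::
  "('m, 'e::real_normed_vector) chart set \<Rightarrow> ('m, 'i, 'f::real_normed_vector) vbundle \<Rightarrow>
   'm set \<Rightarrow> ('m \<Rightarrow> 'i \<Rightarrow> 'f) \<Rightarrow> bool" where
  "smooth_section A E U s \<longleftrightarrow>
     (\<forall>x\<in>U. s x \<in> fibre E x) \<and> (\<forall>i. smooth_fun A (U \<inter> bdom E i) (\<lambda>x. s x i))"

text \<open>The local section over 'bdom E i' with constant component b in trivialisation i.\<close>

definition const_section ::
  "('m, 'i, 'f::real_normed_vector) vbundle \<Rightarrow> 'i \<Rightarrow> 'f \<Rightarrow> 'm \<Rightarrow> 'i \<Rightarrow> 'f" where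
  "const_section E i b x = (\<lambda>j. if x \<in> bdom E i \<inter> bdom E j then btrans E i j x b else 0)"

definition pullback_bundle :: "('m \<Rightarrow> 'n) \<Rightarrow> ('n, 'i, 'f) vbundle \<Rightarrow> ('m, 'i, 'f) vbundle" where
  "pullback_bundle u E = \<lparr>bdom = (\<lambda>i. u -` bdom E i), btrans = (\<lambda>i j x. btrans E i j (u x))\<rparr>"

text \<open>
  The tangent bundle, trivialised over the charts: a tangent vector at x is the family of its
  coordinate representations, transforming by the derivatives of the coordinate changes.
\<close>

definition tangent_bundle ::
  "('m, 'e::real_normed_vector) chart set \<Rightarrow> ('m, ('m, 'e) chart, 'e) vbundle" where
  "tangent_bundle A =
     \<lparr>bdom = (\<lambda>c. if c \<in> A then cdom c else {}),
      btrans = (\<lambda>c d x. frechet_derivative (\<lambda>y. cmap d (cinv c y)) (at (cmap c x)))\<rparr>"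

type_synonym ('m, 'e) tvec = "('m, 'e) chart \<Rightarrow> 'e"

abbreviation tangent_space ::
  "('m, 'e::real_normed_vector) chart set \<Rightarrow> 'm \<Rightarrow> ('m, 'e) tvec set" where
  "tangent_space A \<equiv> fibre (tangent_bundle A)"

abbreviation vector_field ::
  "('m, 'e::real_normed_vector) chart set \<Rightarrow> 'm set \<Rightarrow> ('m \<Rightarrow> ('m, 'e) tvec) \<Rightarrow> bool" where
  "vector_field A \<equiv> smooth_section A (tangent_bundle A)"

definition differential ::
  "('m, 'a::real_normed_vector) chart set \<Rightarrow> ('n, 'b::real_normed_vector) chart set \<Rightarrow>
   ('m \<Rightarrow> 'n) \<Rightarrow> 'm \<Rightarrow> ('m, 'a) tvec \<Rightarrow> ('n, 'b) tvec" where
  "differential A B u x v = (\<lambda>d. if d \<in> B \<and> u x \<in> cdom d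
     then frechet_derivative (\<lambda>y. cmap d (u (cinv (chart_at A x) y)))
            (at (cmap (chart_at A x) x)) (v (chart_at A x))
     else 0)"

definition dfun ::
  "('m, 'e::real_normed_vector) chart set \<Rightarrow> ('m \<Rightarrow> real) \<Rightarrow> 'm \<Rightarrow> ('m, 'e) tvec \<Rightarrow> real" where
  "dfun A f x v = frechet_derivative (\<lambda>y. f (cinv (chart_at A x) y))
     (at (cmap (chart_at A x) x)) (v (chart_at A x))"

definition lie_bracket ::
  "('m, 'e::real_normed_vector) chart set \<Rightarrow>
   ('m \<Rightarrow> ('m, 'e) tvec) \<Rightarrow> ('m \<Rightarrow> ('m, 'e) tvec) \<Rightarrow> 'm \<Rightarrow> ('m, 'e) tvec" where
  "lie_bracket A X Y x = (\<lambda>c. if c \<in> A \<and> x \<in> cdom c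
     then frechet_derivative (\<lambda>y. Y (cinv c y) c) (at (cmap c x)) (X x c) -
          frechet_derivative (\<lambda>y. X (cinv c y) c) (at (cmap c x)) (Y x c)
     else 0)"

section \<open>Riemannian metrics, gradients and Morse functions\<close>

definition riemannian_metric ::
  "('m::topological_space, 'e::real_normed_vector) chart set \<Rightarrow>
   ('m \<Rightarrow> ('m, 'e) tvec \<Rightarrow> ('m, 'e) tvec \<Rightarrow> real) \<Rightarrow> bool" where
  "riemannian_metric A g \<longleftrightarrow>
     (\<forall>x. \<forall>v\<in>tangent_space A x. \<forall>w\<in>tangent_space A x. g x v w = g x w v) \<and>
     (\<forall>x a b. \<forall>v\<in>tangent_space A x. \<forall>v'\<in>tangent_space A x. \<forall>w\<in>tangent_space A x.
        g x (\<lambda>c. a *\<^sub>R v c + b *\<^sub>R v' c) w = a * g x v w + b * g x v' w) \<and>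
     (\<forall>x. \<forall>v\<in>tangent_space A x. v \<noteq> (\<lambda>_. 0) \<longrightarrow> g x v v > 0) \<and>
     (\<forall>U X Y. open U \<and> vector_field A U X \<and> vector_field A U Y \<longrightarrow>
        smooth_fun A U (\<lambda>x. g x (X x) (Y x)))"

definition riemannian_manifold ::
  "('m::{t2_space,second_countable_topology}, 'e::{real_normed_vector,heine_borel}) chart set \<Rightarrow>
   ('m \<Rightarrow> ('m, 'e) tvec \<Rightarrow> ('m, 'e) tvec \<Rightarrow> real) \<Rightarrow> bool" where
  "riemannian_manifold A g \<longleftrightarrow> smooth_atlas A \<and> riemannian_metric A g"

definition gradient ::
  "('m, 'e::real_normed_vector) chart set \<Rightarrow>
   ('m \<Rightarrow> ('m, 'e) tvec \<Rightarrow> ('m, 'e) tvec \<Rightarrow> real) \<Rightarrow>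
   ('m \<Rightarrow> real) \<Rightarrow> 'm \<Rightarrow> ('m, 'e) tvec" where
  "gradient A g f x =
     (THE w. w \<in> tangent_space A x \<and> (\<forall>v\<in>tangent_space A x. g x w v = dfun A f x v))"

definition critical_point ::
  "('m, 'e::real_normed_vector) chart set \<Rightarrow> ('m \<Rightarrow> real) \<Rightarrow> 'm \<Rightarrow> bool" where
  "critical_point A f x \<longleftrightarrow> (\<forall>v\<in>tangent_space A x. dfun A f x v = 0)"

text \<open>Only used at critical points, where it does not depend on the chart.\<close>

definition hessian ::
  "('m, 'e::real_normed_vector) chart set \<Rightarrow> ('m \<Rightarrow> real) \<Rightarrow> 'm \<Rightarrow>
   ('m, 'e) tvec \<Rightarrow> ('m, 'e) tvec \<Rightarrow> real" where
  "hessian A f x v w = (let c = chart_at A x in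
     frechet_derivative (\<lambda>y. frechet_derivative (\<lambda>z. f (cinv c z)) (at y) (w c))
       (at (cmap c x)) (v c))"

definition morse_function ::
  "('m, 'e::real_normed_vector) chart set \<Rightarrow> ('m \<Rightarrow> real) \<Rightarrow> bool" where
  "morse_function A f \<longleftrightarrow> smooth_fun A UNIV f \<and>
     (\<forall>x. critical_point A f x \<longrightarrow>
        (\<forall>v\<in>tangent_space A x. (\<forall>w\<in>tangent_space A x. hessian A f x v w = 0) \<longrightarrow> v = (\<lambda>_. 0)))"

section \<open>Connections\<close>

text \<open>
  'D x v s' is the covariant derivative at x, in the direction of the tangent vector v at x,
  of a smooth section s defined near x; so the section usually written as D applied to X and s is
  '\<lambda>x. D x (X x) s'.  Connections are taken in their (unique) extension to local sections.
  Homogeneity over the reals in the section is the Leibniz rule for constant functions.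
\<close>

type_synonym ('m, 'e, 'i, 'f) conn =
  "'m \<Rightarrow> ('m, 'e) tvec \<Rightarrow> ('m \<Rightarrow> 'i \<Rightarrow> 'f) \<Rightarrow> 'i \<Rightarrow> 'f"

definition connection ::
  "('m::topological_space, 'e::real_normed_vector) chart set \<Rightarrow>
   ('m, 'i, 'f::real_normed_vector) vbundle \<Rightarrow> ('m, 'e, 'i, 'f) conn \<Rightarrow> bool" where
  "connection A E D \<longleftrightarrow>
     (\<forall>U s. open U \<and> smooth_section A E U s \<longrightarrow>
        (\<forall>x\<in>U. \<forall>v\<in>tangent_space A x.
           D x v s \<in> fibre E x \<and>
           (\<forall>s'. (\<forall>y\<in>U. s' y = s y) \<longrightarrow> D x v s' = D x v s) \<and>
           (\<forall>a b. \<forall>w\<in>tangent_space A x.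
              D x (\<lambda>c. a *\<^sub>R v c + b *\<^sub>R w c) s = (\<lambda>i. a *\<^sub>R D x v s i + b *\<^sub>R D x w s i)) \<and>
           (\<forall>s'. smooth_section A E U s' \<longrightarrow>
              D x v (\<lambda>y i. s y i + s' y i) = (\<lambda>i. D x v s i + D x v s' i)) \<and>
           (\<forall>h. smooth_fun A U h \<longrightarrow>
              D x v (\<lambda>y i. h y *\<^sub>R s y i) = (\<lambda>i. dfun A h x v *\<^sub>R s x i + h x *\<^sub>R D x v s i))) \<and>
        (\<forall>X. vector_field A U X \<longrightarrow> smooth_section A E U (\<lambda>x. D x (X x) s)))"

definition levi_civita ::
  "('m::topological_space, 'e::real_normed_vector) chart set \<Rightarrow>
   ('m \<Rightarrow> ('m, 'e) tvec \<Rightarrow> ('m, 'e) tvec \<Rightarrow> real) \<Rightarrow> ('m, 'e, ('m, 'e) chart, 'e) conn \<Rightarrow> bool" where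
  "levi_civita A g D \<longleftrightarrow> connection A (tangent_bundle A) D \<and>
     (\<forall>U X Y. open U \<and> vector_field A U X \<and> vector_field A U Y \<longrightarrow>
        (\<forall>x\<in>U. (\<lambda>c. D x (X x) Y c - D x (Y x) X c) = lie_bracket A X Y x)) \<and>
     (\<forall>U Y Z. open U \<and> vector_field A U Y \<and> vector_field A U Z \<longrightarrow>
        (\<forall>x\<in>U. \<forall>v\<in>tangent_space A x.
           dfun A (\<lambda>y. g y (Y y) (Z y)) x v = g x (D x v Y) (Z x) + g x (Y x) (D x v Z)))"

definition pullback_connection ::
  "('m::topological_space, 'a::real_normed_vector) chart set \<Rightarrow>
   ('n::topological_space, 'b::real_normed_vector) chart set \<Rightarrow> ('m \<Rightarrow> 'n) \<Rightarrow>
   ('n, 'i, 'f::real_normed_vector) vbundle \<Rightarrow> ('n, 'b, 'i, 'f) conn \<Rightarrow> ('m, 'a, 'i, 'f) conn \<Rightarrow> bool" where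
  "pullback_connection A B u E D D' \<longleftrightarrow> connection A (pullback_bundle u E) D' \<and>
     (\<forall>V s. open V \<and> smooth_section B E V s \<longrightarrow>
        (\<forall>x. u x \<in> V \<longrightarrow> (\<forall>v\<in>tangent_space A x.
           D' x v (\<lambda>y. s (u y)) = D (u x) (differential A B u x v) s)))"

section \<open>Flows, parallel transport and the connection Lie derivative\<close>

definition integral_curve ::
  "('m::topological_space, 'e::real_normed_vector) chart set \<Rightarrow> ('m \<Rightarrow> ('m, 'e) tvec) \<Rightarrow>
   real set \<Rightarrow> (real \<Rightarrow> 'm) \<Rightarrow> bool" where
  "integral_curve A X S \<gamma> \<longleftrightarrow> continuous_on S \<gamma> \<and>
     (\<forall>s\<in>S. \<forall>c\<in>A. \<gamma> s \<in> cdom c \<longrightarrow>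
        ((\<lambda>r. cmap c (\<gamma> r)) has_vector_derivative X (\<gamma> s) c) (at s within S))"

text \<open>
  'flow A X t x' is the maximal flow, meaningful where the integral curve of X through x
  extends to time t; on a compact manifold this is the case for all t and x.
\<close>

definition flow ::
  "('m::topological_space, 'e::real_normed_vector) chart set \<Rightarrow> ('m \<Rightarrow> ('m, 'e) tvec) \<Rightarrow>
   real \<Rightarrow> 'm \<Rightarrow> 'm" where
  "flow A X t x =
     (THE y. \<exists>\<gamma>. integral_curve A X (closed_segment 0 t) \<gamma> \<and> \<gamma> 0 = x \<and> \<gamma> t = y)"

definition velocity ::
  "('m, 'e::real_normed_vector) chart set \<Rightarrow> (real \<Rightarrow> 'm) \<Rightarrow> real \<Rightarrow> ('m, 'e) tvec" where
  "velocity A \<gamma> s = (\<lambda>c. if c \<in> A \<and> \<gamma> s \<in> cdom c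
     then vector_derivative (\<lambda>r. cmap c (\<gamma> r)) (at s) else 0)"

text \<open>
  The equation says that the covariant derivative of V along the curve vanishes: in trivialisation i
  it has component V' + D(V), where V' is the derivative of the component of V, and D(V) the
  covariant derivative along the velocity of the section that is constant in trivialisation i.
\<close>

definition parallel_along ::
  "('m, 'e::real_normed_vector) chart set \<Rightarrow> ('m, 'i, 'f::real_normed_vector) vbundle \<Rightarrow>
   ('m, 'e, 'i, 'f) conn \<Rightarrow> (real \<Rightarrow> 'm) \<Rightarrow> real set \<Rightarrow> (real \<Rightarrow> 'i \<Rightarrow> 'f) \<Rightarrow> bool" where
  "parallel_along A E D \<gamma> S V \<longleftrightarrow>
     (\<forall>s\<in>S. V s \<in> fibre E (\<gamma> s) \<and>
        (\<forall>i. \<gamma> s \<in> bdom E i \<longrightarrow>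
           ((\<lambda>r. V r i) has_vector_derivative
              - D (\<gamma> s) (velocity A \<gamma> s) (const_section E i (V s i)) i) (at s within S)))"

definition parallel_transport ::
  "('m, 'e::real_normed_vector) chart set \<Rightarrow> ('m, 'i, 'f::real_normed_vector) vbundle \<Rightarrow>
   ('m, 'e, 'i, 'f) conn \<Rightarrow> (real \<Rightarrow> 'm) \<Rightarrow> real \<Rightarrow> real \<Rightarrow> ('i \<Rightarrow> 'f) \<Rightarrow> 'i \<Rightarrow> 'f" where
  "parallel_transport A E D \<gamma> a b v =
     (THE w. \<exists>V. parallel_along A E D \<gamma> (closed_segment a b) V \<and> V a = v \<and> V b = w)"

text \<open>'horizontal_lift A E D X t x' maps the fibre over x to the fibre over 'flow A X t x'.\<close>

definition horizontal_lift ::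
  "('m::topological_space, 'e::real_normed_vector) chart set \<Rightarrow>
   ('m, 'i, 'f::real_normed_vector) vbundle \<Rightarrow> ('m, 'e, 'i, 'f) conn \<Rightarrow>
   ('m \<Rightarrow> ('m, 'e) tvec) \<Rightarrow> real \<Rightarrow> 'm \<Rightarrow> ('i \<Rightarrow> 'f) \<Rightarrow> 'i \<Rightarrow> 'f" where
  "horizontal_lift A E D X t x = parallel_transport A E D (\<lambda>s. flow A X s x) 0 t"

text \<open>
  A bundle-valued r-form takes at each point a list of r tangent vectors.  The derivative is that of
  a curve in the fibre over x, taken in each trivialisation.
\<close>

definition conn_lie_deriv ::
  "('m::topological_space, 'e::real_normed_vector) chart set \<Rightarrow>
   ('m, 'i, 'f::real_normed_vector) vbundle \<Rightarrow> ('m, 'e, 'i, 'f) conn \<Rightarrow>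
   ('m \<Rightarrow> ('m, 'e) tvec) \<Rightarrow> ('m \<Rightarrow> ('m, 'e) tvec list \<Rightarrow> 'i \<Rightarrow> 'f) \<Rightarrow>
   ('m \<Rightarrow> ('m, 'e) tvec) list \<Rightarrow> 'm \<Rightarrow> 'i \<Rightarrow> 'f" where
  "conn_lie_deriv A E D X \<omega> Ys x = (\<lambda>i. vector_derivative
     (\<lambda>t. horizontal_lift A E D X (- t) (flow A X t x)
        (\<omega> (flow A X t x) (map (\<lambda>Y. differential A A (flow A X t) x (Y x)) Ys)) i) (at 0))"

definition differential_one_form ::
  "('m, 'a::real_normed_vector) chart set \<Rightarrow> ('n, 'b::real_normed_vector) chart set \<Rightarrow>
   ('m \<Rightarrow> 'n) \<Rightarrow> 'm \<Rightarrow> ('m, 'a) tvec list \<Rightarrow> ('n, 'b) tvec" where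
  "differential_one_form A B u x vs = differential A B u x (hd vs)"

end

theory Submission
  imports Defs
begin

text \<open>
  Put \<open>X = \<nabla>f\<close>.  The pull-back connection inherits vanishing torsion from the Levi-Civita
  connection, so the connection Lie derivative of \<open>du\<close> along \<open>X\<close>, evaluated on \<open>Y\<close>, is the covariant
  derivative of the section \<open>du(X)\<close> in the direction \<open>Y\<close>.  The hypothesis therefore says that \<open>du(X)\<close> is
  parallel.  A parallel section that vanishes at one point of a connected manifold vanishes everywhere,
  and \<open>X\<close> vanishes at a maximum of \<open>f\<close>, which exists by compactness; hence \<open>du(X) = 0\<close>, and \<open>u\<close> is
  constant along the flow lines of \<open>\<nabla>f\<close>.

  The conclusion is drawn from the fibres of \<open>u\<close>.  On a non-empty fibre, which is compact,
  \<open>f\<close> has a maximum \<open>p\<close>.  The flow line through \<open>p\<close> stays in the fibre, so \<open>f\<close> cannot increase along it,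
  and \<open>p\<close> is a critical point.  Every value of \<open>u\<close> is thus attained at a critical point of \<open>f\<close>.  The
  critical points of a Morse function on a compact manifold are finite in number, so the image of \<open>u\<close> is
  finite and connected: a single point.

  The bulk of the work is the identification of the Lie derivative, because flow, parallel transport and
  all derivatives have to be shown to exist.  It is carried out in a chart \<open>c\<close> of the source and a
  chart \<open>d\<close> of the target.  There \<open>u\<close> becomes a map \<open>U\<close> between open subsets of vector spaces, \<open>X\<close> a vector
  valued function, and the connection is given by Christoffel symbols \<open>\<Gamma>\<close>.  With \<open>w = dU(X)\<close>, the Lie
  derivative on a vector \<open>v\<close> is
  \<open>D\<^sup>2U(X, v) + dU(dX(v)) + \<Gamma>(w, dU(v))\<close>: the first two terms come from the flow, whose differential
  satisfies the linearised equation (\<open>smooth_local_flow\<close>), the last one from parallel transport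
  (\<open>transport_back_derivative\<close>).  By the symmetry of \<open>D\<^sup>2U\<close> and of \<open>\<Gamma>\<close> this is
  \<open>dw(v) + \<Gamma>(dU(v), w)\<close> (\<open>conn_lie_deriv_differential\<close>).  When it is zero for all \<open>v\<close>, the norm of \<open>w\<close>
  satisfies a linear differential inequality along segments, and the Gronwall argument of
  \<open>zero_set_locally_open\<close> shows that the zero set of \<open>du(X)\<close> is open.
\<close>


section \<open>Finite-dimensionality of locally compact normed spaces\<close>

text \<open>
  If t is not zero, dividing by t exhibits b, up to the vector x / t, as an element of the span; so
  x / t is at least as long as the distance of b from the span.
\<close>

lemma span_insert_infdist:
  fixes b :: "'a::real_normed_vector"
  assumes "x - t *\<^sub>R b \<in> span S"
  shows "\<bar>t\<bar> * infdist b (span S) \<le> norm x"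
proof (cases "t = 0")
  case False
  have "- ((1/t) *\<^sub>R (x - t *\<^sub>R b)) \<in> span S"
    using assms by (intro span_neg span_scale)
  then have "infdist b (span S) \<le> dist b (- ((1/t) *\<^sub>R (x - t *\<^sub>R b)))"
    by (rule infdist_le)
  also have "\<dots> = norm ((1/t) *\<^sub>R x)"
    using False by (simp add: dist_norm scaleR_diff_right)
  finally show ?thesis using False by (simp add: field_simps)
qed simp

text \<open>
  In a convergent sequence the coefficients of b form a Cauchy sequence by the previous estimate, so
  both parts of the decomposition converge.
\<close>

lemma closed_span_insert:
  fixes b :: "'a::{real_normed_vector,heine_borel}"
  assumes S: "closed (span S)" and b: "b \<notin> span S"
  shows "closed (span (insert b S))"
  unfolding closed_sequential_limits
proof (intro allI impI)
  fix X l assume X: "(\<forall>n. X n \<in> span (insert b S)) \<and> X \<longlonglongrightarrow> l"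
  define d where "d = infdist b (span S)"
  have d: "d > 0"
    unfolding d_def using infdist_pos_not_in_closed[OF S _ b] span_zero by blast
  have "\<forall>n. \<exists>t. X n - t *\<^sub>R b \<in> span S"
    using X by (auto simp: span_breakdown_eq)
  then obtain t where t: "\<And>n. X n - t n *\<^sub>R b \<in> span S" by metis
  have tb: "\<bar>t n - t m\<bar> \<le> norm (X n - X m) / d" for n m
  proof -
    have "(X n - X m) - (t n - t m) *\<^sub>R b \<in> span S"
      using span_diff[OF t[of n] t[of m]] by (simp add: algebra_simps)
    from span_insert_infdist[OF this] show ?thesis
      using d by (simp add: d_def field_simps)
  qed
  have "Cauchy X" using X LIMSEQ_imp_Cauchy by blast
  have "Cauchy t"
  proof (rule metric_CauchyI)
    fix e :: real assume "e > 0"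
    then obtain M where M: "\<forall>m\<ge>M. \<forall>n\<ge>M. dist (X m) (X n) < e * d"
      using metric_CauchyD[OF \<open>Cauchy X\<close>, of "e * d"] d by (meson mult_pos_pos)
    have "dist (t m) (t n) < e" if "m \<ge> M" "n \<ge> M" for m n
    proof -
      have "norm (X m - X n) / d < e"
        using M that d by (simp add: dist_norm field_simps)
      then show ?thesis using tb[of m n] by (simp add: dist_real_def)
    qed
    then show "\<exists>M. \<forall>m\<ge>M. \<forall>n\<ge>M. dist (t m) (t n) < e" by blast
  qed
  then obtain T where T: "t \<longlonglongrightarrow> T" using Cauchy_convergent_iff convergent_def by blast
  have "(\<lambda>n. X n - t n *\<^sub>R b) \<longlonglongrightarrow> l - T *\<^sub>R b"
    using X T by (intro tendsto_intros) auto
  then have "l - T *\<^sub>R b \<in> span S"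
    by (rule closed_sequentially[OF S t])
  then show "l \<in> span (insert b S)" by (auto simp: span_breakdown_eq)
qed

text \<open>
  The two claims are proved together: since the span of S is closed, a new basis vector has a positive
  distance from it, and this bounds its coefficient.
\<close>

lemma independent_coefficients_bounded:
  fixes S :: "'a::{real_normed_vector,heine_borel} set"
  assumes "finite S" "independent S"
  shows "closed (span S) \<and> (\<exists>K. \<forall>c. (\<Sum>b\<in>S. \<bar>c b\<bar>) \<le> K * norm (\<Sum>b\<in>S. c b *\<^sub>R b))"
  using assms
proof (induction S rule: finite_induct)
  case empty
  then show ?case by auto
next
  case (insert b S)
  then have b: "b \<notin> span S" and "independent S"
    by (auto simp: independent_insert)
  with insert obtain K where S: "closed (span S)"
    and K: "\<And>c. (\<Sum>b\<in>S. \<bar>c b\<bar>) \<le> K * norm (\<Sum>b\<in>S. c b *\<^sub>R b)" by blast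
  define d where "d = infdist b (span S)"
  have d: "d > 0"
    unfolding d_def using infdist_pos_not_in_closed[OF S _ b] span_zero by blast
  have "(\<Sum>a\<in>insert b S. \<bar>c a\<bar>) \<le> (1 / d + \<bar>K\<bar> * (1 + norm b / d)) * norm (\<Sum>a\<in>insert b S. c a *\<^sub>R a)" for c
  proof -
    define x where "x = (\<Sum>a\<in>insert b S. c a *\<^sub>R a)"
    have x: "x - c b *\<^sub>R b = (\<Sum>a\<in>S. c a *\<^sub>R a)"
      unfolding x_def using insert by simp
    have "x - c b *\<^sub>R b \<in> span S"
      unfolding x by (intro span_sum span_scale span_base)
    from span_insert_infdist[OF this] have cb: "\<bar>c b\<bar> \<le> norm x / d"
      using d by (simp add: d_def field_simps)
    have "(\<Sum>a\<in>S. \<bar>c a\<bar>) \<le> K * norm (x - c b *\<^sub>R b)" using K[of c] x by simp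
    also have "\<dots> \<le> \<bar>K\<bar> * (norm x + \<bar>c b\<bar> * norm b)"
      using norm_triangle_ineq4[of x "c b *\<^sub>R b"]
      by (intro mult_mono) auto
    also have "\<dots> \<le> \<bar>K\<bar> * (norm x + norm x / d * norm b)"
      using cb by (intro mult_left_mono add_left_mono mult_right_mono) auto
    finally have "(\<Sum>a\<in>S. \<bar>c a\<bar>) \<le> \<bar>K\<bar> * (norm x + norm x / d * norm b)" .
    moreover have "(\<Sum>a\<in>insert b S. \<bar>c a\<bar>) = \<bar>c b\<bar> + (\<Sum>a\<in>S. \<bar>c a\<bar>)"
      using insert by simp
    ultimately have "(\<Sum>a\<in>insert b S. \<bar>c a\<bar>) \<le> norm x / d + \<bar>K\<bar> * (norm x + norm x / d * norm b)"
      using cb by linarith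
    also have "\<dots> = (1 / d + \<bar>K\<bar> * (1 + norm b / d)) * norm x"
      by (simp add: algebra_simps)
    finally show ?thesis unfolding x_def .
  qed
  then show ?case using closed_span_insert[OF S b] by blast
qed

text \<open>
  Riesz's theorem.  Finitely many balls of radius 1/2 cover the unit ball.  If the span V of their
  centres were not everything, a point x outside V and an almost nearest point of V would give a unit vector
  which is too far from all the centres.
\<close>

lemma finite_basis_exists:
  "\<exists>S::'a::{real_normed_vector,heine_borel} set. finite S \<and> independent S \<and> span S = UNIV"
proof -
  have cpt: "compact (cball (0::'a) 1)" by simp
  have opn: "open (ball c (1/2))" if "c \<in> cball 0 1" for c :: 'a by simp
  have cov: "cball (0::'a) 1 \<subseteq> (\<Union>c\<in>cball 0 1. ball c (1/2))"
  proof
    fix x :: 'a assume "x \<in> cball 0 1"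
    then show "x \<in> (\<Union>c\<in>cball 0 1. ball c (1/2))"
      by (intro UN_I[of x]) simp_all
  qed
  obtain F where F: "F \<subseteq> cball (0::'a) 1" "finite F" "cball (0::'a) 1 \<subseteq> (\<Union>c\<in>F. ball c (1/2))"
    by (rule compactE_image[OF cpt opn cov])
  obtain S where S: "S \<subseteq> F" "independent S" "F \<subseteq> span S"
    using maximal_independent_subset[of F] by blast
  have fin: "finite S" using S F finite_subset by blast
  have "closed (span S)"
    by (rule independent_coefficients_bounded[OF fin S(2), THEN conjunct1])
  have "x \<in> span S" for x
  proof (rule ccontr)
    assume x: "x \<notin> span S"
    define d where "d = infdist x (span S)"
    have d: "d > 0"
      unfolding d_def using infdist_pos_not_in_closed[OF \<open>closed (span S)\<close> _ x] span_zero by blast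
    obtain v where v: "v \<in> span S" "dist x v < 3/2 * d"
      using infdist_attains_inf
    proof -
      obtain v where "v \<in> span S" "infdist x (span S) = dist x v"
        using infdist_attains_inf[OF \<open>closed (span S)\<close>] span_zero by blast
      then show ?thesis using that d unfolding d_def by auto
    qed
    have n: "norm (x - v) \<ge> d" using infdist_le[OF v(1), of x] by (simp add: d_def dist_norm)
    then have n0: "norm (x - v) > 0" using d by linarith
    have "(1 / norm (x - v)) *\<^sub>R (x - v) \<in> cball 0 1" using n0 by simp
    then have "(1 / norm (x - v)) *\<^sub>R (x - v) \<in> (\<Union>c\<in>F. ball c (1/2))"
      using F(3) by blast
    then obtain c where c: "c \<in> F" "dist c ((1 / norm (x - v)) *\<^sub>R (x - v)) < 1/2"
      unfolding UN_iff mem_ball by blast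
    have "v + norm (x - v) *\<^sub>R c \<in> span S" using v c S by (intro span_add span_scale) auto
    then have "d \<le> dist x (v + norm (x - v) *\<^sub>R c)" unfolding d_def by (rule infdist_le)
    also have "\<dots> = norm (norm (x - v) *\<^sub>R ((1 / norm (x - v)) *\<^sub>R (x - v) - c))"
      using n0 by (simp add: dist_norm scaleR_diff_right algebra_simps)
    also have "\<dots> = norm (x - v) * dist c ((1 / norm (x - v)) *\<^sub>R (x - v))"
      by (simp add: dist_norm norm_minus_commute)
    also have "\<dots> \<le> norm (x - v) * (1/2)" using c by (intro mult_left_mono) auto
    also have "\<dots> < d" using v(2) d by (simp add: dist_norm)
    finally show False by simp
  qed
  then show ?thesis using fin S by blast
qed


text \<open>
  A fixed basis plays the role that Basis plays in Euclidean spaces.  It is empty in dimension 0.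
\<close>

definition fbasis :: "'a::{real_normed_vector,heine_borel} set" where
  "fbasis = (SOME S. finite S \<and> independent S \<and> span S = UNIV)"

definition coord :: "'a::{real_normed_vector,heine_borel} \<Rightarrow> 'a \<Rightarrow> real" where
  "coord b x = representation fbasis x b"

lemma fbasis: "finite (fbasis :: 'a::{real_normed_vector,heine_borel} set)"
  "independent (fbasis :: 'a set)" "span (fbasis :: 'a set) = UNIV"
  using someI_ex[OF finite_basis_exists[where 'a='a]] unfolding fbasis_def by auto

lemma sum_coord: "(\<Sum>b\<in>fbasis. coord b x *\<^sub>R b) = x"
  unfolding coord_def using fbasis by (intro real_vector.sum_representation_eq) auto

lemma linear_coord: "linear (coord b)"
proof (rule linearI)
  have "x \<in> span fbasis" for x :: 'a using fbasis(3) by blast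
  then show "coord b (x + y) = coord b x + coord b y" "coord b (r *\<^sub>R x) = r *\<^sub>R coord b x" for x y r
    unfolding coord_def
    by (simp_all add: real_vector.representation_add[OF fbasis(2)] real_vector.representation_scale[OF fbasis(2)])
qed

lemma coord_bound:
  obtains C where "C > 0" "\<And>x::'a::{real_normed_vector,heine_borel}. (\<Sum>b\<in>fbasis. \<bar>coord b x\<bar>) \<le> C * norm x"
proof -
  obtain K where K: "\<And>c. (\<Sum>b\<in>(fbasis::'a set). \<bar>c b\<bar>) \<le> K * norm (\<Sum>b\<in>(fbasis::'a set). c b *\<^sub>R b)"
    using independent_coefficients_bounded[OF fbasis(1,2)[where 'a='a], THEN conjunct2] by auto
  show thesis
  proof (rule that[of "\<bar>K\<bar> + 1"])
    fix x :: 'a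
    have "(\<Sum>b\<in>fbasis. \<bar>coord b x\<bar>) \<le> K * norm x"
      using K[of "\<lambda>b. coord b x"] by (simp add: sum_coord)
    also have "\<dots> \<le> (\<bar>K\<bar> + 1) * norm x" by (intro mult_right_mono) auto
    finally show "(\<Sum>b\<in>fbasis. \<bar>coord b x\<bar>) \<le> (\<bar>K\<bar> + 1) * norm x" .
  qed simp
qed

lemma linear_expand_coord:
  fixes f :: "'a::{real_normed_vector,heine_borel} \<Rightarrow> 'b::real_vector"
  assumes "linear f"
  shows "f x = (\<Sum>b\<in>fbasis. coord b x *\<^sub>R f b)"
proof -
  have "f x = f (\<Sum>b\<in>fbasis. coord b x *\<^sub>R b)" by (simp add: sum_coord)
  also have "\<dots> = (\<Sum>b\<in>fbasis. coord b x *\<^sub>R f b)"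
    using assms by (simp add: linear_sum linear_cmul)
  finally show ?thesis .
qed

lemma bounded_linear_coord: "bounded_linear (coord b)"
proof (cases "b \<in> fbasis")
  case True
  obtain C where C: "\<And>x::'a. (\<Sum>b\<in>fbasis. \<bar>coord b x\<bar>) \<le> C * norm x"
    using coord_bound[where 'a='a] by blast
  have "norm (coord b x) \<le> norm x * C" for x
  proof -
    have "norm (coord b x) \<le> (\<Sum>b\<in>fbasis. \<bar>coord b x\<bar>)"
      using member_le_sum[OF True, of "\<lambda>b. \<bar>coord b x\<bar>"] fbasis(1) by simp
    then show ?thesis using C[of x] by (simp add: mult.commute)
  qed
  then show ?thesis
    using linear_coord[of b] by (intro bounded_linear_intro) (auto simp: linear_add linear_cmul)
next
  case False
  then have "coord b = (\<lambda>x. 0)"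
    unfolding coord_def using real_vector.representation_ne_zero by blast
  then show ?thesis by simp
qed

text \<open>
  One constant serves all linear maps, so that bounds on the values on the basis can be made uniform in
  a family of maps.
\<close>

lemma linear_bound_coord:
  "\<exists>C>0. \<forall>(f :: 'a::{real_normed_vector,heine_borel} \<Rightarrow> 'b::real_normed_vector) K x. linear f \<longrightarrow>
    (\<forall>b\<in>fbasis. norm (f b) \<le> K) \<longrightarrow> norm (f x) \<le> C * K * norm x"
proof -
  obtain C where C: "C > 0" "\<And>x::'a. (\<Sum>b\<in>fbasis. \<bar>coord b x\<bar>) \<le> C * norm x"
    using coord_bound[where 'a='a] by blast
  have "norm (f x) \<le> C * K * norm x"
    if f: "linear f" "\<forall>b\<in>fbasis. norm (f b) \<le> K" for f :: "'a \<Rightarrow> 'b" and K x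
  proof (cases "fbasis = ({} :: 'a set)")
    case True
    then have "x = 0" using sum_coord[of x] by simp
    then show ?thesis using f by (simp add: linear_0)
  next
    case False
    then have K: "K \<ge> 0" using f(2) norm_ge_zero order_trans by blast
    have "norm (f x) \<le> (\<Sum>b\<in>fbasis. norm (coord b x *\<^sub>R f b))"
      unfolding linear_expand_coord[OF f(1), of x] by (rule norm_sum)
    also have "\<dots> \<le> (\<Sum>b\<in>fbasis. \<bar>coord b x\<bar> * K)"
      using f by (intro sum_mono) (simp add: mult_left_mono)
    also have "\<dots> = K * (\<Sum>b\<in>fbasis. \<bar>coord b x\<bar>)" by (simp add: sum_distrib_left mult.commute)
    also have "\<dots> \<le> K * (C * norm x)" using C K by (intro mult_left_mono) auto
    finally show "norm (f x) \<le> C * K * norm x" by (simp add: mult_ac)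
  qed
  then show ?thesis using C(1) by blast
qed

lemma linear_imp_bounded_linear:
  fixes f :: "'a::{real_normed_vector,heine_borel} \<Rightarrow> 'b::real_normed_vector"
  assumes "linear f"
  shows "bounded_linear f"
proof -
  have "bounded_linear (\<lambda>x. \<Sum>b\<in>fbasis. coord b x *\<^sub>R f b)"
    by (intro bounded_linear_sum bounded_linear_scaleR_const bounded_linear_coord)
  moreover have "f = (\<lambda>x. \<Sum>b\<in>fbasis. coord b x *\<^sub>R f b)"
    by (rule ext) (rule linear_expand_coord[OF assms])
  ultimately show ?thesis by (rule back_subst[where P=bounded_linear, OF _ sym])
qed

section \<open>Functions of class C^k\<close>

abbreviation dder :: "('a::real_normed_vector \<Rightarrow> 'b::real_normed_vector) \<Rightarrow> 'a \<Rightarrow> 'a \<Rightarrow> 'b" where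
  "dder f x \<equiv> frechet_derivative f (at x)"

lemma dderI: "(f has_derivative f') (at x) \<Longrightarrow> dder f x = f'"
  using frechet_derivative_at by metis

lemma has_derivative_dder: "f differentiable (at x) \<Longrightarrow> (f has_derivative dder f x) (at x)"
  using frechet_derivative_works by blast

lemma linear_dder: "f differentiable (at x) \<Longrightarrow> linear (dder f x)"
  using linear_frechet_derivative .

lemma dder_cong:
  assumes "open S" "x \<in> S" "\<And>y. y \<in> S \<Longrightarrow> f y = g y"
  shows "dder f x = dder g x"
proof -
  have "(f has_derivative D) (at x) \<longleftrightarrow> (g has_derivative D) (at x)" for D
    using has_derivative_transform_within_open[OF _ assms(1,2)] assms(3) by metis
  then show ?thesis unfolding frechet_derivative_def by simp
qed

lemma differentiable_cong_open:
  assumes "open S" "x \<in> S" "\<And>y. y \<in> S \<Longrightarrow> f y = g y" "f differentiable (at x)"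
  shows "g differentiable (at x)"
  using assms has_derivative_transform_within_open unfolding differentiable_def by metis

lemma Ck_on_dder: "Ck_on (Suc k) S f \<Longrightarrow> Ck_on k S (\<lambda>x. dder f x v)"
  by simp

lemma Ck_on_subset: "Ck_on k S f \<Longrightarrow> T \<subseteq> S \<Longrightarrow> Ck_on k T f"
  by (induction k arbitrary: f) (auto intro: continuous_on_subset)

lemma Ck_on_cong:
  assumes "open S" "\<And>y. y \<in> S \<Longrightarrow> f y = g y" "Ck_on k S f"
  shows "Ck_on k S g"
  using assms(2,3)
proof (induction k arbitrary: f g)
  case 0
  then show ?case by (auto intro: continuous_on_eq)
next
  case (Suc k)
  have "g differentiable (at x)" if "x \<in> S" for x
    using differentiable_cong_open[OF assms(1) that, of f g] Suc that by auto
  moreover have "Ck_on k S (\<lambda>x. dder g x v)" for v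
  proof (rule Suc.IH)
    show "dder f y v = dder g y v" if "y \<in> S" for y
      using dder_cong[OF assms(1) that, of f g] Suc by auto
  qed (use Suc in auto)
  ultimately show ?case by simp
qed

lemma Ck_on_mono_Suc: "Ck_on (Suc k) S f \<Longrightarrow> Ck_on k S f"
proof (induction k arbitrary: f)
  case 0
  then have "f differentiable_on S"
    unfolding differentiable_on_def by (auto intro: differentiable_at_withinI)
  then show ?case by (simp add: differentiable_imp_continuous_on)
next
  case (Suc k)
  then show ?case by (metis Ck_on.simps(2))
qed

lemma Ck_on_mono: "Ck_on k S f \<Longrightarrow> j \<le> k \<Longrightarrow> Ck_on j S f"
  by (induction k) (auto simp: le_Suc_eq simp del: Ck_on.simps dest: Ck_on_mono_Suc)

lemma Ck_on_continuous: "Ck_on k S f \<Longrightarrow> continuous_on S f"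
  using Ck_on_mono[of k S f 0] by simp

lemma Ck_on_Union:
  assumes "\<And>x. x \<in> S \<Longrightarrow> \<exists>U. open U \<and> x \<in> U \<and> Ck_on k U f"
  shows "Ck_on k S f"
  using assms
proof (induction k arbitrary: f)
  case 0
  have "continuous (at x within S) f" if "x \<in> S" for x
    using 0[OF that] by (auto simp: continuous_on_eq_continuous_at intro: continuous_at_imp_continuous_at_within)
  then show ?case by (auto simp: continuous_on_eq_continuous_within)
next
  case (Suc k)
  have "f differentiable (at x)" if "x \<in> S" for x using Suc.prems[OF that] by auto
  moreover have "Ck_on k S (\<lambda>x. dder f x v)" for v
    using Suc.prems by (intro Suc.IH) (auto, blast)
  ultimately show ?case by simp
qed

lemma Ck_on_const [simp]: "Ck_on k S (\<lambda>x. c)"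
proof (induction k arbitrary: c)
  case (Suc k)
  then show ?case by simp
qed simp

lemma Ck_on_bounded_linear_comp:
  assumes "bounded_linear h" "open S" "Ck_on k S f"
  shows "Ck_on k S (\<lambda>x. h (f x))"
  using assms(3)
proof (induction k arbitrary: f)
  case 0
  then show ?case using assms(1) by (auto intro: bounded_linear.continuous_on)
next
  case (Suc k)
  have D: "((\<lambda>x. h (f x)) has_derivative (\<lambda>v. h (dder f x v))) (at x)" if "x \<in> S" for x
    using bounded_linear.has_derivative[OF assms(1) has_derivative_dder] Suc.prems that by auto
  have "Ck_on k S (\<lambda>x. dder (\<lambda>x. h (f x)) x v)" for v
    by (rule Ck_on_cong[OF assms(2) _ Suc.IH[of "\<lambda>x. dder f x v"]])
       (use Suc.prems dderI[OF D] in auto)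
  then show ?case using D by (auto simp: differentiable_def)
qed

lemma Ck_on_add:
  assumes "open S" "Ck_on k S f" "Ck_on k S g"
  shows "Ck_on k S (\<lambda>x. f x + g x)"
  using assms(2,3)
proof (induction k arbitrary: f g)
  case 0
  then show ?case by (auto intro: continuous_on_add)
next
  case (Suc k)
  have D: "((\<lambda>x. f x + g x) has_derivative (\<lambda>v. dder f x v + dder g x v)) (at x)" if "x \<in> S" for x
    using Suc.prems that by (intro has_derivative_add has_derivative_dder) auto
  have "Ck_on k S (\<lambda>x. dder (\<lambda>x. f x + g x) x v)" for v
    by (rule Ck_on_cong[OF assms(1) _ Suc.IH[of "\<lambda>x. dder f x v" "\<lambda>x. dder g x v"]])
       (use Suc.prems dderI[OF D] in auto)
  then show ?case using D by (auto simp: differentiable_def)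
qed

lemma Ck_on_bilinear:
  assumes "bounded_bilinear h" "open S" "Ck_on k S f" "Ck_on k S g"
  shows "Ck_on k S (\<lambda>x. h (f x) (g x))"
  using assms(3,4)
proof (induction k arbitrary: f g)
  case 0
  then show ?case using bounded_bilinear.continuous_on[OF assms(1)] by auto
next
  case (Suc k)
  have D: "((\<lambda>x. h (f x) (g x)) has_derivative (\<lambda>v. h (f x) (dder g x v) + h (dder f x v) (g x))) (at x)"
    if "x \<in> S" for x
    using Suc.prems that by (intro bounded_bilinear.FDERIV[OF assms(1)] has_derivative_dder) auto
  have "Ck_on k S (\<lambda>x. h (f x) (dder g x v) + h (dder f x v) (g x))" for v
    by (intro Ck_on_add assms(2) Suc.IH Ck_on_dder Suc.prems Ck_on_mono_Suc[OF Suc.prems(1)] Ck_on_mono_Suc[OF Suc.prems(2)])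
  then have "Ck_on k S (\<lambda>x. dder (\<lambda>x. h (f x) (g x)) x v)" for v
    by (rule Ck_on_cong[OF assms(2), rotated]) (use dderI[OF D] in auto)
  then show ?case using D by (auto simp: differentiable_def)
qed

lemma Ck_on_sum:
  assumes "open S" "\<And>i. i \<in> I \<Longrightarrow> Ck_on k S (f i)"
  shows "Ck_on k S (\<lambda>x. \<Sum>i\<in>I. f i x)"
  using assms(2)
proof (induction I rule: infinite_finite_induct)
  case (insert i I)
  then show ?case using Ck_on_add[OF assms(1), of k "f i" "\<lambda>x. \<Sum>i\<in>I. f i x"] by simp
qed simp_all

lemma Ck_on_ident: "open S \<Longrightarrow> Ck_on k S (\<lambda>x. x)"
  by (cases k) auto

lemma Ck_on_bounded_linear: "bounded_linear h \<Longrightarrow> open S \<Longrightarrow> Ck_on k S h"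
  using Ck_on_bounded_linear_comp[of h S k "\<lambda>x. x"] Ck_on_ident by blast

lemma Ck_on_scaleR: "open S \<Longrightarrow> Ck_on k S f \<Longrightarrow> Ck_on k S g \<Longrightarrow> Ck_on k S (\<lambda>x. f x *\<^sub>R g x)"
  by (rule Ck_on_bilinear[OF bounded_bilinear_scaleR])

lemma Ck_on_mult:
  fixes f g :: "_ \<Rightarrow> real"
  shows "open S \<Longrightarrow> Ck_on k S f \<Longrightarrow> Ck_on k S g \<Longrightarrow> Ck_on k S (\<lambda>x. f x * g x)"
  by (rule Ck_on_bilinear[OF bounded_bilinear_mult])

lemma Ck_on_minus: "open S \<Longrightarrow> Ck_on k S f \<Longrightarrow> Ck_on k S (\<lambda>x. - f x)"
  by (rule Ck_on_bounded_linear_comp[OF bounded_linear_minus[OF bounded_linear_ident]])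

lemma Ck_on_diff: "open S \<Longrightarrow> Ck_on k S f \<Longrightarrow> Ck_on k S g \<Longrightarrow> Ck_on k S (\<lambda>x. f x - g x)"
  using Ck_on_add[OF _ _ Ck_on_minus, of S k f g] by simp

text \<open>
  The chain rule produces the differential of f applied to a moving vector, whereas \<open>Ck_on\<close> speaks about
  constant directions; expanding the moving vector in the basis reduces one to the other.
\<close>

lemma Ck_on_compose:
  fixes f :: "'b::{real_normed_vector,heine_borel} \<Rightarrow> 'c::real_normed_vector"
    and g :: "'a::real_normed_vector \<Rightarrow> 'b"
  assumes "open S" "open T" "g ` S \<subseteq> T" "Ck_on k T f" "Ck_on k S g"
  shows "Ck_on k S (\<lambda>x. f (g x))"
  using assms(4,5)
proof (induction k arbitrary: f)
  case 0
  then show ?case using assms(3) by (auto intro: continuous_on_compose2)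
next
  case (Suc k)
  have D: "((\<lambda>x. f (g x)) has_derivative (\<lambda>v. dder f (g x) (dder g x v))) (at x)" if "x \<in> S" for x
    using Suc.prems that assms(3)
    by (intro has_derivative_compose[of g "dder g x" x UNIV f] has_derivative_dder) auto
  have gk: "Ck_on k S g" using Suc.prems Ck_on_mono_Suc by blast
  have C: "Ck_on k S (\<lambda>x. \<Sum>b\<in>fbasis. coord b (dder g x v) *\<^sub>R dder f (g x) b)" for v
  proof (intro Ck_on_sum Ck_on_scaleR assms(1))
    fix b :: 'b
    show "Ck_on k S (\<lambda>x. coord b (dder g x v))"
      using Suc.prems by (intro Ck_on_bounded_linear_comp[OF bounded_linear_coord assms(1)]) auto
    show "Ck_on k S (\<lambda>x. dder f (g x) b)"
      using Suc.prems gk Suc.IH[of "\<lambda>y. dder f y b"] by auto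
  qed
  have E: "(\<Sum>b\<in>fbasis. coord b (dder g x v) *\<^sub>R dder f (g x) b) = dder (\<lambda>x. f (g x)) x v" if "x \<in> S" for x v
  proof -
    have "f differentiable (at (g x))" using Suc.prems(1) that assms(3) by auto
    from linear_expand_coord[OF linear_dder[OF this], of "dder g x v"]
    show ?thesis unfolding dderI[OF D[OF that]] by simp
  qed
  have "Ck_on k S (\<lambda>x. dder (\<lambda>x. f (g x)) x v)" for v
    by (rule Ck_on_cong[OF assms(1) E C])
  then show ?case using D by (auto simp: differentiable_def)
qed

lemma Ck_on_inverse:
  fixes h :: "'a::real_normed_vector \<Rightarrow> real"
  assumes "open S" "\<And>x. x \<in> S \<Longrightarrow> h x \<noteq> 0" "Ck_on k S h"
  shows "Ck_on k S (\<lambda>x. inverse (h x))"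
  using assms(3)
proof (induction k)
  case 0
  then show ?case using assms(2) by (auto intro: continuous_on_inverse)
next
  case (Suc k)
  have D: "((\<lambda>x. inverse (h x)) has_derivative (\<lambda>v. - (inverse (h x) * dder h x v * inverse (h x)))) (at x)"
    if "x \<in> S" for x
    using Suc.prems that assms(2)
    by (intro Deriv.has_derivative_inverse[OF _ has_derivative_dder]) auto
  have "Ck_on k S (\<lambda>x. inverse (h x))" using Suc Ck_on_mono_Suc by blast
  then have "Ck_on k S (\<lambda>x. - (inverse (h x) * dder h x v * inverse (h x)))" for v
    using Suc.prems by (intro Ck_on_minus Ck_on_mult assms(1)) auto
  then have "Ck_on k S (\<lambda>x. dder (\<lambda>x. inverse (h x)) x v)" for v
    by (rule Ck_on_cong[OF assms(1), rotated]) (use dderI[OF D] in auto)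
  then show ?case using D by (auto simp: differentiable_def)
qed

lemma Ck_on_differentiable: "Ck_on (Suc k) S f \<Longrightarrow> x \<in> S \<Longrightarrow> f differentiable (at x)"
  by simp

lemma smooth_on_Ck: "smooth_on S f \<Longrightarrow> Ck_on k S f"
  unfolding smooth_on_def by blast

lemma smooth_on_dder: "smooth_on S f \<Longrightarrow> smooth_on S (\<lambda>x. dder f x v)"
  unfolding smooth_on_def by (metis Ck_on.simps(2))

lemma smooth_on_differentiable: "smooth_on S f \<Longrightarrow> x \<in> S \<Longrightarrow> f differentiable (at x)"
  using smooth_on_Ck[of S f 1] by simp


lemma smooth_on_cong: "open S \<Longrightarrow> (\<And>y. y \<in> S \<Longrightarrow> f y = g y) \<Longrightarrow> smooth_on S f \<Longrightarrow> smooth_on S g"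
  unfolding smooth_on_def by (meson Ck_on_cong)

lemma smooth_on_subset: "smooth_on S f \<Longrightarrow> T \<subseteq> S \<Longrightarrow> smooth_on T f"
  unfolding smooth_on_def using Ck_on_subset by blast

lemma smooth_on_Union:
  assumes "\<And>x. x \<in> S \<Longrightarrow> \<exists>U. open U \<and> x \<in> U \<and> smooth_on U f"
  shows "smooth_on S f"
  unfolding smooth_on_def
proof
  show "Ck_on k S f" for k
    by (rule Ck_on_Union) (use assms smooth_on_Ck in blast)
qed

lemma smooth_on_const [simp]: "smooth_on S (\<lambda>x. c)"
  by (simp add: smooth_on_def)

lemma smooth_on_bounded_linear_comp:
  "bounded_linear h \<Longrightarrow> open S \<Longrightarrow> smooth_on S f \<Longrightarrow> smooth_on S (\<lambda>x. h (f x))"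
  by (simp add: smooth_on_def Ck_on_bounded_linear_comp)

lemma smooth_on_bounded_linear: "bounded_linear h \<Longrightarrow> open S \<Longrightarrow> smooth_on S h"
  by (simp add: smooth_on_def Ck_on_bounded_linear)

lemma smooth_on_add: "open S \<Longrightarrow> smooth_on S f \<Longrightarrow> smooth_on S g \<Longrightarrow> smooth_on S (\<lambda>x. f x + g x)"
  by (simp add: smooth_on_def Ck_on_add)

lemma smooth_on_diff: "open S \<Longrightarrow> smooth_on S f \<Longrightarrow> smooth_on S g \<Longrightarrow> smooth_on S (\<lambda>x. f x - g x)"
  by (simp add: smooth_on_def Ck_on_diff)

lemma smooth_on_sum: "open S \<Longrightarrow> (\<And>i. i \<in> I \<Longrightarrow> smooth_on S (f i)) \<Longrightarrow> smooth_on S (\<lambda>x. \<Sum>i\<in>I. f i x)"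
  by (simp add: smooth_on_def Ck_on_sum)

lemma smooth_on_scaleR: "open S \<Longrightarrow> smooth_on S f \<Longrightarrow> smooth_on S g \<Longrightarrow> smooth_on S (\<lambda>x. f x *\<^sub>R g x)"
  by (simp add: smooth_on_def Ck_on_scaleR)

lemma smooth_on_mult:
  fixes f g :: "_ \<Rightarrow> real"
  shows "open S \<Longrightarrow> smooth_on S f \<Longrightarrow> smooth_on S g \<Longrightarrow> smooth_on S (\<lambda>x. f x * g x)"
  by (simp add: smooth_on_def Ck_on_mult)

lemma smooth_on_inverse:
  fixes h :: "'a::real_normed_vector \<Rightarrow> real"
  shows "open S \<Longrightarrow> (\<And>x. x \<in> S \<Longrightarrow> h x \<noteq> 0) \<Longrightarrow> smooth_on S h \<Longrightarrow> smooth_on S (\<lambda>x. inverse (h x))"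
  by (simp add: smooth_on_def Ck_on_inverse)

lemma smooth_on_compose:
  fixes f :: "'b::{real_normed_vector,heine_borel} \<Rightarrow> 'c::real_normed_vector"
  shows "open S \<Longrightarrow> open T \<Longrightarrow> g ` S \<subseteq> T \<Longrightarrow> smooth_on T f \<Longrightarrow> smooth_on S g \<Longrightarrow> smooth_on S (\<lambda>x. f (g x))"
  unfolding smooth_on_def using Ck_on_compose by blast

lemma smooth_on_continuous: "smooth_on S f \<Longrightarrow> continuous_on S f"
  using smooth_on_Ck Ck_on_continuous by blast

subsection \<open>Local estimates\<close>

text \<open>
  Linear maps depending continuously on a parameter, in the sense that the value at each fixed vector is
  continuous.  In finite dimension this suffices for local uniform bounds and for joint continuity.
\<close>

lemma linear_family_bounded_on_compact:
  fixes N :: "'t::topological_space \<Rightarrow> 'a::{real_normed_vector,heine_borel} \<Rightarrow> 'b::real_normed_vector"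
  assumes K: "compact K" and lin: "\<And>q. q \<in> K \<Longrightarrow> linear (N q)" and cont: "\<And>b. continuous_on K (\<lambda>q. N q b)"
  shows "\<exists>L\<ge>0. \<forall>q\<in>K. \<forall>v. norm (N q v) \<le> L * norm v"
proof -
  obtain C where C0: "C > 0" and CC: "\<forall>(f :: 'a \<Rightarrow> 'b) K x. linear f \<longrightarrow>
    (\<forall>b\<in>fbasis. norm (f b) \<le> K) \<longrightarrow> norm (f x) \<le> C * K * norm x"
    using linear_bound_coord[where 'a='a and 'b='b] by (elim exE conjE) (rule that)
  have "continuous_on K (\<lambda>q. \<Sum>b\<in>fbasis. norm (N q b))"
    by (intro continuous_on_sum continuous_on_norm cont)
  then have "bounded ((\<lambda>q. \<Sum>b\<in>fbasis. norm (N q b)) ` K)"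
    using K compact_imp_bounded compact_continuous_image by blast
  then obtain M where M: "\<And>q. q \<in> K \<Longrightarrow> \<bar>\<Sum>b\<in>fbasis. norm (N q b)\<bar> \<le> M"
    unfolding bounded_iff by auto
  have "norm (N q v) \<le> C * \<bar>M\<bar> * norm v" if q: "q \<in> K" for q v
  proof -
    have "norm (N q b) \<le> \<bar>M\<bar>" if "b \<in> fbasis" for b
    proof -
      have "norm (N q b) \<le> (\<Sum>b\<in>fbasis. norm (N q b))"
        using that fbasis(1) by (intro member_le_sum) auto
      then show ?thesis using M[OF q] by linarith
    qed
    then show ?thesis using CC lin[OF q] by blast
  qed
  then show ?thesis using C0 by (intro exI[of _ "C * \<bar>M\<bar>"]) simp
qed

lemma continuous_on_linear_family:
  fixes N :: "'t::topological_space \<Rightarrow> 'a::{real_normed_vector,heine_borel} \<Rightarrow> 'b::real_normed_vector"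
  assumes lin: "\<And>t. t \<in> T \<Longrightarrow> linear (N t)" and cont: "\<And>b. continuous_on T (\<lambda>t. N t b)" and z: "continuous_on T z"
  shows "continuous_on T (\<lambda>t. N t (z t))"
proof -
  have "continuous_on T (\<lambda>t. \<Sum>b\<in>fbasis. coord b (z t) *\<^sub>R N t b)"
    by (intro continuous_on_sum continuous_on_scaleR cont bounded_linear.continuous_on[OF bounded_linear_coord] z)
  then show ?thesis
    by (rule continuous_on_eq) (rule linear_expand_coord[OF lin, symmetric])
qed

lemma dder_bounded_on_compact:
  fixes f :: "'a::{real_normed_vector,heine_borel} \<Rightarrow> 'b::real_normed_vector"
  assumes "Ck_on 1 S f" "compact K" "K \<subseteq> S"
  shows "\<exists>L\<ge>0. \<forall>q\<in>K. \<forall>v. norm (dder f q v) \<le> L * norm v"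
proof (rule linear_family_bounded_on_compact[OF assms(2)])
  show "linear (dder f q)" if "q \<in> K" for q
    using linear_dder[OF Ck_on_differentiable[of 0 S f q]] assms(1,3) that by auto
  show "continuous_on K (\<lambda>q. dder f q b)" for b
    by (rule continuous_on_subset[OF _ assms(3)]) (use assms(1) in simp)
qed

lemma C1_lipschitz_on_compact_convex:
  fixes f :: "'a::{real_normed_vector,heine_borel} \<Rightarrow> 'b::real_normed_vector"
  assumes "Ck_on 1 S f" "compact K" "convex K" "K \<subseteq> S"
  obtains L where "L-lipschitz_on K f"
proof -
  obtain L where L: "L \<ge> 0" "\<And>q v. q \<in> K \<Longrightarrow> norm (dder f q v) \<le> L * norm v"
    using dder_bounded_on_compact[OF assms(1,2,4)] by blast
  have "norm (f x - f y) \<le> L * norm (x - y)" if "x \<in> K" "y \<in> K" for x y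
  proof (rule differentiable_bound[OF assms(3) _ _ that])
    show "(f has_derivative dder f q) (at q within K)" if "q \<in> K" for q
    proof (rule has_derivative_at_withinI[OF has_derivative_dder])
      show "f differentiable (at q)"
        using Ck_on_differentiable[of 0 S f q] assms(1,4) that by auto
    qed
    show "onorm (dder f q) \<le> L" if "q \<in> K" for q
      by (rule onorm_bound[OF L(1)]) (rule L(2)[OF that])
  qed
  then show thesis using that[of L] L(1) by (auto simp: lipschitz_on_def dist_norm)
qed

text \<open>
  The differential of f is Lipschitz on K, so f differs from its linearisation at q by a function whose
  differential is of the order of the distance to q.
\<close>

lemma C2_taylor_on_compact_convex:
  fixes f :: "'a::{real_normed_vector,heine_borel} \<Rightarrow> 'b::real_normed_vector"
  assumes "Ck_on 2 S f" "compact K" "convex K" "K \<subseteq> S"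
  obtains M where "M \<ge> 0" "\<And>p q. p \<in> K \<Longrightarrow> q \<in> K \<Longrightarrow> norm (f p - f q - dder f q (p - q)) \<le> M * (norm (p - q))\<^sup>2"
proof -
  have f2: "Ck_on (Suc 1) S f" using assms(1) by (simp add: numeral_2_eq_2)
  obtain C where C0: "C > 0" and CC: "\<forall>(f :: 'a \<Rightarrow> 'b) K x. linear f \<longrightarrow>
    (\<forall>b\<in>fbasis. norm (f b) \<le> K) \<longrightarrow> norm (f x) \<le> C * K * norm x"
    using linear_bound_coord[where 'a='a and 'b='b] by (elim exE conjE) (rule that)
  have C1: "norm (f x) \<le> C * K * norm x"
    if "linear f" "\<And>b. b \<in> fbasis \<Longrightarrow> norm (f b) \<le> K" for f :: "'a \<Rightarrow> 'b" and K x
    using CC that by blast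
  note C = C0 C1
  have "\<exists>L. L-lipschitz_on K (\<lambda>q. dder f q b)" for b
    by (rule C1_lipschitz_on_compact_convex[OF Ck_on_dder[OF f2] assms(2-4), of b]) (rule exI)
  then obtain L where L: "\<And>b. (L b)-lipschitz_on K (\<lambda>q. dder f q b)" by metis
  define M where "M = (\<Sum>b\<in>(fbasis::'a set). L b)"
  have Lpos: "L b \<ge> 0" for b using L lipschitz_on_nonneg by blast
  have M: "M \<ge> 0" unfolding M_def using Lpos by (intro sum_nonneg)
  have dif: "f differentiable (at q)" if "q \<in> K" for q using that f2 assms(4) by auto
  have bd: "norm (dder f p v - dder f q v) \<le> C * (M * norm (p - q)) * norm v" if "p \<in> K" "q \<in> K" for p q v
  proof (rule C(2)[of "\<lambda>v. dder f p v - dder f q v"])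
    show "linear (\<lambda>v. dder f p v - dder f q v)"
      using linear_compose_sub[OF linear_dder[OF dif] linear_dder[OF dif]] that by blast
    fix b :: 'a assume b: "b \<in> fbasis"
    have "norm (dder f p b - dder f q b) \<le> L b * norm (p - q)"
      using lipschitz_onD[OF L that] by (simp add: dist_norm)
    also have "\<dots> \<le> M * norm (p - q)"
      unfolding M_def using b fbasis(1) Lpos by (intro mult_right_mono member_le_sum) auto
    finally show "norm (dder f p b - dder f q b) \<le> M * norm (p - q)" .
  qed
  show thesis
  proof (rule that[of "C * M"])
    fix p q assume pq: "p \<in> K" "q \<in> K"
    have "norm (f p - f q - dder f q (p - q)) \<le> norm (p - q) * (C * (M * norm (p - q)))"
    proof (rule differentiable_bound_linearization[where S="K \<inter> cball q (norm (p - q))"])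
      fix t :: real assume t: "t \<in> {0..1}"
      have "(1 - t) *\<^sub>R q + t *\<^sub>R p \<in> K"
        using convexD[OF assms(3) pq(2,1), of "1 - t" t] t by simp
      moreover have "q + t *\<^sub>R (p - q) = (1 - t) *\<^sub>R q + t *\<^sub>R p" by (simp add: algebra_simps)
      moreover have "t * norm (p - q) \<le> norm (p - q)" using t by (simp add: mult_left_le_one_le)
      moreover have "dist q (q + t *\<^sub>R (p - q)) = t * norm (p - q)"
        using t by (simp add: dist_norm)
      ultimately show "q + t *\<^sub>R (p - q) \<in> K \<inter> cball q (norm (p - q))"
        by simp
    next
      fix x assume x: "x \<in> K \<inter> cball q (norm (p - q))"
      show "(f has_derivative dder f x) (at x within K \<inter> cball q (norm (p - q)))"
        using x by (intro has_derivative_at_withinI[OF has_derivative_dder] dif) auto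
      have nx: "norm (x - q) \<le> norm (p - q)" using x by (simp add: dist_norm norm_minus_commute)
      show "onorm (dder f x - dder f q) \<le> C * (M * norm (p - q))"
      proof (rule onorm_bound)
        show "0 \<le> C * (M * norm (p - q))" using C(1) M by simp
        fix v
        have "norm ((dder f x - dder f q) v) \<le> C * (M * norm (x - q)) * norm v"
          using bd[of x q v] x pq by simp
        also have "\<dots> \<le> C * (M * norm (p - q)) * norm v"
          using C(1) M nx by (intro mult_right_mono mult_left_mono) auto
        finally show "norm ((dder f x - dder f q) v) \<le> C * (M * norm (p - q)) * norm v" .
      qed
    qed (use pq in simp)
    then show "norm (f p - f q - dder f q (p - q)) \<le> C * M * (norm (p - q))\<^sup>2"
      by (simp add: power2_eq_square mult_ac)
  qed (use C M in simp)
qed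

lemma real_mean_value_bound:
  fixes f :: "real \<Rightarrow> 'b::real_normed_vector"
  assumes "convex T" "\<And>t. t \<in> T \<Longrightarrow> (f has_vector_derivative f' t) (at t within T)"
    and "\<And>t. t \<in> T \<Longrightarrow> norm (f' t) \<le> K" "s \<in> T" "t \<in> T"
  shows "norm (f s - f t) \<le> K * \<bar>s - t\<bar>"
proof -
  have "onorm (\<lambda>h. h *\<^sub>R f' x) \<le> K" if "x \<in> T" for x
  proof (rule onorm_le)
    fix h :: real
    show "norm (h *\<^sub>R f' x) \<le> K * norm h"
      using mult_left_mono[OF assms(3)[OF that], of "\<bar>h\<bar>"] by (simp add: mult.commute)
  qed
  then show ?thesis
    using differentiable_bound[OF assms(1), of f "\<lambda>t h. h *\<^sub>R f' t" K s t] assms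
    by (simp add: has_vector_derivative_def)
qed

subsection \<open>Symmetry of the second derivative\<close>

lemma has_vector_derivative_line:
  assumes "f differentiable (at (a + t *\<^sub>R v))"
  shows "((\<lambda>t. f (a + t *\<^sub>R v)) has_vector_derivative dder f (a + t *\<^sub>R v) v) (at t within T)"
proof -
  have "((\<lambda>t. a + t *\<^sub>R v) has_derivative (\<lambda>h. h *\<^sub>R v)) (at t within T)"
    by (auto intro!: derivative_eq_intros)
  from has_derivative_compose[OF this has_derivative_dder[OF assms]]
  show ?thesis
    unfolding has_vector_derivative_def using linear_cmul[OF linear_dder[OF assms]] by simp
qed

text \<open>
  The mean value inequality is applied in direction v to the difference of f in direction w, and in
  direction w to the derivative of f in direction v.
\<close>

lemma second_difference_bound:
  fixes f :: "'a::real_normed_vector \<Rightarrow> 'b::real_normed_vector"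
  assumes C2: "Ck_on 2 S f" and S: "ball x r \<subseteq> S"
    and bd: "\<And>y. y \<in> ball x r \<Longrightarrow> norm (dder (\<lambda>y. dder f y v) y w - D) \<le> e"
    and s: "s > 0" "s * (norm v + norm w) < r"
  shows "norm (f (x + s *\<^sub>R v + s *\<^sub>R w) - f (x + s *\<^sub>R v) - f (x + s *\<^sub>R w) + f x - (s * s) *\<^sub>R D) \<le> e * s * s"
proof -
  have f2: "Ck_on (Suc (Suc 0)) S f" using C2 by (simp add: numeral_2_eq_2)
  have mem: "x + t *\<^sub>R v + u *\<^sub>R w \<in> ball x r" if "t \<in> {0..s}" "u \<in> {0..s}" for t u
  proof -
    have "norm (t *\<^sub>R v + u *\<^sub>R w) \<le> t * norm v + u * norm w"
      using norm_triangle_ineq[of "t *\<^sub>R v" "u *\<^sub>R w"] that by simp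
    also have "\<dots> \<le> s * norm v + s * norm w" using that by (intro add_mono mult_right_mono) auto
    also have "\<dots> < r" using s by (simp add: distrib_left)
    finally have "norm (t *\<^sub>R v + u *\<^sub>R w) < r" .
    moreover have "dist x (x + t *\<^sub>R v + u *\<^sub>R w) = norm (t *\<^sub>R v + u *\<^sub>R w)"
      using norm_minus_cancel[of "t *\<^sub>R v + u *\<^sub>R w"] by (simp add: dist_norm algebra_simps)
    ultimately show ?thesis by simp
  qed
  define \<phi> where "\<phi> t = f (x + s *\<^sub>R w + t *\<^sub>R v) - f (x + t *\<^sub>R v) - t *\<^sub>R (s *\<^sub>R D)" for t
  have phi': "(\<phi> has_vector_derivative dder f (x + s *\<^sub>R w + t *\<^sub>R v) v - dder f (x + t *\<^sub>R v) v - s *\<^sub>R D) (at t within {0..s})"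
    if t: "t \<in> {0..s}" for t
  proof -
    have a: "x + s *\<^sub>R w + t *\<^sub>R v \<in> S" using mem[OF t, of s] S s by (auto simp: algebra_simps)
    have b: "x + t *\<^sub>R v \<in> S" using mem[OF t, of 0] S s by auto
    show ?thesis unfolding \<phi>_def
    proof (intro has_vector_derivative_diff has_vector_derivative_line)
      show "f differentiable (at (x + s *\<^sub>R w + t *\<^sub>R v))" "f differentiable (at (x + t *\<^sub>R v))"
        using a b f2 by auto
      show "((\<lambda>t. t *\<^sub>R (s *\<^sub>R D)) has_vector_derivative s *\<^sub>R D) (at t within {0..s})"
        unfolding has_vector_derivative_def by (auto intro!: derivative_eq_intros)
    qed
  qed
  have "norm (dder f (x + s *\<^sub>R w + t *\<^sub>R v) v - dder f (x + t *\<^sub>R v) v - s *\<^sub>R D) \<le> e * s" if t: "t \<in> {0..s}" for t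
  proof -
    define \<psi> where "\<psi> u = dder f (x + t *\<^sub>R v + u *\<^sub>R w) v - u *\<^sub>R D" for u
    have "(\<psi> has_vector_derivative dder (\<lambda>y. dder f y v) (x + t *\<^sub>R v + u *\<^sub>R w) w - D) (at u within {0..s})"
      if u: "u \<in> {0..s}" for u
    proof -
      have "x + t *\<^sub>R v + u *\<^sub>R w \<in> S" using mem[OF t u] S by auto
      then have "(\<lambda>y. dder f y v) differentiable (at (x + t *\<^sub>R v + u *\<^sub>R w))" using f2 by simp
      note 1 = has_vector_derivative_line[OF this]
      have 2: "((\<lambda>u. u *\<^sub>R D) has_vector_derivative D) (at u within {0..s})"
        unfolding has_vector_derivative_def by (auto intro!: derivative_eq_intros)
      show ?thesis unfolding \<psi>_def by (rule has_vector_derivative_diff[OF 1 2])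
    qed
    from real_mean_value_bound[OF _ this, of e s 0] s bd mem[OF t]
    have "norm (\<psi> s - \<psi> 0) \<le> e * \<bar>s - 0\<bar>" by auto
    then show ?thesis using s by (simp add: \<psi>_def algebra_simps)
  qed
  from real_mean_value_bound[OF _ phi' this, of s 0] s
  have "norm (\<phi> s - \<phi> 0) \<le> e * s * \<bar>s - 0\<bar>" by auto
  then show ?thesis using s by (simp add: \<phi>_def algebra_simps)
qed

text \<open>
  The second difference quotient is symmetric in v and w and converges to either mixed derivative.
\<close>

lemma second_derivative_symmetric:
  fixes f :: "'a::real_normed_vector \<Rightarrow> 'b::real_normed_vector"
  assumes "open S" "Ck_on 2 S f" "x \<in> S"
  shows "dder (\<lambda>y. dder f y v) x w = dder (\<lambda>y. dder f y w) x v"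
proof -
  define P where "P = dder (\<lambda>y. dder f y v) x w"
  define Q where "Q = dder (\<lambda>y. dder f y w) x v"
  have f2: "Ck_on (Suc (Suc 0)) S f" using assms(2) by (simp add: numeral_2_eq_2)
  have "norm (P - Q) \<le> 2 * e" if e: "e > 0" for e
  proof -
    have "isCont (\<lambda>y. dder (\<lambda>y. dder f y v) y w) x" "isCont (\<lambda>y. dder (\<lambda>y. dder f y w) y v) x"
      using f2 assms by (auto simp: continuous_on_eq_continuous_at)
    then have "((\<lambda>y. dder (\<lambda>y. dder f y v) y w) \<longlongrightarrow> P) (nhds x)" "((\<lambda>y. dder (\<lambda>y. dder f y w) y v) \<longlongrightarrow> Q) (nhds x)"
      unfolding P_def Q_def isCont_def
      by (blast intro: tendsto_at_iff_tendsto_nhds[THEN iffD1])+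
    note tendstoD[OF this(1) e] tendstoD[OF this(2) e]
    moreover have "\<forall>\<^sub>F y in nhds x. y \<in> S" using assms by (simp add: eventually_nhds_in_open)
    ultimately have "\<forall>\<^sub>F y in nhds x. y \<in> S \<and> dist (dder (\<lambda>y. dder f y v) y w) P < e \<and> dist (dder (\<lambda>y. dder f y w) y v) Q < e"
      by (simp add: eventually_conj)
    then obtain r where r: "r > 0" "\<And>y. dist y x < r \<Longrightarrow> y \<in> S \<and> dist (dder (\<lambda>y. dder f y v) y w) P < e \<and> dist (dder (\<lambda>y. dder f y w) y v) Q < e"
      unfolding eventually_nhds_metric by blast
    define s where "s = r / (2 * (norm v + norm w + 1))"
    have npos: "norm v + norm w + 1 > 0" by (smt (verit) norm_ge_zero)
    have s: "s > 0" unfolding s_def using r npos by simp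
    have "s * (norm v + norm w) \<le> s * (norm v + norm w + 1)" using s by simp
    also have "\<dots> = r / 2" unfolding s_def using npos by (simp add: field_simps)
    finally have sr: "s * (norm v + norm w) < r" using r by simp
    have B: "ball x r \<subseteq> S" using r by (auto simp: dist_commute)
    have "norm (f (x + s *\<^sub>R v + s *\<^sub>R w) - f (x + s *\<^sub>R v) - f (x + s *\<^sub>R w) + f x - (s * s) *\<^sub>R P) \<le> e * s * s"
      using r by (intro second_difference_bound[OF assms(2) B _ s sr])
        (force simp: dist_norm dist_commute norm_minus_commute)
    moreover have "norm (f (x + s *\<^sub>R w + s *\<^sub>R v) - f (x + s *\<^sub>R w) - f (x + s *\<^sub>R v) + f x - (s * s) *\<^sub>R Q) \<le> e * s * s"
      using r sr by (intro second_difference_bound[OF assms(2) B _ s])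
        (force simp: dist_norm dist_commute norm_minus_commute add.commute)+
    moreover have "(s * s) *\<^sub>R (P - Q) =
      (f (x + s *\<^sub>R w + s *\<^sub>R v) - f (x + s *\<^sub>R w) - f (x + s *\<^sub>R v) + f x - (s * s) *\<^sub>R Q)
      - (f (x + s *\<^sub>R v + s *\<^sub>R w) - f (x + s *\<^sub>R v) - f (x + s *\<^sub>R w) + f x - (s * s) *\<^sub>R P)"
      by (simp add: algebra_simps)
    ultimately have "norm ((s * s) *\<^sub>R (P - Q)) \<le> e * s * s + e * s * s"
      using norm_triangle_ineq4 by (smt (verit))
    then have "\<bar>s * s\<bar> * norm (P - Q) \<le> e * s * s + e * s * s" unfolding norm_scaleR .
    then have "(s * s) * norm (P - Q) \<le> (s * s) * (2 * e)" by (simp add: mult_ac)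
    then show ?thesis using s by simp
  qed
  then have "norm (P - Q) \<le> e" if "e > 0" for e
    using that by (metis field_sum_of_halves mult_2 half_gt_zero)
  then have "norm (P - Q) \<le> 0" by (meson dense_le_bounded field_le_epsilon add_0 le_add_same_cancel2 linorder_not_less dense)
  then show ?thesis by (simp add: P_def Q_def)
qed

subsection \<open>Differentiating a differential along a curve\<close>

lemma dder_expand_coord:
  fixes f :: "'a::{real_normed_vector,heine_borel} \<Rightarrow> 'b::real_normed_vector"
  assumes "f differentiable (at x)"
  shows "dder f x v = (\<Sum>b\<in>fbasis. coord b v *\<^sub>R dder f x b)"
  by (rule linear_expand_coord[OF linear_dder[OF assms]])

lemma dder_dder_expand_coord:
  fixes f :: "'a::{real_normed_vector,heine_borel} \<Rightarrow> 'b::real_normed_vector"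
  assumes "open S" "Ck_on 2 S f" "x \<in> S"
  shows "dder (\<lambda>y. dder f y v) x w = (\<Sum>b\<in>fbasis. coord b v *\<^sub>R dder (\<lambda>y. dder f y b) x w)"
proof -
  have f2: "Ck_on (Suc (Suc 0)) S f" using assms(2) by (simp add: numeral_2_eq_2)
  have "dder (\<lambda>y. dder f y v) x = dder (\<lambda>y. \<Sum>b\<in>fbasis. coord b v *\<^sub>R dder f y b) x"
    using f2 by (intro dder_cong[OF assms(1,3)] dder_expand_coord) auto
  also have "\<dots> = (\<lambda>w. \<Sum>b\<in>fbasis. coord b v *\<^sub>R dder (\<lambda>y. dder f y b) x w)"
    using f2 assms(3) by (intro dderI has_derivative_sum has_derivative_scaleR_right has_derivative_dder) auto
  finally show ?thesis by simp
qed

text \<open>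
  The product rule for the differential of f at a moving point, applied to a moving vector.
\<close>

lemma has_vector_derivative_differential_along:
  fixes f :: "'a::{real_normed_vector,heine_borel} \<Rightarrow> 'b::real_normed_vector"
  assumes S: "open S" "Ck_on 2 S f" and p: "\<And>r. r \<in> T \<Longrightarrow> p r \<in> S" "s \<in> T"
    and p': "(p has_vector_derivative p') (at s within T)"
    and z': "(z has_vector_derivative z') (at s within T)"
  shows "((\<lambda>r. dder f (p r) (z r)) has_vector_derivative
      dder (\<lambda>q. dder f q (z s)) (p s) p' + dder f (p s) z') (at s within T)"
proof -
  have f2: "Ck_on (Suc (Suc 0)) S f" using S(2) by (simp add: numeral_2_eq_2)
  have d1: "f differentiable (at (p r))" if "r \<in> T" for r using p(1)[OF that] f2 by auto
  have d2: "(\<lambda>q. dder f q b) differentiable (at (p s))" for b using p(1)[OF p(2)] f2 by auto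
  have c: "((\<lambda>r. coord b (z r)) has_vector_derivative coord b z') (at s within T)" for b
    using bounded_linear.has_vector_derivative[OF bounded_linear_coord z'] .
  have e: "((\<lambda>r. dder f (p r) b) has_vector_derivative dder (\<lambda>q. dder f q b) (p s) p') (at s within T)" for b
    using has_derivative_compose[OF p'[unfolded has_vector_derivative_def] has_derivative_dder[OF d2[of b]]]
    unfolding has_vector_derivative_def using linear_cmul[OF linear_dder[OF d2[of b]]] by simp
  have "((\<lambda>r. \<Sum>b\<in>fbasis. coord b (z r) *\<^sub>R dder f (p r) b) has_vector_derivative
     (\<Sum>b\<in>fbasis. coord b (z s) *\<^sub>R dder (\<lambda>q. dder f q b) (p s) p' + coord b z' *\<^sub>R dder f (p s) b)) (at s within T)"
    by (intro has_vector_derivative_sum has_vector_derivative_scaleR e)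
       (use c in \<open>simp add: has_real_derivative_iff_has_vector_derivative\<close>)
  also have "(\<Sum>b\<in>fbasis. coord b (z s) *\<^sub>R dder (\<lambda>q. dder f q b) (p s) p' + coord b z' *\<^sub>R dder f (p s) b)
    = dder (\<lambda>q. dder f q (z s)) (p s) p' + dder f (p s) z'"
    by (simp only: sum.distrib dder_dder_expand_coord[OF S p(1)[OF p(2)], symmetric]
        dder_expand_coord[OF d1[OF p(2)], symmetric])
  finally have *: "((\<lambda>r. \<Sum>b\<in>fbasis. coord b (z r) *\<^sub>R dder f (p r) b) has_vector_derivative
     dder (\<lambda>q. dder f q (z s)) (p s) p' + dder f (p s) z') (at s within T)" .
  show ?thesis
    by (rule has_vector_derivative_transform[OF p(2) _ *]) (rule dder_expand_coord[OF d1])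
qed


section \<open>Bump functions\<close>

text \<open>
  The functions \<open>t^(-n) exp (-1/t)\<close>, extended by 0.  Differentiation stays within the span of this
  family, so the smoothness of all its members can be proved by a single induction.
\<close>

definition flat :: "nat \<Rightarrow> real \<Rightarrow> real" where
  "flat n t = (if t \<le> 0 then 0 else inverse t ^ n * exp (- inverse t))"

lemma flat_tendsto_0: "(flat n \<longlongrightarrow> 0) (at 0)"
proof -
  have "((\<lambda>x::real. x ^ n / exp x) \<longlongrightarrow> 0) at_top" by (rule tendsto_power_div_exp_0)
  then have "((\<lambda>t::real. inverse t ^ n / exp (inverse t)) \<longlongrightarrow> 0) (at_right 0)"
    by (rule filterlim_compose) (rule filterlim_inverse_at_top_right)
  moreover have "\<forall>\<^sub>F t in at_right 0. inverse t ^ n / exp (inverse t) = flat n t"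
    using eventually_at_right_less[of "0::real"]
    by eventually_elim (simp add: flat_def exp_minus divide_inverse)
  ultimately have r: "(flat n \<longlongrightarrow> 0) (at_right 0)"
    using Lim_transform_eventually by blast
  have "\<forall>\<^sub>F t in at_left 0. 0 = flat n t"
    using eventually_at_left_real[of "-1" "0::real"] by (auto simp: flat_def elim!: eventually_mono)
  then have "(flat n \<longlongrightarrow> 0) (at_left 0)"
    using Lim_transform_eventually tendsto_const by blast
  with r show ?thesis by (simp add: filterlim_at_split)
qed

lemma flat_has_derivative:
  "(flat n has_real_derivative (flat (n + 2) t - real n * flat (n + 1) t)) (at t)"
proof -
  consider "t > 0" | "t < 0" | "t = 0" by linarith
  then show ?thesis
  proof cases
    case 1
    then have "((\<lambda>t. inverse t ^ n) has_real_derivative real n * (- (inverse t ^ Suc (Suc 0)) * inverse t ^ (n - Suc 0))) (at t)"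
      by (intro DERIV_power DERIV_inverse) simp
    also have "real n * (- (inverse t ^ Suc (Suc 0)) * inverse t ^ (n - Suc 0)) = - (real n * inverse t ^ (n + 1))"
      by (cases n) (simp_all add: mult_ac)
    finally have a: "((\<lambda>t. inverse t ^ n) has_real_derivative - (real n * inverse t ^ (n + 1))) (at t)" .
    have b: "((\<lambda>t. exp (- inverse t)) has_real_derivative (inverse t * inverse t) * exp (- inverse t)) (at t)"
      using 1 by (auto intro!: derivative_eq_intros)
    have "((\<lambda>t. inverse t ^ n * exp (- inverse t)) has_real_derivative
        (flat (n + 2) t - real n * flat (n + 1) t)) (at t)"
      by (rule DERIV_cong[OF DERIV_mult[OF a b]])
         (use 1 in \<open>simp add: flat_def power_add algebra_simps\<close>)
    then show ?thesis
      by (rule has_field_derivative_transform_within_open[of _ _ _ "{0<..}"])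
         (use 1 in \<open>auto simp: flat_def\<close>)
  next
    case 2
    have "((\<lambda>t. 0) has_real_derivative (flat (n + 2) t - real n * flat (n + 1) t)) (at t)"
      using 2 by (auto simp: flat_def)
    then show ?thesis
      by (rule has_field_derivative_transform_within_open[of _ _ _ "{..<0}"])
         (use 2 in \<open>auto simp: flat_def\<close>)
  next
    case 3
    have "(\<lambda>h. (flat n (0 + h) - flat n 0) / h) = flat (n + 1)"
      by (rule ext) (auto simp: flat_def divide_inverse)
    then show ?thesis
      using flat_tendsto_0[of "n + 1"] 3 by (simp add: has_field_derivative_iff flat_def)
  qed
qed

lemma Ck_on_flat: "Ck_on k UNIV (flat n)"
proof (induction k arbitrary: n)
  case 0
  then show ?case
    using flat_has_derivative by (auto intro!: continuous_at_imp_continuous_on DERIV_isCont)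
next
  case (Suc k)
  have D: "(flat n has_derivative (\<lambda>v. (flat (n + 2) t - real n * flat (n + 1) t) * v)) (at t)" for t
    using flat_has_derivative[of n t] by (simp add: has_field_derivative_def)
  have "Ck_on k UNIV (\<lambda>t. (flat (n + 2) t - real n * flat (n + 1) t) * v)" for v
    by (intro Ck_on_mult Ck_on_diff Suc.IH Ck_on_const open_UNIV)
  then have "Ck_on k UNIV (\<lambda>t. dder (flat n) t v)" for v
    unfolding dderI[OF D] .
  then show ?case using D by (auto simp: differentiable_def)
qed

text \<open>
  The norm need not be smooth, so the sum of the squared coordinates takes its place.
\<close>

lemma bump_function_exists:
  fixes x0 :: "'a::{real_normed_vector,heine_borel}"
  assumes "open S" "x0 \<in> S"
  obtains \<psi> :: "'a \<Rightarrow> real" and K where "smooth_on UNIV \<psi>" "\<psi> x0 = 1" "compact K" "K \<subseteq> S"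
    "\<And>x. x \<notin> K \<Longrightarrow> \<psi> x = 0"
proof -
  obtain \<rho> where \<rho>: "\<rho> > 0" "cball x0 \<rho> \<subseteq> S" using assms open_contains_cball by blast
  define B where "B = 1 + (\<Sum>b\<in>(fbasis::'a set). norm b)"
  have B: "B > 0" unfolding B_def by (intro add_pos_nonneg sum_nonneg) auto
  define r where "r = \<rho> / B"
  have r: "r > 0" unfolding r_def using \<rho> B by simp
  define q where "q x = (\<Sum>b\<in>(fbasis::'a set). (coord b (x - x0))\<^sup>2)" for x
  define \<psi> where "\<psi> x = inverse (flat 0 (r\<^sup>2)) * flat 0 (r\<^sup>2 - q x)" for x
  have sq: "smooth_on UNIV q"
    unfolding q_def power2_eq_square
    by (intro smooth_on_sum smooth_on_mult smooth_on_bounded_linear_comp[OF bounded_linear_coord] smooth_on_diff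
        smooth_on_const smooth_on_bounded_linear bounded_linear_ident open_UNIV)
  have "smooth_on UNIV (flat 0)" by (simp add: smooth_on_def Ck_on_flat)
  then have "smooth_on UNIV (\<lambda>x. flat 0 (r\<^sup>2 - q x))"
    by (rule smooth_on_compose[OF open_UNIV open_UNIV, rotated])
       (auto intro!: smooth_on_diff sq)
  then have 1: "smooth_on UNIV \<psi>" unfolding \<psi>_def
    by (intro smooth_on_mult) auto
  have "q x0 = 0" unfolding q_def by (simp add: linear_0[OF linear_coord])
  moreover have "flat 0 (r\<^sup>2) > 0" using r by (simp add: flat_def)
  ultimately have 2: "\<psi> x0 = 1" unfolding \<psi>_def by simp
  have 3: "\<psi> x = 0" if "x \<notin> cball x0 \<rho>" for x
  proof -
    have "\<not> q x < r\<^sup>2"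
    proof
      assume q: "q x < r\<^sup>2"
      have c: "\<bar>coord b (x - x0)\<bar> \<le> r" if "b \<in> fbasis" for b
      proof -
        have "(coord b (x - x0))\<^sup>2 \<le> q x"
          unfolding q_def using that fbasis(1) by (intro member_le_sum) auto
        then have "(coord b (x - x0))\<^sup>2 \<le> r\<^sup>2" using q by simp
        then show ?thesis using r by (simp add: abs_le_square_iff[symmetric])
      qed
      have "norm (x - x0) = norm (\<Sum>b\<in>fbasis. coord b (x - x0) *\<^sub>R b)" by (simp add: sum_coord)
      also have "\<dots> \<le> (\<Sum>b\<in>(fbasis::'a set). r * norm b)"
      proof (rule order_trans[OF norm_sum sum_mono])
        fix b :: 'a assume "b \<in> fbasis"
        from mult_right_mono[OF c[OF this] norm_ge_zero[of b]]
        show "norm (coord b (x - x0) *\<^sub>R b) \<le> r * norm b" by simp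
      qed
      also have "\<dots> \<le> r * B" unfolding B_def using r by (simp add: sum_distrib_left distrib_left)
      also have "\<dots> = \<rho>" unfolding r_def using B by simp
      finally show False using that by (simp add: dist_norm norm_minus_commute)
    qed
    then show ?thesis unfolding \<psi>_def flat_def by simp
  qed
  show thesis by (rule that[OF 1 2 _ \<rho>(2) 3]) auto
qed

section \<open>Smooth solutions of smooth linear equations\<close>

lemma smooth_on_bilinear_family:
  fixes N :: "'a::real_normed_vector \<Rightarrow> 'b::{real_normed_vector,heine_borel} \<Rightarrow> 'c::real_normed_vector"
  assumes S: "open S" and lin: "\<And>y. y \<in> S \<Longrightarrow> linear (N y)"
    and sm: "\<And>b. smooth_on S (\<lambda>y. N y b)" and Z: "smooth_on S Z"
  shows "smooth_on S (\<lambda>y. N y (Z y))"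
proof -
  have "smooth_on S (\<lambda>y. \<Sum>b\<in>fbasis. coord b (Z y) *\<^sub>R N y b)"
    by (intro smooth_on_sum smooth_on_scaleR S sm smooth_on_bounded_linear_comp[OF bounded_linear_coord] Z)
  then show ?thesis
    by (rule smooth_on_cong[OF S, rotated]) (rule linear_expand_coord[OF lin, symmetric])
qed

text \<open>
  Gram-Schmidt orthogonalisation with parameters.  The right-hand side is generalised in the induction,
  because the solution for the right-hand side \<open>N y b\<close> is the orthogonal projection Z of the new vector b;
  the solution is then corrected by a multiple of \<open>b - Z\<close>.
\<close>

lemma smooth_linear_solve_finite:
  fixes N :: "'a::real_normed_vector \<Rightarrow> 'b::{real_normed_vector,heine_borel} \<Rightarrow> 'b \<Rightarrow> real"
  assumes S: "open S"
    and lin1: "\<And>y c. y \<in> S \<Longrightarrow> linear (\<lambda>b. N y b c)" and lin2: "\<And>y b. y \<in> S \<Longrightarrow> linear (N y b)"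
    and pos: "\<And>y b. y \<in> S \<Longrightarrow> b \<noteq> 0 \<Longrightarrow> N y b b > 0"
    and sm: "\<And>b c. smooth_on S (\<lambda>y. N y b c)"
    and F: "finite F" "independent F" and r: "\<And>b. b \<in> F \<Longrightarrow> smooth_on S (\<lambda>y. r y b)"
  shows "\<exists>X. smooth_on S X \<and> (\<forall>y\<in>S. X y \<in> span F \<and> (\<forall>b\<in>F. N y (X y) b = r y b))"
  using F r
proof (induction F arbitrary: r rule: finite_induct)
  case empty
  show ?case by (rule exI[of _ "\<lambda>y. 0"]) (simp add: span_zero)
next
  case (insert b F)
  have b: "b \<notin> span F" and ind: "independent F"
    using insert by (auto simp: independent_insert)
  obtain Z where Z: "smooth_on S Z" "\<And>y. y \<in> S \<Longrightarrow> Z y \<in> span F" "\<And>y c. y \<in> S \<Longrightarrow> c \<in> F \<Longrightarrow> N y (Z y) c = N y b c"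
    using insert.IH[OF ind, of "\<lambda>y c. N y b c"] sm by blast
  obtain X where X: "smooth_on S X" "\<And>y. y \<in> S \<Longrightarrow> X y \<in> span F" "\<And>y c. y \<in> S \<Longrightarrow> c \<in> F \<Longrightarrow> N y (X y) c = r y c"
    using insert.IH[OF ind, of r] insert.prems by blast
  define e where "e y = b - Z y" for y
  have e: "smooth_on S e" unfolding e_def by (intro smooth_on_diff S Z smooth_on_const)
  have eF: "N y (e y) c = 0" if "y \<in> S" "c \<in> span F" for y c
    using that(2)
  proof (induction rule: span_induct_alt)
    case base
    show ?case using linear_0[OF lin2[OF that(1)]] .
  next
    case (step k c z)
    have "N y (e y) c = 0"
      unfolding e_def using linear_diff[OF lin1[OF that(1)]] Z(3)[OF that(1) step(1)] by simp
    then show ?case using step(2) linear_add[OF lin2[OF that(1)]] linear_cmul[OF lin2[OF that(1)]] by simp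
  qed
  have eb: "N y (e y) b > 0" if "y \<in> S" for y
  proof -
    have "e y \<noteq> 0" using b Z(2)[OF that] unfolding e_def by auto
    then have "N y (e y) (e y) > 0" using pos that by blast
    moreover have "N y (e y) (e y) = N y (e y) b - N y (e y) (Z y)"
      using linear_diff[OF lin2[OF that]] by (simp add: e_def)
    ultimately show ?thesis using eF[OF that Z(2)[OF that]] by simp
  qed
  define l where "l y = (r y b - N y (X y) b) * inverse (N y (e y) b)" for y
  have "smooth_on S l" unfolding l_def
  proof (intro smooth_on_mult smooth_on_diff smooth_on_inverse S)
    show "smooth_on S (\<lambda>y. N y (X y) b)" "smooth_on S (\<lambda>y. N y (e y) b)"
      using smooth_on_bilinear_family[OF S, of "\<lambda>y c. N y c b"] lin1 sm X(1) e by auto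
    show "smooth_on S (\<lambda>y. r y b)" using insert.prems by simp
    show "N y (e y) b \<noteq> 0" if "y \<in> S" for y using eb[OF that] by simp
  qed
  then have sX: "smooth_on S (\<lambda>y. X y + l y *\<^sub>R e y)"
    by (intro smooth_on_add smooth_on_scaleR S X(1) e)
  have "X y + l y *\<^sub>R e y \<in> span (insert b F) \<and> (\<forall>c\<in>insert b F. N y (X y + l y *\<^sub>R e y) c = r y c)" if y: "y \<in> S" for y
  proof
    have "X y \<in> span (insert b F)" "Z y \<in> span (insert b F)"
      using X(2)[OF y] Z(2)[OF y] span_mono[of F "insert b F"] by auto
    then show "X y + l y *\<^sub>R e y \<in> span (insert b F)"
      unfolding e_def by (intro span_add span_scale span_diff) (auto intro: span_base)
    have N: "N y (X y + l y *\<^sub>R e y) c = N y (X y) c + l y * N y (e y) c" for c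
      using linear_add[OF lin1[OF y]] linear_cmul[OF lin1[OF y]] by simp
    show "\<forall>c\<in>insert b F. N y (X y + l y *\<^sub>R e y) c = r y c"
    proof -
      have "l y * N y (e y) b = r y b - N y (X y) b" using eb[OF y] by (simp add: l_def)
      then show ?thesis using X(3)[OF y] eF[OF y span_base] by (auto simp: N)
    qed
  qed
  with sX show ?case by blast
qed

lemma smooth_linear_solve:
  fixes N :: "'a::real_normed_vector \<Rightarrow> 'b::{real_normed_vector,heine_borel} \<Rightarrow> 'b \<Rightarrow> real"
  assumes S: "open S"
    and lin1: "\<And>y c. y \<in> S \<Longrightarrow> linear (\<lambda>b. N y b c)" and lin2: "\<And>y b. y \<in> S \<Longrightarrow> linear (N y b)"
    and pos: "\<And>y b. y \<in> S \<Longrightarrow> b \<noteq> 0 \<Longrightarrow> N y b b > 0"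
    and sm: "\<And>b c. smooth_on S (\<lambda>y. N y b c)"
    and r: "\<And>b. smooth_on S (\<lambda>y. r y b)" and lin3: "\<And>y. y \<in> S \<Longrightarrow> linear (r y)"
  shows "\<exists>X. smooth_on S X \<and> (\<forall>y\<in>S. \<forall>b. N y (X y) b = r y b)"
proof -
  obtain X where X: "smooth_on S X" "\<And>y b. y \<in> S \<Longrightarrow> b \<in> fbasis \<Longrightarrow> N y (X y) b = r y b"
  proof -
    have "\<exists>X. smooth_on S X \<and> (\<forall>y\<in>S. X y \<in> span fbasis \<and> (\<forall>b\<in>fbasis. N y (X y) b = r y b))"
      by (rule smooth_linear_solve_finite[OF S]) (simp_all add: lin1 lin2 pos sm fbasis r)
    then show thesis using that by blast
  qed
  have "N y (X y) b = r y b" if "y \<in> S" for y b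
    by (rule linear_eq_on_span[OF lin2[OF that] lin3[OF that], of fbasis])
       (use X(2)[OF that] fbasis(3) in auto)
  with X(1) show ?thesis by blast
qed


section \<open>Ordinary differential equations\<close>

text \<open>
  Primitives are obtained by integrating the coordinates.
\<close>

lemma primitive_exists:
  fixes g :: "real \<Rightarrow> 'a::{real_normed_vector,heine_borel}"
  assumes g: "continuous_on {-\<delta>..\<delta>} g"
  shows "\<exists>P. P 0 = 0 \<and> (\<forall>t\<in>{-\<delta>..\<delta>}. (P has_vector_derivative g t) (at t within {-\<delta>..\<delta>}))"
proof -
  define G where "G b t = integral {-\<delta>..t} (\<lambda>s. coord b (g s))" for b t
  define P where "P t = (\<Sum>b\<in>fbasis. (G b t - G b 0) *\<^sub>R b)" for t
  have "(P has_vector_derivative g t) (at t within {-\<delta>..\<delta>})" if t: "t \<in> {-\<delta>..\<delta>}" for t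
  proof -
    have G: "(G b has_vector_derivative coord b (g t)) (at t within {-\<delta>..\<delta>})" for b
      unfolding G_def
      by (intro integral_has_vector_derivative t bounded_linear.continuous_on[OF bounded_linear_coord g])
    have "((\<lambda>t. G b t - G b 0) has_vector_derivative coord b (g t)) (at t within {-\<delta>..\<delta>})" for b
      using has_vector_derivative_diff[OF G has_vector_derivative_const] by simp
    then have "((\<lambda>t. (G b t - G b 0) *\<^sub>R b) has_vector_derivative coord b (g t) *\<^sub>R b) (at t within {-\<delta>..\<delta>})" for b
      by (rule bounded_linear.has_vector_derivative[OF bounded_linear_scaleR_left])
    then have "(P has_vector_derivative (\<Sum>b\<in>fbasis. coord b (g t) *\<^sub>R b)) (at t within {-\<delta>..\<delta>})"
      unfolding P_def by (rule has_vector_derivative_sum)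
    then show ?thesis by (simp add: sum_coord)
  qed
  then show ?thesis by (intro exI[of _ P]) (simp add: P_def)
qed

lemma has_vector_derivative_imp_continuous_on:
  "(\<And>t. t \<in> T \<Longrightarrow> (w has_vector_derivative w' t) (at t within T)) \<Longrightarrow> continuous_on T w"
  unfolding continuous_on_eq_continuous_within
  by (blast intro: has_vector_derivative_continuous)

text \<open>
  On an interval so short that \<open>L * \<delta> \<le> 1/2\<close>, the growth of w is at most half of its maximum, which can
  therefore be absorbed.
\<close>

lemma small_gronwall:
  fixes w :: "real \<Rightarrow> 'a::real_normed_vector"
  assumes T: "convex T" "compact T" "t0 \<in> T" "\<And>t. t \<in> T \<Longrightarrow> \<bar>t - t0\<bar> \<le> \<delta>"
    and w: "\<And>t. t \<in> T \<Longrightarrow> (w has_vector_derivative w' t) (at t within T)"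
    and bd: "\<And>t. t \<in> T \<Longrightarrow> norm (w' t) \<le> L * norm (w t) + K"
    and L: "L * \<delta> \<le> 1/2" "L \<ge> 0" "K \<ge> 0" and t: "t \<in> T"
  shows "norm (w t) \<le> 2 * norm (w t0) + 2 * \<delta> * K"
proof -
  have "continuous_on T (\<lambda>t. norm (w t))"
    using has_vector_derivative_imp_continuous_on[OF w] by (intro continuous_intros)
  then obtain s where s: "s \<in> T" "\<And>t. t \<in> T \<Longrightarrow> norm (w t) \<le> norm (w s)"
    using continuous_attains_sup[OF T(2), of "\<lambda>t. norm (w t)"] T(3) by blast
  define m where "m = norm (w s)"
  have m: "m \<ge> 0" unfolding m_def by simp
  have "norm (w' t) \<le> L * m + K" if "t \<in> T" for t
    using bd[OF that] mult_left_mono[OF s(2)[OF that] L(2)] unfolding m_def by linarith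
  from real_mean_value_bound[OF T(1) w this s(1) T(3)]
  have "norm (w s - w t0) \<le> (L * m + K) * \<bar>s - t0\<bar>" .
  also have "\<dots> \<le> (L * m + K) * \<delta>"
    using T(4)[OF s(1)] L m by (intro mult_left_mono) auto
  also have "\<dots> = (L * \<delta>) * m + K * \<delta>" by (simp add: algebra_simps)
  also have "\<dots> \<le> (1/2) * m + K * \<delta>" using mult_right_mono[OF L(1) m] by simp
  finally have "norm (w s - w t0) \<le> m / 2 + K * \<delta>" by simp
  moreover have "m \<le> norm (w t0) + norm (w s - w t0)"
    unfolding m_def using norm_triangle_ineq[of "w t0" "w s - w t0"] by simp
  ultimately have "m \<le> 2 * norm (w t0) + 2 * \<delta> * K" by (simp add: algebra_simps)
  then show ?thesis using s(2)[OF t] unfolding m_def by linarith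
qed

lemma ode_unique_small:
  fixes p q :: "real \<Rightarrow> 'a::real_normed_vector"
  assumes T: "convex T" "compact T" "t0 \<in> T" "\<And>t. t \<in> T \<Longrightarrow> \<bar>t - t0\<bar> \<le> \<delta>" "L * \<delta> \<le> 1/2"
    and p: "\<And>t. t \<in> T \<Longrightarrow> (p has_vector_derivative F t (p t)) (at t within T)"
    and q: "\<And>t. t \<in> T \<Longrightarrow> (q has_vector_derivative F t (q t)) (at t within T)"
    and Lip: "\<And>t. t \<in> T \<Longrightarrow> norm (F t (p t) - F t (q t)) \<le> L * norm (p t - q t)" "L \<ge> 0"
    and "p t0 = q t0" "t \<in> T"
  shows "p t = q t"
proof -
  have "norm (p t - q t) \<le> 2 * norm (p t0 - q t0) + 2 * \<delta> * 0"
    by (rule small_gronwall[OF T(1-4), where w="\<lambda>t. p t - q t" and w'="\<lambda>t. F t (p t) - F t (q t)" and L=L])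
       (use assms in \<open>auto intro: has_vector_derivative_diff\<close>)
  then show ?thesis using \<open>p t0 = q t0\<close> by simp
qed

text \<open>
  The interval is given explicitly in terms of the bound and the Lipschitz constant, so that it is the
  same for all initial values near a given one.  The fixed point is found in the space of bounded continuous
  functions on the whole line, which explains the truncation of the time variable in the proof.
\<close>

theorem picard:
  fixes F :: "real \<Rightarrow> 'z \<Rightarrow> 'z::{real_normed_vector,heine_borel}"
  assumes cont: "\<And>\<phi>. continuous_on {-\<delta>..\<delta>} \<phi> \<Longrightarrow> (\<And>t. t \<in> {-\<delta>..\<delta>} \<Longrightarrow> \<phi> t \<in> cball z r) \<Longrightarrow>
      continuous_on {-\<delta>..\<delta>} (\<lambda>t. F t (\<phi> t))"
    and M: "\<And>t y. t \<in> {-\<delta>..\<delta>} \<Longrightarrow> y \<in> cball z r \<Longrightarrow> norm (F t y) \<le> M" "M * \<delta> \<le> r"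
    and Lip: "\<And>t y y'. t \<in> {-\<delta>..\<delta>} \<Longrightarrow> y \<in> cball z r \<Longrightarrow> y' \<in> cball z r \<Longrightarrow>
      norm (F t y - F t y') \<le> L * norm (y - y')" "L * \<delta> \<le> 1/2" "L \<ge> 0"
    and \<delta>: "\<delta> \<ge> 0" and r: "r \<ge> 0"
  shows "\<exists>\<phi>. \<phi> 0 = z \<and> (\<forall>t\<in>{-\<delta>..\<delta>}. \<phi> t \<in> cball z r \<and>
    (\<phi> has_vector_derivative F t (\<phi> t)) (at t within {-\<delta>..\<delta>}))"
proof -
  let ?T = "{-\<delta>..\<delta>}"
  define X where "X = PiC (UNIV :: real set) (\<lambda>_. cball z r)"
  have XD: "apply_bcontfun \<phi> t \<in> cball z r" if "\<phi> \<in> X" for \<phi> t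
    using that unfolding X_def mem_PiC_iff by auto
  have XI: "\<phi> \<in> X" if "\<And>t. apply_bcontfun \<phi> t \<in> cball z r" for \<phi>
    using that unfolding X_def mem_PiC_iff by auto
  have "closed X" unfolding X_def by (intro closed_PiC) auto
  then have X: "complete X" by (simp add: complete_eq_closed)
  have "const_bcontfun z \<in> X" using r by (intro XI) simp
  then have Xne: "X \<noteq> {}" by blast
  have "\<exists>P. P 0 = 0 \<and> (\<forall>t\<in>?T. (P has_vector_derivative F t (apply_bcontfun \<phi> t)) (at t within ?T))"
    if "\<phi> \<in> X" for \<phi>
  proof -
    have "continuous_on ?T (\<lambda>t. F t (apply_bcontfun \<phi> t))" by (intro cont XD[OF that]) simp
    then show ?thesis by (rule primitive_exists)
  qed
  then have "\<forall>\<phi>\<in>X. \<exists>P. P 0 = 0 \<and> (\<forall>t\<in>?T. (P has_vector_derivative F t (apply_bcontfun \<phi> t)) (at t within ?T))"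
    by (rule ballI)
  from bchoice[OF this] obtain P where P0: "\<forall>\<phi>\<in>X. P \<phi> 0 = 0 \<and> (\<forall>t\<in>?T. (P \<phi> has_vector_derivative F t (apply_bcontfun \<phi> t)) (at t within ?T))"
    by (elim exE) (rule that)
  have P: "P \<phi> 0 = 0" "t \<in> ?T \<Longrightarrow> (P \<phi> has_vector_derivative F t (apply_bcontfun \<phi> t)) (at t within ?T)" if "\<phi> \<in> X" for \<phi> t
    using bspec[OF P0 that] by blast+
  \<comment> \<open>The operator is extended to all times by freezing the time outside the interval.\<close>
  define cl where "cl t = max (-\<delta>) (min \<delta> t)" for t
  have cl: "cl t \<in> ?T" "t \<in> ?T \<Longrightarrow> cl t = t" for t using \<delta> by (auto simp: cl_def)
  have T0: "0 \<in> ?T" and Tabs: "\<bar>t\<bar> \<le> \<delta>" if "t \<in> ?T" for t using \<delta> that by auto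
  have Pb: "norm (P \<phi> t) \<le> r" if "\<phi> \<in> X" "t \<in> ?T" for \<phi> t
  proof -
    have "norm (P \<phi> t - P \<phi> 0) \<le> M * \<bar>t - 0\<bar>"
      by (rule real_mean_value_bound[OF _ P(2)[OF that(1)] M(1)[OF _ XD[OF that(1)]]])
         (use that \<delta> in auto)
    also have "\<dots> \<le> M * \<delta>"
    proof (rule mult_left_mono)
      show "0 \<le> M" using M(1)[of 0 z] \<delta> r order_trans[OF norm_ge_zero] by force
    qed (use that in auto)
    finally show ?thesis using P(1)[OF that(1)] M(2) by simp
  qed
  define J where "J \<phi> = Bcontfun (\<lambda>t. z + P \<phi> (cl t))" for \<phi>
  have J: "apply_bcontfun (J \<phi>) t = z + P \<phi> (cl t)" if "\<phi> \<in> X" for \<phi> t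
  proof -
    have "continuous_on ?T (P \<phi>)"
      by (rule has_vector_derivative_imp_continuous_on[OF P(2)[OF that]])
    then have "continuous_on UNIV (\<lambda>t. P \<phi> (cl t))"
      by (rule continuous_on_compose2) (auto simp: cl_def \<delta> intro!: continuous_intros)
    then have "(\<lambda>t. z + P \<phi> (cl t)) \<in> bcontfun"
    proof (intro bcontfun_normI continuous_intros)
      show "norm (z + P \<phi> (cl t)) \<le> norm z + r" for t
        using norm_triangle_ineq[of z "P \<phi> (cl t)"] Pb[OF that cl(1)[of t]] by linarith
    qed
    then show ?thesis unfolding J_def by (simp add: Bcontfun_inverse)
  qed
  have JX: "J ` X \<subseteq> X"
  proof (intro image_subsetI XI)
    fix \<phi> t assume "\<phi> \<in> X"
    then show "apply_bcontfun (J \<phi>) t \<in> cball z r"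
      using J Pb cl(1) by (simp add: dist_norm)
  qed
  have "dist (J \<phi>) (J \<psi>) \<le> 1/2 * dist \<phi> \<psi>" if "\<phi> \<in> X" "\<psi> \<in> X" for \<phi> \<psi>
  proof (rule dist_bound)
    fix t
    have "norm ((P \<phi> (cl t) - P \<psi> (cl t)) - (P \<phi> 0 - P \<psi> 0)) \<le> (L * dist \<phi> \<psi>) * \<bar>cl t - 0\<bar>"
    proof (rule real_mean_value_bound[where T="?T"])
      fix s assume s: "s \<in> ?T"
      show "((\<lambda>t. P \<phi> t - P \<psi> t) has_vector_derivative F s (apply_bcontfun \<phi> s) - F s (apply_bcontfun \<psi> s)) (at s within ?T)"
        by (intro has_vector_derivative_diff P that s)
      have "norm (F s (apply_bcontfun \<phi> s) - F s (apply_bcontfun \<psi> s)) \<le> L * norm (apply_bcontfun \<phi> s - apply_bcontfun \<psi> s)"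
        by (intro Lip s XD that)
      also have "\<dots> \<le> L * dist \<phi> \<psi>"
        using dist_bounded[of \<phi> s \<psi>] Lip(3) by (intro mult_left_mono) (auto simp: dist_norm)
      finally show "norm (F s (apply_bcontfun \<phi> s) - F s (apply_bcontfun \<psi> s)) \<le> L * dist \<phi> \<psi>" .
    qed (use cl(1) \<delta> in auto)
    also have "\<dots> \<le> (L * dist \<phi> \<psi>) * \<delta>"
      using Tabs[OF cl(1)[of t]] Lip(3) by (intro mult_left_mono) auto
    also have "\<dots> = (L * \<delta>) * dist \<phi> \<psi>" by simp
    also have "\<dots> \<le> 1/2 * dist \<phi> \<psi>" using Lip(2) by (intro mult_right_mono) auto
    finally show "dist (apply_bcontfun (J \<phi>) t) (apply_bcontfun (J \<psi>) t) \<le> 1/2 * dist \<phi> \<psi>"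
      using P(1) that by (simp add: J dist_norm)
  qed
  then have "\<exists>!\<phi>. \<phi> \<in> X \<and> J \<phi> = \<phi>"
    using Banach_fix[OF X Xne _ _ JX, of "1/2"] by auto
  then obtain \<phi> where \<phi>: "\<phi> \<in> X" "J \<phi> = \<phi>" by blast
  have ev: "apply_bcontfun \<phi> t = z + P \<phi> t" if "t \<in> ?T" for t
    using J[OF \<phi>(1), of t] cl(2)[OF that] \<phi>(2) by simp
  have "(apply_bcontfun \<phi> has_vector_derivative F t (apply_bcontfun \<phi> t)) (at t within ?T)" if t: "t \<in> ?T" for t
  proof -
    have "((\<lambda>t. z + P \<phi> t) has_vector_derivative F t (apply_bcontfun \<phi> t)) (at t within ?T)"
      using has_vector_derivative_add[OF has_vector_derivative_const P(2)[OF \<phi>(1) t]] by simp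
    note 1 = this
    show ?thesis
      by (rule has_vector_derivative_transform[OF t _ 1]) (rule ev)
  qed
  moreover have "apply_bcontfun \<phi> 0 = z" using ev[of 0] \<delta> P(1)[OF \<phi>(1)] by simp
  ultimately show ?thesis using XD[OF \<phi>(1)] by blast
qed

text \<open>
  A linear equation is solved on an interval that does not depend on the initial value z: on the ball of
  radius \<open>norm z\<close> around z the right-hand side is bounded by a multiple of \<open>norm z\<close>.
\<close>

lemma picard_linear:
  fixes A :: "real \<Rightarrow> 'z \<Rightarrow> 'z::{real_normed_vector,heine_borel}"
  assumes lin: "\<And>t. t \<in> {-\<delta>..\<delta>} \<Longrightarrow> linear (A t)"
    and L: "\<And>t y. t \<in> {-\<delta>..\<delta>} \<Longrightarrow> norm (A t y) \<le> L * norm y" "L * \<delta> \<le> 1/2" "L \<ge> 0" "\<delta> \<ge> 0"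
    and cont: "\<And>\<phi>. continuous_on {-\<delta>..\<delta>} \<phi> \<Longrightarrow> continuous_on {-\<delta>..\<delta>} (\<lambda>t. A t (\<phi> t))"
  shows "\<exists>\<phi>. \<phi> 0 = z \<and> (\<forall>t\<in>{-\<delta>..\<delta>}. (\<phi> has_vector_derivative A t (\<phi> t)) (at t within {-\<delta>..\<delta>}))"
proof -
  have "\<exists>\<phi>. \<phi> 0 = z \<and> (\<forall>t\<in>{-\<delta>..\<delta>}. \<phi> t \<in> cball z (norm z) \<and>
    (\<phi> has_vector_derivative A t (\<phi> t)) (at t within {-\<delta>..\<delta>}))"
  proof (rule picard[of \<delta> z "norm z" A "L * (2 * norm z)" L])
    show "norm (A t y) \<le> L * (2 * norm z)" if "t \<in> {-\<delta>..\<delta>}" "y \<in> cball z (norm z)" for t y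
    proof -
      have "norm y \<le> norm z + norm (y - z)" using norm_triangle_ineq[of z "y - z"] by simp
      then have "norm y \<le> 2 * norm z" using that(2) by (simp add: dist_norm norm_minus_commute)
      then show ?thesis using L(1)[OF that(1), of y] mult_left_mono[OF _ L(3)] order_trans by blast
    qed
    have "(L * \<delta>) * (2 * norm z) \<le> 1/2 * (2 * norm z)" by (intro mult_right_mono L) auto
    then show "L * (2 * norm z) * \<delta> \<le> norm z" by (simp add: mult_ac)
    show "norm (A t y - A t y') \<le> L * norm (y - y')" if "t \<in> {-\<delta>..\<delta>}" for t y y'
      using L(1)[OF that, of "y - y'"] linear_diff[OF lin[OF that]] by simp
  qed (use assms in auto)
  then show ?thesis by blast
qed

lemma continuous_on_dder_along:
  fixes f :: "'a::{real_normed_vector,heine_borel} \<Rightarrow> 'b::real_normed_vector"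
  assumes f: "Ck_on (Suc 0) S f" and p: "continuous_on T p" "\<And>t. t \<in> T \<Longrightarrow> p t \<in> S" and z: "continuous_on T z"
  shows "continuous_on T (\<lambda>t. dder f (p t) (z t))"
proof (rule continuous_on_linear_family[OF _ _ z])
  show "linear (dder f (p t))" if "t \<in> T" for t
    by (rule linear_dder) (use f p(2)[OF that] in simp)
  have "continuous_on S (\<lambda>x. dder f x b)" for b using f by simp
  then show "continuous_on T (\<lambda>t. dder f (p t) b)" for b
    by (rule continuous_on_compose2[OF _ p(1)]) (use p(2) in auto)
qed

section \<open>The local flow of a vector field and its differential\<close>

text \<open>
  The candidate Z for the differential of the flow is the
  solution of the linearised equation along the orbit of \<open>\<xi>0\<close>; the Gronwall inequality, with the quadratic Taylor
  estimate as inhomogeneous term, then shows that the error of this linearisation is quadratic.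
\<close>

lemma smooth_local_flow:
  fixes X :: "'a \<Rightarrow> 'a::{real_normed_vector,heine_borel}"
  assumes \<Omega>: "open \<Omega>" "Ck_on 2 \<Omega> X" "\<xi>0 \<in> \<Omega>"
  obtains r \<delta> L M \<phi> Z where "r > 0" "\<delta> > 0" "cball \<xi>0 r \<subseteq> \<Omega>" "L-lipschitz_on (cball \<xi>0 r) X"
    "M \<ge> 0"
    "\<And>\<xi>. \<xi> \<in> cball \<xi>0 (r/2) \<Longrightarrow> \<phi> \<xi> 0 = \<xi>"
    "\<And>\<xi> t. \<xi> \<in> cball \<xi>0 (r/2) \<Longrightarrow> t \<in> {-\<delta>..\<delta>} \<Longrightarrow> \<phi> \<xi> t \<in> ball \<xi>0 r"
    "\<And>\<xi> t. \<xi> \<in> cball \<xi>0 (r/2) \<Longrightarrow> t \<in> {-\<delta>..\<delta>} \<Longrightarrow> norm (\<phi> \<xi> t - \<xi>) \<le> M * \<bar>t\<bar>"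
    "\<And>\<xi> t. \<xi> \<in> cball \<xi>0 (r/2) \<Longrightarrow> t \<in> {-\<delta>..\<delta>} \<Longrightarrow>
       (\<phi> \<xi> has_vector_derivative X (\<phi> \<xi> t)) (at t within {-\<delta>..\<delta>})"
    "\<And>t. t \<in> {-\<delta>..\<delta>} \<Longrightarrow> ((\<lambda>\<xi>. \<phi> \<xi> t) has_derivative Z t) (at \<xi>0)"
    "\<And>v. Z 0 v = v"
    "\<And>v. ((\<lambda>t. Z t v) has_vector_derivative dder X \<xi>0 v) (at 0)"
proof -
  obtain r where r: "r > 0" "cball \<xi>0 r \<subseteq> \<Omega>" using \<Omega>(1,3) open_contains_cball by blast
  have X2: "Ck_on (Suc (Suc 0)) \<Omega> X" using \<Omega>(2) by (simp add: numeral_2_eq_2)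
  have X1: "Ck_on (Suc 0) \<Omega> X" using X2 Ck_on_mono_Suc by blast
  obtain L1 where L1: "L1-lipschitz_on (cball \<xi>0 r) X"
    using C1_lipschitz_on_compact_convex[of \<Omega> X "cball \<xi>0 r"] X1 r(2) by auto
  obtain L2 where L2: "L2 \<ge> 0" "\<And>q v. q \<in> cball \<xi>0 r \<Longrightarrow> norm (dder X q v) \<le> L2 * norm v"
    using dder_bounded_on_compact[of \<Omega> X "cball \<xi>0 r"] X1 r(2) by auto
  obtain K where K: "K \<ge> 0" "\<And>p q. p \<in> cball \<xi>0 r \<Longrightarrow> q \<in> cball \<xi>0 r \<Longrightarrow> norm (X p - X q - dder X q (p - q)) \<le> K * (norm (p - q))\<^sup>2"
    using C2_taylor_on_compact_convex[of \<Omega> X "cball \<xi>0 r"] \<Omega>(2) r(2) by auto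
  define L where "L = L1 + L2"
  have L10: "L1 \<ge> 0" using L1 lipschitz_on_nonneg by blast
  have L: "L \<ge> 0" "L-lipschitz_on (cball \<xi>0 r) X" "\<And>q v. q \<in> cball \<xi>0 r \<Longrightarrow> norm (dder X q v) \<le> L * norm v"
  proof -
    show "L-lipschitz_on (cball \<xi>0 r) X" using L1 by (rule lipschitz_on_mono) (use L2 in \<open>auto simp: L_def\<close>)
    show "norm (dder X q v) \<le> L * norm v" if "q \<in> cball \<xi>0 r" for q v
      using L2(2)[OF that, of v] mult_right_mono[of L2 L "norm v"] L10 by (simp add: L_def)
  qed (use L10 L2 in \<open>simp add: L_def\<close>)
  have Lip: "norm (X p - X q) \<le> L * norm (p - q)" if "p \<in> cball \<xi>0 r" "q \<in> cball \<xi>0 r" for p q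
    using lipschitz_onD[OF L(2) that] by (simp add: dist_norm)
  define M where "M = norm (X \<xi>0) + L * r"
  have M: "M \<ge> 0" "\<And>p. p \<in> cball \<xi>0 r \<Longrightarrow> norm (X p) \<le> M"
  proof -
    show "M \<ge> 0" unfolding M_def using L r by simp
    fix p assume p: "p \<in> cball \<xi>0 r"
    have "norm (X p) \<le> norm (X \<xi>0) + norm (X p - X \<xi>0)" using norm_triangle_ineq[of "X \<xi>0" "X p - X \<xi>0"] by simp
    also have "norm (X p - X \<xi>0) \<le> L * norm (p - \<xi>0)" using Lip[OF p, of \<xi>0] r by simp
    also have "\<dots> \<le> L * r" using p L by (intro mult_left_mono) (auto simp: dist_norm norm_minus_commute)
    finally show "norm (X p) \<le> M" unfolding M_def by simp
  qed
  define \<delta> where "\<delta> = min (1 / (2 * (L + 1))) (r / (4 * (M + 1)))"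
  have \<delta>: "\<delta> > 0" unfolding \<delta>_def using L M r by simp
  have L\<delta>: "L * \<delta> \<le> 1/2"
  proof -
    have "L * \<delta> \<le> L * (1 / (2 * (L + 1)))" using L unfolding \<delta>_def by (intro mult_left_mono) auto
    also have "\<dots> \<le> 1/2" using L by (simp add: field_simps)
    finally show ?thesis .
  qed
  have M\<delta>: "M * \<delta> \<le> r/4"
  proof -
    have "M * \<delta> \<le> M * (r / (4 * (M + 1)))" using M unfolding \<delta>_def by (intro mult_left_mono) auto
    also have "\<dots> \<le> r/4" using M r by (simp add: field_simps)
    finally show ?thesis .
  qed
  let ?T = "{-\<delta>..\<delta>}"
  have sub: "cball \<xi> (r/4) \<subseteq> ball \<xi>0 r" if "\<xi> \<in> cball \<xi>0 (r/2)" for \<xi>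
  proof
    fix y assume "y \<in> cball \<xi> (r/4)"
    then show "y \<in> ball \<xi>0 r" using that dist_triangle[of \<xi>0 y \<xi>] r by auto
  qed
  have "\<exists>\<phi>. \<phi> 0 = \<xi> \<and> (\<forall>t\<in>?T. \<phi> t \<in> ball \<xi>0 r \<and> (\<phi> has_vector_derivative X (\<phi> t)) (at t within ?T))"
    if \<xi>: "\<xi> \<in> cball \<xi>0 (r/2)" for \<xi>
  proof -
    have "\<exists>\<phi>. \<phi> 0 = \<xi> \<and> (\<forall>t\<in>?T. \<phi> t \<in> cball \<xi> (r/4) \<and> (\<phi> has_vector_derivative X (\<phi> t)) (at t within ?T))"
    proof (rule picard[of \<delta> \<xi> "r/4" "\<lambda>t. X" M L])
      have s: "y \<in> cball \<xi>0 r" if "y \<in> cball \<xi> (r/4)" for y using sub[OF \<xi>] that by auto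
      show "continuous_on ?T (\<lambda>t. X (\<phi> t))" if "continuous_on ?T \<phi>" "\<And>t. t \<in> ?T \<Longrightarrow> \<phi> t \<in> cball \<xi> (r/4)" for \<phi>
        by (rule continuous_on_compose2[OF lipschitz_on_continuous_on[OF L(2)] that(1)]) (use s that(2) in auto)
      show "norm (X y) \<le> M" if "y \<in> cball \<xi> (r/4)" for y using M(2)[OF s[OF that]] .
      show "norm (X y - X y') \<le> L * norm (y - y')" if "y \<in> cball \<xi> (r/4)" "y' \<in> cball \<xi> (r/4)" for y y'
        using Lip[OF s s] that by blast
    qed (use L M L\<delta> M\<delta> \<delta> r in auto)
    then show ?thesis using sub[OF \<xi>] by blast
  qed
  then have "\<forall>\<xi>\<in>cball \<xi>0 (r/2). \<exists>\<phi>. \<phi> 0 = \<xi> \<and> (\<forall>t\<in>?T. \<phi> t \<in> ball \<xi>0 r \<and> (\<phi> has_vector_derivative X (\<phi> t)) (at t within ?T))"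
    by (rule ballI)
  from bchoice[OF this] obtain \<phi> where \<phi>0: "\<forall>\<xi>\<in>cball \<xi>0 (r/2). \<phi> \<xi> 0 = \<xi> \<and> (\<forall>t\<in>?T. \<phi> \<xi> t \<in> ball \<xi>0 r \<and> (\<phi> \<xi> has_vector_derivative X (\<phi> \<xi> t)) (at t within ?T))"
    by (elim exE) (rule that)
  have \<phi>: "\<phi> \<xi> 0 = \<xi>" "t \<in> ?T \<Longrightarrow> \<phi> \<xi> t \<in> ball \<xi>0 r"
    "t \<in> ?T \<Longrightarrow> (\<phi> \<xi> has_vector_derivative X (\<phi> \<xi> t)) (at t within ?T)" if "\<xi> \<in> cball \<xi>0 (r/2)" for \<xi> t
    using bspec[OF \<phi>0 that] by blast+
  have \<phi>c: "\<phi> \<xi> t \<in> cball \<xi>0 r" if "\<xi> \<in> cball \<xi>0 (r/2)" "t \<in> ?T" for \<xi> t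
    using \<phi>(2)[OF that] by auto
  have z0: "\<xi>0 \<in> cball \<xi>0 (r/2)" using r by simp
  have T0: "0 \<in> ?T" using \<delta> by simp
  have \<phi>M: "norm (\<phi> \<xi> t - \<xi>) \<le> M * \<bar>t\<bar>" if "\<xi> \<in> cball \<xi>0 (r/2)" "t \<in> ?T" for \<xi> t
    using real_mean_value_bound[OF _ \<phi>(3)[OF that(1)] M(2)[OF \<phi>c[OF that(1)]] that(2) T0] \<phi>(1)[OF that(1)]
    by simp
  have \<phi>Lip: "norm (\<phi> \<xi> t - \<phi> \<xi>0 t) \<le> 2 * norm (\<xi> - \<xi>0)" if "\<xi> \<in> cball \<xi>0 (r/2)" "t \<in> ?T" for \<xi> t
  proof -
    have "norm (\<phi> \<xi> t - \<phi> \<xi>0 t) \<le> 2 * norm (\<phi> \<xi> 0 - \<phi> \<xi>0 0) + 2 * \<delta> * 0"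
      by (rule small_gronwall[of ?T, where w'="\<lambda>t. X (\<phi> \<xi> t) - X (\<phi> \<xi>0 t)" and L=L])
         (use that L L\<delta> \<delta> z0 in \<open>auto intro!: has_vector_derivative_diff \<phi> Lip \<phi>c\<close>)
    then show ?thesis using \<phi>(1) that z0 by simp
  qed
  \<comment> \<open>Only the solutions that start at basis vectors are needed; their combinations depend linearly on the initial vector.\<close>
  define Zb where "Zb b = (SOME \<zeta>. \<zeta> 0 = b \<and> (\<forall>t\<in>?T. (\<zeta> has_vector_derivative dder X (\<phi> \<xi>0 t) (\<zeta> t)) (at t within ?T)))" for b
  have dif: "X differentiable (at (\<phi> \<xi>0 t))" if "t \<in> ?T" for t
    using \<phi>c[OF z0 that] r(2) X1 by auto
  have Zb: "Zb b 0 = b" "\<And>t. t \<in> ?T \<Longrightarrow> (Zb b has_vector_derivative dder X (\<phi> \<xi>0 t) (Zb b t)) (at t within ?T)" for b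
  proof -
    have "\<exists>\<zeta>. \<zeta> 0 = b \<and> (\<forall>t\<in>?T. (\<zeta> has_vector_derivative dder X (\<phi> \<xi>0 t) (\<zeta> t)) (at t within ?T))"
    proof (rule picard_linear[of \<delta> "\<lambda>t. dder X (\<phi> \<xi>0 t)" L b])
      show "linear (dder X (\<phi> \<xi>0 t))" if "t \<in> ?T" for t using linear_dder[OF dif[OF that]] .
      show "norm (dder X (\<phi> \<xi>0 t) y) \<le> L * norm y" if "t \<in> ?T" for t y using L(3)[OF \<phi>c[OF z0 that]] .
      show "continuous_on ?T (\<lambda>t. dder X (\<phi> \<xi>0 t) (\<zeta> t))" if "continuous_on ?T \<zeta>" for \<zeta>
        by (rule continuous_on_dder_along[OF X1 has_vector_derivative_imp_continuous_on[OF \<phi>(3)[OF z0]] _ that])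
           (use \<phi>c[OF z0] r(2) in auto)
    qed (use L L\<delta> \<delta> in auto)
    from someI_ex[OF this, folded Zb_def]
    show "Zb b 0 = b" "\<And>t. t \<in> ?T \<Longrightarrow> (Zb b has_vector_derivative dder X (\<phi> \<xi>0 t) (Zb b t)) (at t within ?T)"
      by auto
  qed
  define Z where "Z t v = (\<Sum>b\<in>fbasis. coord b v *\<^sub>R Zb b t)" for t v
  have linZ: "linear (Z t)" for t
    unfolding Z_def by (intro bounded_linear.linear bounded_linear_sum bounded_linear_scaleR_const bounded_linear_coord)
  have Z0: "Z 0 v = v" for v unfolding Z_def Zb(1) by (rule sum_coord)
  have Z': "((\<lambda>t. Z t v) has_vector_derivative dder X (\<phi> \<xi>0 t) (Z t v)) (at t within ?T)" if "t \<in> ?T" for t v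
  proof -
    have "((\<lambda>t. Z t v) has_vector_derivative (\<Sum>b\<in>fbasis. coord b v *\<^sub>R dder X (\<phi> \<xi>0 t) (Zb b t))) (at t within ?T)"
      unfolding Z_def
      by (intro has_vector_derivative_sum bounded_linear.has_vector_derivative[OF bounded_linear_scaleR_right] Zb that)
    also have "(\<Sum>b\<in>fbasis. coord b v *\<^sub>R dder X (\<phi> \<xi>0 t) (Zb b t)) = dder X (\<phi> \<xi>0 t) (Z t v)"
      unfolding Z_def using linear_dder[OF dif[OF that]] by (simp add: linear_sum linear_cmul)
    finally show ?thesis .
  qed
  have err: "norm (\<phi> \<xi> t - \<phi> \<xi>0 t - Z t (\<xi> - \<xi>0)) \<le> (8 * \<delta> * K) * (norm (\<xi> - \<xi>0))\<^sup>2"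
    if \<xi>: "\<xi> \<in> cball \<xi>0 (r/2)" and t: "t \<in> ?T" for \<xi> t
  proof -
    let ?w = "\<lambda>t. \<phi> \<xi> t - \<phi> \<xi>0 t - Z t (\<xi> - \<xi>0)"
    let ?w' = "\<lambda>t. X (\<phi> \<xi> t) - X (\<phi> \<xi>0 t) - dder X (\<phi> \<xi>0 t) (Z t (\<xi> - \<xi>0))"
    have "norm (?w t) \<le> 2 * norm (?w 0) + 2 * \<delta> * (K * (2 * norm (\<xi> - \<xi>0))\<^sup>2)"
    proof (rule small_gronwall[of ?T, where w'="?w'" and L=L])
      fix s assume s: "s \<in> ?T"
      show "(?w has_vector_derivative ?w' s) (at s within ?T)"
        by (intro has_vector_derivative_diff \<phi>(3) Z' \<xi> z0 s)
      let ?p = "\<phi> \<xi> s" and ?q = "\<phi> \<xi>0 s"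
      have E: "?w' s = (X ?p - X ?q - dder X ?q (?p - ?q)) + dder X ?q (?w s)"
        using linear_dder[OF dif[OF s]] by (simp add: linear_diff)
      have "norm (?w' s) \<le> norm (X ?p - X ?q - dder X ?q (?p - ?q)) + norm (dder X ?q (?w s))"
        unfolding E by (rule norm_triangle_ineq)
      also have "\<dots> \<le> K * (norm (?p - ?q))\<^sup>2 + L * norm (?w s)"
        by (intro add_mono K L \<phi>c \<xi> z0 s)
      also have "K * (norm (?p - ?q))\<^sup>2 \<le> K * (2 * norm (\<xi> - \<xi>0))\<^sup>2"
        by (intro mult_left_mono K power_mono \<phi>Lip \<xi> s) auto
      finally show "norm (?w' s) \<le> L * norm (?w s) + K * (2 * norm (\<xi> - \<xi>0))\<^sup>2" by simp
    qed (use t L L\<delta> \<delta> K in auto)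
    then show ?thesis using \<phi>(1)[OF \<xi>] \<phi>(1)[OF z0] by (simp add: Z0 power2_eq_square algebra_simps)
  qed
  have der: "((\<lambda>\<xi>. \<phi> \<xi> t) has_derivative Z t) (at \<xi>0)" if t: "t \<in> ?T" for t
    unfolding has_derivative_at_alt
  proof (intro conjI allI impI)
    show "bounded_linear (Z t)" using linear_imp_bounded_linear[OF linZ] .
    fix e :: real assume e: "e > 0"
    define C where "C = 8 * \<delta> * K"
    have C: "C \<ge> 0" unfolding C_def using \<delta> K by simp
    define d where "d = min (r/2) (e / (C + 1))"
    have "d > 0" unfolding d_def using r e C by simp
    moreover have "norm (\<phi> y t - \<phi> \<xi>0 t - Z t (y - \<xi>0)) \<le> e * norm (y - \<xi>0)" if y: "norm (y - \<xi>0) < d" for y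
    proof -
      have "y \<in> cball \<xi>0 (r/2)" using y by (simp add: d_def dist_norm norm_minus_commute)
      from err[OF this t] have "norm (\<phi> y t - \<phi> \<xi>0 t - Z t (y - \<xi>0)) \<le> (C * norm (y - \<xi>0)) * norm (y - \<xi>0)"
        by (simp add: C_def power2_eq_square mult_ac)
      also have "C * norm (y - \<xi>0) \<le> C * (e / (C + 1))" using y C by (intro mult_left_mono) (auto simp: d_def)
      also have "\<dots> \<le> e" using C e by (simp add: field_simps)
      finally show ?thesis by (simp add: mult_right_mono)
    qed
    ultimately show "\<exists>d>0. \<forall>y. norm (y - \<xi>0) < d \<longrightarrow> norm (\<phi> y t - \<phi> \<xi>0 t - Z t (y - \<xi>0)) \<le> e * norm (y - \<xi>0)"
      by blast
  qed
  have Zd: "((\<lambda>t. Z t v) has_vector_derivative dder X \<xi>0 v) (at 0)" for v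
  proof -
    have "at 0 within ?T = at (0::real)" using \<delta> by (intro at_within_interior) simp
    then show ?thesis using Z'[OF T0, of v] \<phi>(1)[OF z0] Z0 by simp
  qed
  show thesis
    by (rule that[OF r(1) \<delta> r(2) L(2) M(1) \<phi>(1) \<phi>(2) \<phi>M \<phi>(3) der Z0 Zd])
qed


section \<open>Charts, tangent vectors and vector fields\<close>

lemma smooth_on_empty [simp]: "smooth_on {} f"
  by (rule smooth_on_Union) simp

locale smooth_manifold =
  fixes A :: "('m::{t2_space,second_countable_topology}, 'e::{real_normed_vector,heine_borel}) chart set"
  assumes atlas: "smooth_atlas A"
begin

lemma open_cdom: "c \<in> A \<Longrightarrow> open (cdom c)"
  using atlas unfolding smooth_atlas_def by blast

lemma open_cimage: "c \<in> A \<Longrightarrow> open (cmap c ` cdom c)"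
  using atlas unfolding smooth_atlas_def by blast

lemma chart_homeomorphism:
  "c \<in> A \<Longrightarrow> homeomorphism (cdom c) (cmap c ` cdom c) (cmap c) (cinv c)"
  using atlas unfolding smooth_atlas_def by blast

lemma chart_exists: "\<exists>c. c \<in> A \<and> x \<in> cdom c"
  using atlas unfolding smooth_atlas_def by blast

lemma chart_at: "chart_at A x \<in> A" "x \<in> cdom (chart_at A x)"
  using someI_ex[OF chart_exists[of x]] unfolding chart_at_def by auto

lemma cinv_cmap: "c \<in> A \<Longrightarrow> x \<in> cdom c \<Longrightarrow> cinv c (cmap c x) = x"
  using chart_homeomorphism homeomorphism_apply1 by metis

lemma cinv_in_cdom: "c \<in> A \<Longrightarrow> y \<in> cmap c ` cdom c \<Longrightarrow> cinv c y \<in> cdom c"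
  by (auto simp: cinv_cmap)

lemma cmap_cinv: "c \<in> A \<Longrightarrow> y \<in> cmap c ` cdom c \<Longrightarrow> cmap c (cinv c y) = y"
  by (auto simp: cinv_cmap)

lemma continuous_cmap: "c \<in> A \<Longrightarrow> continuous_on (cdom c) (cmap c)"
  using chart_homeomorphism homeomorphism_cont1 by metis

lemma continuous_cinv: "c \<in> A \<Longrightarrow> continuous_on (cmap c ` cdom c) (cinv c)"
  using chart_homeomorphism homeomorphism_cont2 by metis

lemma mem_cimage_Int:
  "c \<in> A \<Longrightarrow> y \<in> cmap c ` (cdom c \<inter> U) \<longleftrightarrow> y \<in> cmap c ` cdom c \<and> cinv c y \<in> U"
  by (auto simp: image_iff cinv_cmap)

lemma open_cimage_Int:
  assumes "c \<in> A" "open U"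
  shows "open (cmap c ` (cdom c \<inter> U))"
proof -
  have "cmap c ` (cdom c \<inter> U) = cmap c ` cdom c \<inter> cinv c -` U"
    using mem_cimage_Int[OF assms(1)] by auto
  then show ?thesis
    using continuous_open_preimage[OF continuous_cinv[OF assms(1)] open_cimage[OF assms(1)] assms(2)] by simp
qed

lemma smooth_transition:
  "c \<in> A \<Longrightarrow> d \<in> A \<Longrightarrow> smooth_on (cmap c ` (cdom c \<inter> cdom d)) (\<lambda>y. cmap d (cinv c y))"
  using atlas unfolding smooth_atlas_def by blast

lemma transition_differentiable:
  assumes "c \<in> A" "d \<in> A" "x \<in> cdom c" "x \<in> cdom d"
  shows "(\<lambda>y. cmap d (cinv c y)) differentiable (at (cmap c x))"
  using smooth_on_differentiable[OF smooth_transition[OF assms(1,2)]] assms by blast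

text \<open>
  On a set inside a single chart, smoothness needs to be checked in that chart only.
\<close>

lemma smooth_on_change_chart:
  assumes c: "c \<in> A" and e: "e \<in> A" and U: "open U" "U \<subseteq> cdom c"
    and h: "smooth_on (cmap c ` U) (\<lambda>y. h (cinv c y))"
  shows "smooth_on (cmap e ` (cdom e \<inter> U)) (\<lambda>y. h (cinv e y))"
proof -
  let ?S = "cmap e ` (cdom e \<inter> U)"
  have oS: "open ?S" by (rule open_cimage_Int[OF e U(1)])
  have oT: "open (cmap c ` U)"
    using open_cimage_Int[OF c U(1)] U(2) by (simp add: Int_absorb1)
  have "smooth_on ?S (\<lambda>y. h (cinv c (cmap c (cinv e y))))"
  proof (rule smooth_on_compose[OF oS oT _ h])
    show "(\<lambda>y. cmap c (cinv e y)) ` ?S \<subseteq> cmap c ` U"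
      using cinv_cmap[OF e] by auto
    show "smooth_on ?S (\<lambda>y. cmap c (cinv e y))"
      by (rule smooth_on_subset[OF smooth_transition[OF e c]]) (use U(2) in auto)
  qed
  then show ?thesis
  proof (rule smooth_on_cong[OF oS, rotated])
    fix y assume "y \<in> ?S"
    then have "cinv e y \<in> cdom c" using mem_cimage_Int[OF e] U(2) by blast
    then show "h (cinv c (cmap c (cinv e y))) = h (cinv e y)" using cinv_cmap[OF c] by simp
  qed
qed

lemma smooth_fun_chartI:
  assumes "c \<in> A" "open U" "U \<subseteq> cdom c" "smooth_on (cmap c ` U) (\<lambda>y. h (cinv c y))"
  shows "smooth_fun A U h"
  unfolding smooth_fun_def using smooth_on_change_chart assms by blast

lemma has_derivative_change_chart:
  assumes "c \<in> A" "d \<in> A" "x \<in> cdom c" "x \<in> cdom d"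
    and h: "(\<lambda>y. h (cinv c y)) differentiable (at (cmap c x))"
  shows "((\<lambda>y. h (cinv d y)) has_derivative
    (\<lambda>v. dder (\<lambda>y. h (cinv c y)) (cmap c x) (dder (\<lambda>y. cmap c (cinv d y)) (cmap d x) v))) (at (cmap d x))"
proof -
  let ?S = "cmap d ` (cdom d \<inter> cdom c)"
  have S: "open ?S" "cmap d x \<in> ?S" using open_cimage_Int open_cdom assms by auto
  have e: "cmap c (cinv d (cmap d x)) = cmap c x" using cinv_cmap assms by simp
  have "((\<lambda>y. h (cinv c (cmap c (cinv d y)))) has_derivative
    (\<lambda>v. dder (\<lambda>y. h (cinv c y)) (cmap c x) (dder (\<lambda>y. cmap c (cinv d y)) (cmap d x) v))) (at (cmap d x))"
    by (rule has_derivative_compose[OF has_derivative_dder[OF transition_differentiable]])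
       (use assms e has_derivative_dder[OF h] in auto)
  then show ?thesis
  proof (rule has_derivative_transform_within_open[OF _ S])
    fix y assume "y \<in> ?S"
    then have "cinv d y \<in> cdom c" using mem_cimage_Int[OF assms(2)] by blast
    then show "h (cinv c (cmap c (cinv d y))) = h (cinv d y)" using cinv_cmap[OF assms(1)] by simp
  qed
qed

text \<open>
  The transition functions of the tangent bundle.
\<close>

abbreviation trans :: "('m,'e) chart \<Rightarrow> ('m,'e) chart \<Rightarrow> 'm \<Rightarrow> 'e \<Rightarrow> 'e" where
  "trans c d x \<equiv> dder (\<lambda>y. cmap d (cinv c y)) (cmap c x)"

lemma linear_trans: "c \<in> A \<Longrightarrow> d \<in> A \<Longrightarrow> x \<in> cdom c \<Longrightarrow> x \<in> cdom d \<Longrightarrow> linear (trans c d x)"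
  by (intro linear_dder transition_differentiable)

lemma trans_trans:
  assumes "c \<in> A" "d \<in> A" "e \<in> A" "x \<in> cdom c" "x \<in> cdom d" "x \<in> cdom e"
  shows "trans d e x (trans c d x b) = trans c e x b"
  using dderI[OF has_derivative_change_chart[of d c x "cmap e"]] transition_differentiable assms by metis

lemma trans_refl:
  assumes "c \<in> A" "x \<in> cdom c"
  shows "trans c c x b = b"
proof -
  have "trans c c x = dder (\<lambda>y. y) (cmap c x)"
    by (rule dder_cong[OF open_cimage[OF assms(1)]]) (use assms cmap_cinv in auto)
  then show ?thesis by simp
qed

lemma mem_bdom: "x \<in> bdom (tangent_bundle A) c \<longleftrightarrow> c \<in> A \<and> x \<in> cdom c"
  by (simp add: tangent_bundle_def)

lemma btrans_tangent_bundle: "btrans (tangent_bundle A) c d x = trans c d x"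
  by (simp add: tangent_bundle_def)

lemma tangent_spaceD:
  assumes "v \<in> tangent_space A x"
  shows "\<not> (c \<in> A \<and> x \<in> cdom c) \<Longrightarrow> v c = 0"
    "c \<in> A \<Longrightarrow> d \<in> A \<Longrightarrow> x \<in> cdom c \<Longrightarrow> x \<in> cdom d \<Longrightarrow> v d = trans c d x (v c)"
  using assms unfolding fibre_def mem_Collect_eq Int_iff mem_bdom btrans_tangent_bundle by blast+

lemma tangent_spaceI:
  assumes "\<And>c. \<not> (c \<in> A \<and> x \<in> cdom c) \<Longrightarrow> v c = 0"
    "\<And>c d. c \<in> A \<Longrightarrow> d \<in> A \<Longrightarrow> x \<in> cdom c \<Longrightarrow> x \<in> cdom d \<Longrightarrow> v d = trans c d x (v c)"
  shows "v \<in> tangent_space A x"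
  unfolding fibre_def mem_Collect_eq Int_iff mem_bdom btrans_tangent_bundle using assms by blast

abbreviation const_field :: "('m,'e) chart \<Rightarrow> 'e \<Rightarrow> 'm \<Rightarrow> ('m,'e) tvec" where
  "const_field \<equiv> const_section (tangent_bundle A)"

lemma const_field_eq:
  "const_field c b x j = (if c \<in> A \<and> x \<in> cdom c \<and> j \<in> A \<and> x \<in> cdom j then trans c j x b else 0)"
  by (simp add: const_section_def mem_bdom btrans_tangent_bundle)

lemma const_field_tangent:
  assumes "c \<in> A" "x \<in> cdom c"
  shows "const_field c b x \<in> tangent_space A x"
proof (rule tangent_spaceI)
  fix d e assume de: "d \<in> A" "e \<in> A" "x \<in> cdom d" "x \<in> cdom e"
  then show "const_field c b x e = trans d e x (const_field c b x d)"
    using trans_trans[OF assms(1) de(1,2) assms(2) de(3,4)] assms by (simp add: const_field_eq)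
qed (auto simp: const_field_eq)

lemma const_field_self: "c \<in> A \<Longrightarrow> x \<in> cdom c \<Longrightarrow> const_field c b x c = b"
  by (simp add: const_field_eq trans_refl)

text \<open>
  A tangent vector is determined by its components in one chart, and every tangent vector is the value
  of a field with constant components.
\<close>

lemma tangent_eq_const_field:
  assumes "v \<in> tangent_space A x" "c \<in> A" "x \<in> cdom c"
  shows "v = const_field c (v c) x"
proof
  show "v j = const_field c (v c) x j" for j
    using tangent_spaceD(1)[OF assms(1), of j] tangent_spaceD(2)[OF assms(1,2) _ assms(3), of j] assms(2,3)
    unfolding const_field_eq by metis
qed

lemma tangent_zero_iff:
  assumes "v \<in> tangent_space A x" "c \<in> A" "x \<in> cdom c"
  shows "v = (\<lambda>_. 0) \<longleftrightarrow> v c = 0"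
proof
  assume "v c = 0"
  then have "v = const_field c 0 x" using tangent_eq_const_field[OF assms] by simp
  then show "v = (\<lambda>_. 0)"
  proof (rule ssubst)
    show "const_field c 0 x = (\<lambda>_. 0)"
      by (rule ext) (auto simp: const_field_eq linear_0[OF linear_trans])
  qed
qed simp

lemma const_field_linear:
  assumes "c \<in> A" "x \<in> cdom c"
  shows "const_field c (s *\<^sub>R a + t *\<^sub>R b) x = (\<lambda>j. s *\<^sub>R const_field c a x j + t *\<^sub>R const_field c b x j)"
proof
  fix j
  show "const_field c (s *\<^sub>R a + t *\<^sub>R b) x j = s *\<^sub>R const_field c a x j + t *\<^sub>R const_field c b x j"
    using linear_trans[of c j x] by (auto simp: const_field_eq linear_add linear_cmul)
qed

lemma vector_field_tangent: "vector_field A U X \<Longrightarrow> x \<in> U \<Longrightarrow> X x \<in> tangent_space A x"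
  unfolding smooth_section_def by blast

lemma vector_field_component:
  assumes "vector_field A U X" "c \<in> A"
  shows "smooth_fun A (U \<inter> cdom c) (\<lambda>x. X x c)"
proof -
  have "bdom (tangent_bundle A) c = cdom c" using assms(2) by (simp add: tangent_bundle_def)
  moreover have "smooth_fun A (U \<inter> bdom (tangent_bundle A) c) (\<lambda>x. X x c)"
    using assms(1) unfolding smooth_section_def by blast
  ultimately show ?thesis by simp
qed

lemma vector_field_chart:
  assumes "vector_field A U X" "c \<in> A"
  shows "smooth_on (cmap c ` (cdom c \<inter> U)) (\<lambda>y. X (cinv c y) c)"
proof -
  note vector_field_component[OF assms]
  then have "smooth_on (cmap c ` (cdom c \<inter> (U \<inter> cdom c))) (\<lambda>y. X (cinv c y) c)"
    unfolding smooth_fun_def using assms(2) by blast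
  then show ?thesis by (rule smooth_on_subset) auto
qed

lemma smooth_trans:
  assumes "c \<in> A" "d \<in> A"
  shows "smooth_on (cmap c ` (cdom c \<inter> cdom d)) (\<lambda>y. trans c d (cinv c y) b)"
proof (rule smooth_on_cong[OF open_cimage_Int[OF assms(1) open_cdom[OF assms(2)]] _ smooth_on_dder[OF smooth_transition[OF assms]]])
  fix y assume "y \<in> cmap c ` (cdom c \<inter> cdom d)"
  then show "dder (\<lambda>y. cmap d (cinv c y)) y b = trans c d (cinv c y) b"
    using cmap_cinv[OF assms(1)] by auto
qed

lemma vector_fieldI:
  assumes "\<And>x. x \<in> U \<Longrightarrow> X x \<in> tangent_space A x"
    and "\<And>c. c \<in> A \<Longrightarrow> smooth_fun A (U \<inter> cdom c) (\<lambda>x. X x c)"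
  shows "vector_field A U X"
  unfolding smooth_section_def
proof (intro conjI ballI allI)
  show "smooth_fun A (U \<inter> bdom (tangent_bundle A) i) (\<lambda>x. X x i)" for i
    using assms(2)[of i] by (cases "i \<in> A") (auto simp: tangent_bundle_def smooth_fun_def)
qed (use assms(1) in blast)

lemma vector_field_of_component:
  assumes c: "c \<in> A" and U: "open U" "U \<subseteq> cdom c"
    and h: "smooth_on (cmap c ` U) (\<lambda>y. h (cinv c y))"
  shows "vector_field A U (\<lambda>x. const_field c (h x) x)"
proof (rule vector_fieldI)
  fix x assume "x \<in> U"
  then show "const_field c (h x) x \<in> tangent_space A x"
    using const_field_tangent[OF c] U by blast
next
  fix d assume d: "d \<in> A"
  have o: "open (U \<inter> cdom d)" using U open_cdom[OF d] by blast
  have o': "open (cmap c ` (U \<inter> cdom d))"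
    using open_cimage_Int[OF c o] U(2) by (simp add: Int_absorb1 le_infI1)
  have mem: "cinv c y \<in> cdom c \<inter> cdom d \<and> cmap c (cinv c y) = y" if "y \<in> cmap c ` (U \<inter> cdom d)" for y
    using that cinv_cmap[OF c] U by auto
  show "smooth_fun A (U \<inter> cdom d) (\<lambda>x. const_field c (h x) x d)"
  proof (rule smooth_fun_chartI[OF c o])
    have "smooth_on (cmap c ` (U \<inter> cdom d)) (\<lambda>y. trans c d (cinv c y) (h (cinv c y)))"
    proof (rule smooth_on_bilinear_family[OF o', where N="\<lambda>y. trans c d (cinv c y)"])
      show "linear (trans c d (cinv c y))" if "y \<in> cmap c ` (U \<inter> cdom d)" for y
        using linear_trans[OF c d] mem[OF that] by blast
      show "smooth_on (cmap c ` (U \<inter> cdom d)) (\<lambda>y. trans c d (cinv c y) b)" for b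
        by (rule smooth_on_subset[OF smooth_trans[OF c d]]) (use U in auto)
      show "smooth_on (cmap c ` (U \<inter> cdom d)) (\<lambda>y. h (cinv c y))"
        by (rule smooth_on_subset[OF h]) auto
    qed
    then show "smooth_on (cmap c ` (U \<inter> cdom d)) (\<lambda>y. const_field c (h (cinv c y)) (cinv c y) d)"
      by (rule smooth_on_cong[OF o', rotated]) (use mem c d in \<open>simp add: const_field_eq\<close>)
  qed (use U in auto)
qed

lemma vector_field_const_field:
  assumes "c \<in> A" "open U" "U \<subseteq> cdom c"
  shows "vector_field A U (const_field c b)"
  using vector_field_of_component[OF assms, of "\<lambda>_. b"] by simp

text \<open>
  A coordinate field is multiplied by a bump function and extended by zero.  The two open sets on which
  the result is visibly smooth are the chart domain and the complement of the support.
\<close>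

lemma vector_field_exists:
  assumes c: "c \<in> A" and x: "x \<in> cdom c"
  obtains Y where "vector_field A UNIV Y" "Y x c = w"
proof -
  obtain \<psi> K where \<psi>: "smooth_on UNIV \<psi>" "\<psi> (cmap c x) = 1" "compact K" "K \<subseteq> cmap c ` cdom c"
    "\<And>y. y \<notin> K \<Longrightarrow> \<psi> y = (0::real)"
    using bump_function_exists[OF open_cimage[OF c], of "cmap c x"] x by blast
  define Y where "Y y = (if y \<in> cdom c then const_field c (\<psi> (cmap c y) *\<^sub>R w) y else (\<lambda>_. 0))" for y
  have "compact (cinv c ` K)"
    using compact_continuous_image[OF continuous_on_subset[OF continuous_cinv[OF c] \<psi>(4)] \<psi>(3)] .
  then have oV: "open (- cinv c ` K)" by (simp add: compact_imp_closed open_Compl)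
  have Y0: "Y y = (\<lambda>_. 0)" if "y \<in> - cinv c ` K" for y
  proof (cases "y \<in> cdom c")
    case True
    then have "cmap c y \<notin> K" using that cinv_cmap[OF c] by force
    then have "Y y = const_field c 0 y" using \<psi>(5) True by (simp add: Y_def)
    moreover have "const_field c 0 y = (\<lambda>_. 0)"
      by (rule ext) (auto simp: const_field_eq linear_0[OF linear_trans])
    ultimately show ?thesis by simp
  qed (simp add: Y_def)
  have cov: "y \<in> cdom c \<or> y \<in> - cinv c ` K" for y
    using cinv_in_cdom[OF c] \<psi>(4) by auto
  have sm: "smooth_on (cmap c ` cdom c) (\<lambda>y. \<psi> (cmap c (cinv c y)) *\<^sub>R w)"
  proof (rule smooth_on_cong[OF open_cimage[OF c]])
    show "smooth_on (cmap c ` cdom c) (\<lambda>y. \<psi> y *\<^sub>R w)"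
      by (intro smooth_on_scaleR open_cimage c smooth_on_subset[OF \<psi>(1)] smooth_on_const) simp
  qed (simp add: cmap_cinv[OF c])
  have V1: "vector_field A (cdom c) (\<lambda>y. const_field c (\<psi> (cmap c y) *\<^sub>R w) y)"
    by (rule vector_field_of_component[OF c open_cdom[OF c] order_refl sm])
  have "vector_field A UNIV Y"
  proof (rule vector_fieldI)
    fix y
    show "Y y \<in> tangent_space A y"
    proof (cases "y \<in> cdom c")
      case True
      then show ?thesis using vector_field_tangent[OF V1 True] by (simp add: Y_def)
    next
      case False
      then show ?thesis
        by (intro tangent_spaceI) (auto simp: Y_def linear_0[OF linear_trans])
    qed
  next
    fix d assume d: "d \<in> A"
    show "smooth_fun A (UNIV \<inter> cdom d) (\<lambda>x. Y x d)"
      unfolding smooth_fun_def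
    proof (intro ballI smooth_on_Union)
      fix e z assume e: "e \<in> A" and z: "z \<in> cmap e ` (cdom e \<inter> (UNIV \<inter> cdom d))"
      have ze: "z \<in> cmap e ` cdom e" "cinv e z \<in> cdom d" using z mem_cimage_Int[OF e] by auto
      show "\<exists>U. open U \<and> z \<in> U \<and> smooth_on U (\<lambda>y. Y (cinv e y) d)"
      proof (cases "cinv e z \<in> cdom c")
        case True
        let ?U = "cmap e ` (cdom e \<inter> (cdom c \<inter> cdom d))"
        have oU: "open ?U" by (intro open_cimage_Int e open_Int open_cdom c d)
        have "smooth_fun A (cdom c \<inter> cdom d) (\<lambda>x. const_field c (\<psi> (cmap c x) *\<^sub>R w) x d)"
          by (rule vector_field_component[OF V1 d])
        then have "smooth_on ?U (\<lambda>y. const_field c (\<psi> (cmap c (cinv e y)) *\<^sub>R w) (cinv e y) d)"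
          unfolding smooth_fun_def using e by blast
        then have "smooth_on ?U (\<lambda>y. Y (cinv e y) d)"
          by (rule smooth_on_cong[OF oU, rotated]) (use mem_cimage_Int[OF e] in \<open>auto simp: Y_def\<close>)
        moreover have "z \<in> ?U" using ze True mem_cimage_Int[OF e] by blast
        ultimately show ?thesis using oU by blast
      next
        case False
        let ?U = "cmap e ` (cdom e \<inter> (- cinv c ` K))"
        have oU: "open ?U" by (intro open_cimage_Int e oV)
        have "smooth_on ?U (\<lambda>y. Y (cinv e y) d)"
          by (rule smooth_on_cong[OF oU _ smooth_on_const[of ?U 0]]) (use mem_cimage_Int[OF e] Y0 in auto)
        moreover have "z \<in> ?U" using ze False cov mem_cimage_Int[OF e] by blast
        ultimately show ?thesis using oU by blast
      qed
    qed
  qed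
  moreover have "Y x c = w" using x \<psi>(2) const_field_self[OF c x] by (simp add: Y_def)
  ultimately show thesis by (rule that)
qed

text \<open>
  Both \<open>dfun\<close> and \<open>differential\<close> are defined through the arbitrary choice \<open>chart_at\<close>; this lemma and the
  next one allow any chart to be used instead.
\<close>

lemma dfun_chart:
  assumes "c \<in> A" "x \<in> cdom c" "v \<in> tangent_space A x" "(\<lambda>y. f (cinv c y)) differentiable (at (cmap c x))"
  shows "dfun A f x v = dder (\<lambda>y. f (cinv c y)) (cmap c x) (v c)"
  unfolding dfun_def
  using dderI[OF has_derivative_change_chart[OF assms(1) chart_at(1) assms(2) chart_at(2) assms(4)]]
    tangent_spaceD(2)[OF assms(3) chart_at(1) assms(1) chart_at(2) assms(2)] by simp

lemma differential_chart:
  assumes "c \<in> A" "x \<in> cdom c" "v \<in> tangent_space A x" "d \<in> B" "u x \<in> cdom d"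
    "(\<lambda>y. cmap d (u (cinv c y))) differentiable (at (cmap c x))"
  shows "differential A B u x v d = dder (\<lambda>y. cmap d (u (cinv c y))) (cmap c x) (v c)"
  unfolding differential_def
  using dderI[OF has_derivative_change_chart[OF assms(1) chart_at(1) assms(2) chart_at(2), of "\<lambda>y. cmap d (u y)"]]
    tangent_spaceD(2)[OF assms(3) chart_at(1) assms(1) chart_at(2) assms(2)] assms by simp

end

locale smooth_manifold_map = M: smooth_manifold A + N: smooth_manifold B
  for A :: "('m::{t2_space,second_countable_topology}, 'a::{real_normed_vector,heine_borel}) chart set"
    and B :: "('n::{t2_space,second_countable_topology}, 'b::{real_normed_vector,heine_borel}) chart set" +
  fixes u :: "'m \<Rightarrow> 'n"
  assumes smooth: "smooth_map A B u"
begin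

lemma continuous_map: "continuous_on UNIV u"
  using smooth unfolding smooth_map_def by blast

lemma open_preimage: "open V \<Longrightarrow> open (u -` V)"
  using continuous_map open_vimage by blast

abbreviation rep :: "('m,'a) chart \<Rightarrow> ('n,'b) chart \<Rightarrow> 'a \<Rightarrow> 'b" where
  "rep c d y \<equiv> cmap d (u (cinv c y))"

abbreviation repdom :: "('m,'a) chart \<Rightarrow> ('n,'b) chart \<Rightarrow> 'a set" where
  "repdom c d \<equiv> cmap c ` (cdom c \<inter> u -` cdom d)"

lemma open_repdom: "c \<in> A \<Longrightarrow> d \<in> B \<Longrightarrow> open (repdom c d)"
  by (intro M.open_cimage_Int open_preimage N.open_cdom)

lemma mem_repdom: "c \<in> A \<Longrightarrow> y \<in> repdom c d \<longleftrightarrow> y \<in> cmap c ` cdom c \<and> u (cinv c y) \<in> cdom d"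
  using M.mem_cimage_Int[of c y "u -` cdom d"] by simp

lemma cmap_mem_repdom: "x \<in> cdom c \<Longrightarrow> u x \<in> cdom d \<Longrightarrow> cmap c x \<in> repdom c d"
  by blast

lemma smooth_rep: "c \<in> A \<Longrightarrow> d \<in> B \<Longrightarrow> smooth_on (repdom c d) (rep c d)"
  using smooth unfolding smooth_map_def by blast

lemma rep_differentiable: "c \<in> A \<Longrightarrow> d \<in> B \<Longrightarrow> y \<in> repdom c d \<Longrightarrow> rep c d differentiable (at y)"
  using smooth_on_differentiable smooth_rep by blast

lemma differential_rep:
  assumes "c \<in> A" "x \<in> cdom c" "v \<in> tangent_space A x" "d \<in> B" "u x \<in> cdom d"
  shows "differential A B u x v d = dder (rep c d) (cmap c x) (v c)"
  using assms by (intro M.differential_chart rep_differentiable cmap_mem_repdom)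

text \<open>
  This makes \<open>differential A B u x v\<close> an element of the tangent space at \<open>u x\<close>.
\<close>

lemma rep_change_target:
  assumes c: "c \<in> A" "x \<in> cdom c" and d: "d \<in> B" "u x \<in> cdom d" and e: "e \<in> B" "u x \<in> cdom e"
  shows "dder (rep c e) (cmap c x) v = N.trans d e (u x) (dder (rep c d) (cmap c x) v)"
proof -
  let ?S = "repdom c d"
  have S: "open ?S" "cmap c x \<in> ?S" using open_repdom c d by auto
  have 1: "(rep c d has_derivative dder (rep c d) (cmap c x)) (at (cmap c x))"
    by (rule has_derivative_dder[OF rep_differentiable[OF c(1) d(1) S(2)]])
  have "((\<lambda>y. cmap e (cinv d y)) has_derivative N.trans d e (u x)) (at (rep c d (cmap c x)))"
    using has_derivative_dder[OF N.transition_differentiable[OF d(1) e(1) d(2) e(2)]]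
    unfolding M.cinv_cmap[OF c] .
  from has_derivative_compose[OF 1 this]
  have "((\<lambda>y. cmap e (cinv d (rep c d y))) has_derivative (\<lambda>v. N.trans d e (u x) (dder (rep c d) (cmap c x) v))) (at (cmap c x))" .
  then have "(rep c e has_derivative (\<lambda>v. N.trans d e (u x) (dder (rep c d) (cmap c x) v))) (at (cmap c x))"
  proof (rule has_derivative_transform_within_open[OF _ S])
    fix y assume "y \<in> ?S"
    then have "u (cinv c y) \<in> cdom d" using mem_repdom[OF c(1)] by blast
    then show "cmap e (cinv d (rep c d y)) = rep c e y" using N.cinv_cmap[OF d(1)] by simp
  qed
  from dderI[OF this] show ?thesis by simp
qed

lemma differential_tangent:
  assumes v: "v \<in> tangent_space A x"
  shows "differential A B u x v \<in> tangent_space B (u x)"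
proof (rule N.tangent_spaceI)
  fix c d assume "c \<in> B" "d \<in> B" "u x \<in> cdom c" "u x \<in> cdom d"
  then have c: "c \<in> B" "u x \<in> cdom c" and d: "d \<in> B" "u x \<in> cdom d" by blast+
  show "differential A B u x v d = N.trans c d (u x) (differential A B u x v c)"
    unfolding differential_rep[OF M.chart_at v c] differential_rep[OF M.chart_at v d]
    by (rule rep_change_target[OF M.chart_at c d])
next
  fix c assume "\<not> (c \<in> B \<and> u x \<in> cdom c)"
  then show "differential A B u x v c = 0" unfolding differential_def by (rule if_not_P)
qed

end


section \<open>The gradient\<close>

locale riemannian = smooth_manifold A
  for A :: "('m::{t2_space,second_countable_topology}, 'e::{real_normed_vector,heine_borel}) chart set" +
  fixes g :: "'m \<Rightarrow> ('m, 'e) tvec \<Rightarrow> ('m, 'e) tvec \<Rightarrow> real"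
  assumes metric: "riemannian_metric A g"
begin

lemma metric_sym: "v \<in> tangent_space A x \<Longrightarrow> w \<in> tangent_space A x \<Longrightarrow> g x v w = g x w v"
  by (rule metric[unfolded riemannian_metric_def, THEN conjunct1, rule_format])

lemma metric_linear:
  "v \<in> tangent_space A x \<Longrightarrow> v' \<in> tangent_space A x \<Longrightarrow> w \<in> tangent_space A x \<Longrightarrow>
    g x (\<lambda>c. a *\<^sub>R v c + b *\<^sub>R v' c) w = a * g x v w + b * g x v' w"
  by (rule metric[unfolded riemannian_metric_def, THEN conjunct2, THEN conjunct1, rule_format])

lemma metric_pos: "v \<in> tangent_space A x \<Longrightarrow> v \<noteq> (\<lambda>_. 0) \<Longrightarrow> g x v v > 0"
  by (rule metric[unfolded riemannian_metric_def, THEN conjunct2, THEN conjunct2, THEN conjunct1, rule_format])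

lemma metric_smooth:
  "open U \<Longrightarrow> vector_field A U X \<Longrightarrow> vector_field A U Y \<Longrightarrow> smooth_fun A U (\<lambda>x. g x (X x) (Y x))"
  by (rule metric[unfolded riemannian_metric_def, THEN conjunct2, THEN conjunct2, THEN conjunct2, rule_format]) blast

lemma linear_metric_const_field:
  assumes "c \<in> A" "x \<in> cdom c" "w \<in> tangent_space A x"
  shows "linear (\<lambda>a. g x (const_field c a x) w)"
proof -
  note T = const_field_tangent[OF assms(1,2)]
  have l: "g x (const_field c (s *\<^sub>R a + t *\<^sub>R b) x) w = s * g x (const_field c a x) w + t * g x (const_field c b x) w" for s t a b
    unfolding const_field_linear[OF assms(1,2)] by (intro metric_linear T assms(3))
  show ?thesis
  proof (rule linearI)
    show "g x (const_field c (a + b) x) w = g x (const_field c a x) w + g x (const_field c b x) w" for a b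
      using l[of 1 a 1 b] by simp
    show "g x (const_field c (s *\<^sub>R a) x) w = s *\<^sub>R g x (const_field c a x) w" for s a
      using l[of s a 0 a] by simp
  qed
qed

lemma smooth_fun_rep: "smooth_fun A UNIV f \<Longrightarrow> c \<in> A \<Longrightarrow> smooth_on (cmap c ` cdom c) (\<lambda>y. f (cinv c y))"
  unfolding smooth_fun_def by (metis inf_top_right)

lemma gradient_unique:
  assumes "w \<in> tangent_space A x" "w' \<in> tangent_space A x"
    and "\<And>v. v \<in> tangent_space A x \<Longrightarrow> g x w v = g x w' v"
  shows "w = w'"
proof -
  let ?d = "\<lambda>c. 1 *\<^sub>R w c + (-1) *\<^sub>R w' c"
  obtain c where c: "c \<in> A" "x \<in> cdom c" using chart_exists by blast
  have d: "?d \<in> tangent_space A x"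
    using const_field_linear[OF c, of 1 "w c" "-1" "w' c"] const_field_tangent[OF c]
      tangent_eq_const_field[OF assms(1) c] tangent_eq_const_field[OF assms(2) c] by metis
  have "g x ?d ?d = 1 * g x w ?d + (-1) * g x w' ?d"
    by (rule metric_linear[OF assms(1,2) d])
  then have "g x ?d ?d = 0" using assms(3)[OF d] by simp
  then have "?d = (\<lambda>_. 0)" using metric_pos[OF d] by linarith
  then show ?thesis by (simp add: fun_eq_iff)
qed

text \<open>
  In a chart the gradient is the solution of a linear system whose matrix is the metric and whose
  right-hand side is the differential of f; this gives existence and smoothness at the same time.
\<close>

lemma gradient_chart:
  assumes f: "smooth_fun A UNIV f" and c: "c \<in> A"
  shows "\<exists>X. smooth_on (cmap c ` cdom c) X \<and>
    (\<forall>x\<in>cdom c. gradient A g f x = const_field c (X (cmap c x)) x \<and>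
      (\<forall>v\<in>tangent_space A x. g x (gradient A g f x) v = dfun A f x v))"
proof -
  let ?S = "cmap c ` cdom c"
  have S: "open ?S" by (rule open_cimage[OF c])
  define N where "N y a b = g (cinv c y) (const_field c a (cinv c y)) (const_field c b (cinv c y))" for y a b
  define r where "r y b = dder (\<lambda>y. f (cinv c y)) y b" for y b
  have T: "const_field c b (cinv c y) \<in> tangent_space A (cinv c y)" if "y \<in> ?S" for y b
    by (rule const_field_tangent[OF c cinv_in_cdom[OF c that]])
  have l1: "linear (\<lambda>b. N y b b')" if "y \<in> ?S" for y b'
    unfolding N_def by (rule linear_metric_const_field[OF c cinv_in_cdom[OF c that] T[OF that]])
  have sy: "N y b b' = N y b' b" if "y \<in> ?S" for y b b'
    unfolding N_def by (rule metric_sym[OF T[OF that] T[OF that]])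
  have l2: "linear (N y b)" if "y \<in> ?S" for y b
    using l1[OF that, of b] unfolding sy[OF that, of _ b] .
  have pos: "N y b b > 0" if "y \<in> ?S" "b \<noteq> 0" for y b
    unfolding N_def
  proof (rule metric_pos[OF T[OF that(1)]])
    show "const_field c b (cinv c y) \<noteq> (\<lambda>_. 0)"
      using const_field_self[OF c cinv_in_cdom[OF c that(1)], of b] that(2) by metis
  qed
  have sm: "smooth_on ?S (\<lambda>y. N y b b')" for b b'
  proof -
    have "smooth_fun A (cdom c) (\<lambda>x. g x (const_field c b x) (const_field c b' x))"
      by (intro metric_smooth open_cdom[OF c] vector_field_const_field[OF c open_cdom[OF c]] order_refl)
    then show ?thesis unfolding smooth_fun_def N_def using c by fastforce
  qed
  have fs: "smooth_on ?S (\<lambda>y. f (cinv c y))" by (rule smooth_fun_rep[OF f c])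
  have rs: "smooth_on ?S (\<lambda>y. r y b)" for b unfolding r_def by (rule smooth_on_dder[OF fs])
  have rl: "linear (r y)" if "y \<in> ?S" for y
    using linear_dder[OF smooth_on_differentiable[OF fs that]] unfolding r_def .
  have "\<exists>X. smooth_on ?S X \<and> (\<forall>y\<in>?S. \<forall>b. N y (X y) b = r y b)"
    by (rule smooth_linear_solve[OF S l1 l2 pos sm rs rl])
  then obtain X where X: "smooth_on ?S X" "\<And>y b. y \<in> ?S \<Longrightarrow> N y (X y) b = r y b" by blast
  define w where "w x = const_field c (X (cmap c x)) x" for x
  have wT: "w x \<in> tangent_space A x" if "x \<in> cdom c" for x
    unfolding w_def by (rule const_field_tangent[OF c that])
  have wI: "g x (w x) v = dfun A f x v" if "x \<in> cdom c" "v \<in> tangent_space A x" for x v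
  proof -
    have y: "cmap c x \<in> ?S" using that by blast
    have "g x (w x) (const_field c (v c) x) = dder (\<lambda>y. f (cinv c y)) (cmap c x) (v c)"
      using X(2)[OF y, of "v c"] cinv_cmap[OF c that(1)] unfolding N_def r_def w_def by simp
    also have "\<dots> = dfun A f x v"
      by (rule dfun_chart[OF c that smooth_on_differentiable[OF fs y], symmetric])
    finally show ?thesis using tangent_eq_const_field[OF that(2) c that(1)] by simp
  qed
  have gr: "gradient A g f x = w x" if "x \<in> cdom c" for x
    unfolding gradient_def
  proof (rule the_equality)
    show "w x \<in> tangent_space A x \<and> (\<forall>v\<in>tangent_space A x. g x (w x) v = dfun A f x v)"
      using wT[OF that] wI[OF that] by blast
    show "w' = w x" if "w' \<in> tangent_space A x \<and> (\<forall>v\<in>tangent_space A x. g x w' v = dfun A f x v)" for w'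
      by (rule gradient_unique) (use that wT[OF \<open>x \<in> cdom c\<close>] wI[OF \<open>x \<in> cdom c\<close>] in auto)
  qed
  have "g x (gradient A g f x) v = dfun A f x v" if "x \<in> cdom c" "v \<in> tangent_space A x" for x v
    unfolding gr[OF that(1)] by (rule wI[OF that])
  with X(1) show ?thesis using gr unfolding w_def by blast
qed

lemma gradient_tangent:
  assumes f: "smooth_fun A UNIV f"
  shows "gradient A g f x \<in> tangent_space A x"
proof -
  obtain c where c: "c \<in> A" "x \<in> cdom c" using chart_exists by blast
  obtain X where X: "smooth_on (cmap c ` cdom c) X"
    "\<And>x. x \<in> cdom c \<Longrightarrow> gradient A g f x = const_field c (X (cmap c x)) x"
    "\<And>x v. x \<in> cdom c \<Longrightarrow> v \<in> tangent_space A x \<Longrightarrow> g x (gradient A g f x) v = dfun A f x v"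
    using gradient_chart[OF f c(1)] by blast
  show ?thesis unfolding X(2)[OF c(2)] by (rule const_field_tangent[OF c])
qed

lemma gradient_inner:
  assumes f: "smooth_fun A UNIV f" and v: "v \<in> tangent_space A x"
  shows "g x (gradient A g f x) v = dfun A f x v"
proof -
  obtain c where c: "c \<in> A" "x \<in> cdom c" using chart_exists by blast
  obtain X where X: "smooth_on (cmap c ` cdom c) X"
    "\<And>x. x \<in> cdom c \<Longrightarrow> gradient A g f x = const_field c (X (cmap c x)) x"
    "\<And>x v. x \<in> cdom c \<Longrightarrow> v \<in> tangent_space A x \<Longrightarrow> g x (gradient A g f x) v = dfun A f x v"
    using gradient_chart[OF f c(1)] by blast
  show ?thesis by (rule X(3)[OF c(2) v])
qed

lemma gradient_smooth:
  assumes f: "smooth_fun A UNIV f" and c: "c \<in> A"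
  shows "smooth_on (cmap c ` cdom c) (\<lambda>y. gradient A g f (cinv c y) c)"
proof -
  obtain X where X: "smooth_on (cmap c ` cdom c) X"
    "\<And>x. x \<in> cdom c \<Longrightarrow> gradient A g f x = const_field c (X (cmap c x)) x"
    "\<And>x v. x \<in> cdom c \<Longrightarrow> v \<in> tangent_space A x \<Longrightarrow> g x (gradient A g f x) v = dfun A f x v"
    using gradient_chart[OF f c] by blast
  show ?thesis
  proof (rule smooth_on_cong[OF open_cimage[OF c] _ X(1)])
    fix y assume y: "y \<in> cmap c ` cdom c"
    show "X y = gradient A g f (cinv c y) c"
      unfolding X(2)[OF cinv_in_cdom[OF c y]] cmap_cinv[OF c y]
      by (rule const_field_self[OF c cinv_in_cdom[OF c y], symmetric])
  qed
qed

lemma gradient_eq_0_iff: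
  assumes "smooth_fun A UNIV f"
  shows "gradient A g f x = (\<lambda>_. 0) \<longleftrightarrow> critical_point A f x"
proof
  obtain c where c: "c \<in> A" "x \<in> cdom c" using chart_exists by blast
  assume z: "gradient A g f x = (\<lambda>_. 0)"
  show "critical_point A f x" unfolding critical_point_def
  proof
    fix v assume v: "v \<in> tangent_space A x"
    have "dfun A f x v = g x (gradient A g f x) v" using gradient_inner[OF assms v] by simp
    also have "gradient A g f x = (\<lambda>c. 0 *\<^sub>R v c + 0 *\<^sub>R v c)" unfolding z by simp
    also have "g x \<dots> v = 0" using metric_linear[OF v v v, of 0 0] by simp
    finally show "dfun A f x v = 0" .
  qed
next
  assume "critical_point A f x"
  then have "g x (gradient A g f x) (gradient A g f x) = 0"
    using gradient_inner[OF assms gradient_tangent[OF assms]] gradient_tangent[OF assms]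
    unfolding critical_point_def by simp
  then show "gradient A g f x = (\<lambda>_. 0)" using metric_pos[OF gradient_tangent[OF assms, of x]] by linarith
qed

end

section \<open>Integral curves and the flow in charts\<close>

lemma has_vector_derivative_chain:
  assumes "(p has_vector_derivative p') (at s within S)" "f differentiable (at (p s))"
  shows "((\<lambda>r. f (p r)) has_vector_derivative dder f (p s) p') (at s within S)"
  using has_derivative_compose[OF assms(1)[unfolded has_vector_derivative_def] has_derivative_dder[OF assms(2)]]
  unfolding has_vector_derivative_def linear_cmul[OF linear_dder[OF assms(2)]] .

locale smooth_field = smooth_manifold A
  for A :: "('m::{t2_space,second_countable_topology}, 'e::{real_normed_vector,heine_borel}) chart set" +
  fixes X :: "'m \<Rightarrow> ('m, 'e) tvec"
  assumes field_tangent: "\<And>x. X x \<in> tangent_space A x"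
    and field_smooth: "\<And>c. c \<in> A \<Longrightarrow> smooth_on (cmap c ` cdom c) (\<lambda>y. X (cinv c y) c)"
begin

abbreviation frep :: "('m,'e) chart \<Rightarrow> 'e \<Rightarrow> 'e" where
  "frep c y \<equiv> X (cinv c y) c"

lemma integral_curve_chart:
  assumes c: "c \<in> A" and p: "\<And>t. t \<in> S \<Longrightarrow> p t \<in> cmap c ` cdom c"
    "\<And>t. t \<in> S \<Longrightarrow> (p has_vector_derivative frep c (p t)) (at t within S)"
  shows "integral_curve A X S (\<lambda>t. cinv c (p t))"
  unfolding integral_curve_def
proof (intro conjI ballI impI)
  show "continuous_on S (\<lambda>t. cinv c (p t))"
    by (rule continuous_on_compose2[OF continuous_cinv[OF c] has_vector_derivative_imp_continuous_on[OF p(2)]])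
       (use p(1) in auto)
  fix s d assume s: "s \<in> S" and d: "d \<in> A" and sd: "cinv c (p s) \<in> cdom d"
  have x: "cinv c (p s) \<in> cdom c" "cmap c (cinv c (p s)) = p s"
    using cinv_in_cdom[OF c p(1)[OF s]] cmap_cinv[OF c p(1)[OF s]] by auto
  have "(\<lambda>y. cmap d (cinv c y)) differentiable (at (p s))"
    using transition_differentiable[OF c d x(1) sd] unfolding x(2) .
  from has_vector_derivative_chain[OF p(2)[OF s] this]
  show "((\<lambda>r. cmap d (cinv c (p r))) has_vector_derivative X (cinv c (p s)) d) (at s within S)"
    using tangent_spaceD(2)[OF field_tangent c d x(1) sd] unfolding x(2) by simp
qed

text \<open>
  The coincidence set of the two curves is closed because the manifold is Hausdorff, and it is open
  because near a common point both curves lie in the domain of the chart, where the small-time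
  uniqueness applies.  Only one of the curves is assumed to stay in the chart.
\<close>

lemma integral_curve_unique:
  assumes c: "c \<in> A" and T: "convex T" "compact T" "t0 \<in> T"
    and V: "ball \<xi> r \<subseteq> cmap c ` cdom c" and L: "L-lipschitz_on (ball \<xi> r) (frep c)"
    and p: "\<And>t. t \<in> T \<Longrightarrow> p t \<in> ball \<xi> r"
    "\<And>t. t \<in> T \<Longrightarrow> (p has_vector_derivative frep c (p t)) (at t within T)"
    and \<gamma>: "integral_curve A X T \<gamma>" "\<gamma> t0 = cinv c (p t0)" and t: "t \<in> T"
  shows "\<gamma> t = cinv c (p t)"
proof -
  have L0: "L \<ge> 0" using L lipschitz_on_nonneg by blast
  have \<gamma>c: "continuous_on T \<gamma>" using \<gamma>(1) unfolding integral_curve_def by blast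
  have \<gamma>': "((\<lambda>r. cmap c (\<gamma> r)) has_vector_derivative X (\<gamma> s) c) (at s within T)" if "s \<in> T" "\<gamma> s \<in> cdom c" for s
    using \<gamma>(1) that c unfolding integral_curve_def by blast
  have pV: "p t \<in> cmap c ` cdom c" if "t \<in> T" for t using p(1)[OF that] V by blast
  have pc: "continuous_on T (\<lambda>t. cinv c (p t))"
    using integral_curve_chart[OF c pV p(2)] unfolding integral_curve_def by blast
  define E where "E = {s \<in> T. \<gamma> s = cinv c (p s)}"
  have "closedin (top_of_set T) (T \<inter> (\<lambda>s. (\<gamma> s, cinv c (p s))) -` {y. \<exists>x. y = (x, x)})"
    by (rule continuous_closedin_preimage[OF continuous_on_Pair[OF \<gamma>c pc] closed_diagonal])
  also have "T \<inter> (\<lambda>s. (\<gamma> s, cinv c (p s))) -` {y. \<exists>x. y = (x, x)} = E"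
    unfolding E_def by auto
  finally have cl: "closedin (top_of_set T) E" .
  have "\<exists>e>0. \<forall>s\<in>T. dist s s0 < e \<longrightarrow> s \<in> E" if s0: "s0 \<in> E" for s0
  proof -
    have s0T: "s0 \<in> T" and s0e: "\<gamma> s0 = cinv c (p s0)" using s0 unfolding E_def by auto
    define W where "W = cdom c \<inter> cmap c -` ball \<xi> r"
    have "open W" unfolding W_def
      by (rule continuous_open_preimage[OF continuous_cmap[OF c] open_cdom[OF c]]) simp
    moreover have "\<gamma> s0 \<in> W"
      unfolding W_def s0e using cinv_in_cdom[OF c pV[OF s0T]] cmap_cinv[OF c pV[OF s0T]] p(1)[OF s0T] by simp
    ultimately have "openin (top_of_set T) (T \<inter> \<gamma> -` W)" "s0 \<in> T \<inter> \<gamma> -` W"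
      using continuous_openin_preimage_gen[OF \<gamma>c] s0T by auto
    then obtain e where e: "e > 0" "\<And>s. s \<in> T \<Longrightarrow> dist s s0 < e \<Longrightarrow> \<gamma> s \<in> W"
      unfolding openin_euclidean_subtopology_iff by blast
    define d where "d = min (e/2) (1 / (2 * (L + 1)))"
    have d: "d > 0" unfolding d_def using e L0 by simp
    have Ld: "L * d \<le> 1/2"
    proof -
      have "L * d \<le> L * (1 / (2 * (L + 1)))" unfolding d_def using L0 by (intro mult_left_mono) auto
      also have "\<dots> \<le> 1/2" using L0 by (simp add: field_simps)
      finally show ?thesis .
    qed
    let ?T = "T \<inter> cball s0 d"
    have inW: "\<gamma> s \<in> cdom c" "cmap c (\<gamma> s) \<in> ball \<xi> r" if "s \<in> ?T" for s
      using e(2)[of s] that d e(1) unfolding W_def d_def by (auto simp: dist_commute)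
    have "cmap c (\<gamma> s) = p s" if s: "s \<in> ?T" for s
    proof (rule ode_unique_small[where T="?T" and ?t0.0=s0 and \<delta>=d and L=L and F="\<lambda>_. frep c"
        and p="\<lambda>s. cmap c (\<gamma> s)" and q=p and t=s])
      show "convex ?T" "compact ?T" using T by (auto intro: convex_Int compact_Int)
      fix t assume t: "t \<in> ?T"
      then have tT: "t \<in> T" by blast
      show "\<bar>t - s0\<bar> \<le> d" using t by (auto simp: dist_real_def)
      have "((\<lambda>r. cmap c (\<gamma> r)) has_vector_derivative X (\<gamma> t) c) (at t within ?T)"
        by (rule has_vector_derivative_within_subset[OF \<gamma>'[OF tT inW(1)[OF t]]]) blast
      then show "((\<lambda>s. cmap c (\<gamma> s)) has_vector_derivative frep c (cmap c (\<gamma> t))) (at t within ?T)"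
        unfolding cinv_cmap[OF c inW(1)[OF t]] .
      show "(p has_vector_derivative frep c (p t)) (at t within ?T)"
        by (rule has_vector_derivative_within_subset[OF p(2)[OF tT]]) blast
      show "norm (frep c (cmap c (\<gamma> t)) - frep c (p t)) \<le> L * norm (cmap c (\<gamma> t) - p t)"
        using lipschitz_onD[OF L inW(2)[OF t] p(1)[OF tT]] by (simp add: dist_norm)
    next
      show "cmap c (\<gamma> s0) = p s0" unfolding s0e by (rule cmap_cinv[OF c pV[OF s0T]])
    qed (use s0T d Ld L0 s in auto)
    then have "\<gamma> s = cinv c (p s)" if "s \<in> ?T" for s
      using cinv_cmap[OF c inW(1)[OF that]] that by simp
    then have "\<forall>s\<in>T. dist s s0 < d \<longrightarrow> s \<in> E" unfolding E_def by (auto simp: dist_commute)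
    then show ?thesis using d by blast
  qed
  then have op: "openin (top_of_set T) E"
    unfolding openin_euclidean_subtopology_iff using E_def by (auto simp: dist_commute)
  have "E = {} \<or> E = T"
    using convex_connected[OF T(1)] op cl unfolding connected_clopen by blast
  moreover have "t0 \<in> E" using T(3) \<gamma>(2) unfolding E_def by blast
  ultimately show ?thesis using t unfolding E_def by blast
qed

lemma flow_chart:
  assumes c: "c \<in> A" and V: "ball \<xi> r \<subseteq> cmap c ` cdom c" and L: "L-lipschitz_on (ball \<xi> r) (frep c)"
    and p: "\<And>t. t \<in> {-\<delta>..\<delta>} \<Longrightarrow> p t \<in> ball \<xi> r"
    "\<And>t. t \<in> {-\<delta>..\<delta>} \<Longrightarrow> (p has_vector_derivative frep c (p t)) (at t within {-\<delta>..\<delta>})"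
    and t: "t \<in> {-\<delta>..\<delta>}"
  shows "flow A X t (cinv c (p 0)) = cinv c (p t)"
proof -
  let ?S = "closed_segment 0 t"
  have S: "?S \<subseteq> {-\<delta>..\<delta>}" using t by (auto simp: closed_segment_eq_real_ivl split: if_splits)
  have p2: "(p has_vector_derivative frep c (p s)) (at s within ?S)" if "s \<in> ?S" for s
    by (rule has_vector_derivative_within_subset[OF p(2) S]) (use that S in blast)
  have p1: "p s \<in> ball \<xi> r" if "s \<in> ?S" for s using p(1) that S by blast
  have pV: "p s \<in> cmap c ` cdom c" if "s \<in> ?S" for s using p1[OF that] V by blast
  show ?thesis unfolding flow_def
  proof (rule the_equality)
    show "\<exists>\<gamma>. integral_curve A X ?S \<gamma> \<and> \<gamma> 0 = cinv c (p 0) \<and> \<gamma> t = cinv c (p t)"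
      using integral_curve_chart[OF c pV p2] by (intro exI[of _ "\<lambda>s. cinv c (p s)"]) simp
    fix y assume "\<exists>\<gamma>. integral_curve A X ?S \<gamma> \<and> \<gamma> 0 = cinv c (p 0) \<and> \<gamma> t = y"
    then obtain \<gamma> where \<gamma>: "integral_curve A X ?S \<gamma>" "\<gamma> 0 = cinv c (p 0)" "\<gamma> t = y" by blast
    have "\<gamma> t = cinv c (p t)"
      by (rule integral_curve_unique[OF c _ _ _ V L p1 p2 \<gamma>(1,2)]) auto
    then show "y = cinv c (p t)" using \<gamma>(3) by simp
  qed
qed

end


section \<open>Christoffel symbols\<close>

text \<open>
  The properties of the Levi-Civita connection on which the symmetry of its Christoffel symbols rests.
\<close>

locale torsion_free_connection = smooth_manifold A
  for A :: "('m::{t2_space,second_countable_topology}, 'e::{real_normed_vector,heine_borel}) chart set" +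
  fixes D :: "('m, 'e, ('m, 'e) chart, 'e) conn"
  assumes conn: "connection A (tangent_bundle A) D"
    and torsion_free: "\<And>U X Y x. open U \<Longrightarrow> vector_field A U X \<Longrightarrow> vector_field A U Y \<Longrightarrow> x \<in> U \<Longrightarrow>
      (\<lambda>c. D x (X x) Y c - D x (Y x) X c) = lie_bracket A X Y x"
begin

lemma
  assumes U: "open U" "vector_field A U s" and x: "x \<in> U" and v: "v \<in> tangent_space A x"
  shows conn_fibre: "D x v s \<in> tangent_space A x"
    and conn_local: "(\<And>y. y \<in> U \<Longrightarrow> s' y = s y) \<Longrightarrow> D x v s' = D x v s"
    and conn_direction: "w \<in> tangent_space A x \<Longrightarrow>
      D x (\<lambda>c. a *\<^sub>R v c + b *\<^sub>R w c) s = (\<lambda>i. a *\<^sub>R D x v s i + b *\<^sub>R D x w s i)"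
    and conn_add: "vector_field A U s' \<Longrightarrow> D x v (\<lambda>y i. s y i + s' y i) = (\<lambda>i. D x v s i + D x v s' i)"
    and conn_Leibniz: "smooth_fun A U h \<Longrightarrow>
      D x v (\<lambda>y i. h y *\<^sub>R s y i) = (\<lambda>i. dfun A h x v *\<^sub>R s x i + h x *\<^sub>R D x v s i)"
proof -
  note K = conn[unfolded connection_def, THEN spec, THEN spec, THEN mp, OF conjI[OF U], THEN conjunct1,
      THEN bspec, OF x, THEN bspec, OF v]
  show "D x v s \<in> tangent_space A x" by (rule K[THEN conjunct1])
  show "(\<And>y. y \<in> U \<Longrightarrow> s' y = s y) \<Longrightarrow> D x v s' = D x v s"
    by (rule K[THEN conjunct2, THEN conjunct1, THEN spec, THEN mp]) blast
  show "w \<in> tangent_space A x \<Longrightarrow>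
      D x (\<lambda>c. a *\<^sub>R v c + b *\<^sub>R w c) s = (\<lambda>i. a *\<^sub>R D x v s i + b *\<^sub>R D x w s i)"
    by (rule K[THEN conjunct2, THEN conjunct2, THEN conjunct1, THEN spec, THEN spec, THEN bspec])
  show "vector_field A U s' \<Longrightarrow> D x v (\<lambda>y i. s y i + s' y i) = (\<lambda>i. D x v s i + D x v s' i)"
    by (rule K[THEN conjunct2, THEN conjunct2, THEN conjunct2, THEN conjunct1, THEN spec, THEN mp])
  show "smooth_fun A U h \<Longrightarrow>
      D x v (\<lambda>y i. h y *\<^sub>R s y i) = (\<lambda>i. dfun A h x v *\<^sub>R s x i + h x *\<^sub>R D x v s i)"
    by (rule K[THEN conjunct2, THEN conjunct2, THEN conjunct2, THEN conjunct2, THEN spec, THEN mp])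
qed

lemma conn_smooth:
  assumes U: "open U" "vector_field A U s" and X: "vector_field A U X"
  shows "vector_field A U (\<lambda>x. D x (X x) s)"
  by (rule conn[unfolded connection_def, THEN spec, THEN spec, THEN mp, OF conjI[OF U], THEN conjunct2,
      THEN spec, THEN mp, OF X])

definition christoffel :: "('m,'e) chart \<Rightarrow> 'm \<Rightarrow> 'e \<Rightarrow> 'e \<Rightarrow> 'e" where
  "christoffel i x a b = D x (const_field i a x) (const_field i b) i"

lemma conn_const_field:
  assumes "i \<in> A" "x \<in> cdom i" "v \<in> tangent_space A x"
  shows "D x v (const_field i b) i = christoffel i x (v i) b"
  unfolding christoffel_def using tangent_eq_const_field[OF assms(3,1,2)] by simp

context
  fixes i :: "('m,'e) chart" and x :: 'm
  assumes i: "i \<in> A" and x: "x \<in> cdom i"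
begin

lemma const_fieldV: "vector_field A (cdom i) (const_field i b)"
  by (rule vector_field_const_field[OF i open_cdom[OF i] order_refl])

lemma linear_christoffel_left: "linear (\<lambda>a. christoffel i x a b)"
proof -
  note T = const_field_tangent[OF i x]
  have l: "christoffel i x (s *\<^sub>R a + t *\<^sub>R a') b = s *\<^sub>R christoffel i x a b + t *\<^sub>R christoffel i x a' b" for s t a a'
    unfolding christoffel_def const_field_linear[OF i x]
    using conn_direction[OF open_cdom[OF i] const_fieldV x T T] by simp
  show ?thesis
  proof (rule linearI)
    show "christoffel i x (a + a') b = christoffel i x a b + christoffel i x a' b" for a a'
      using l[of 1 a 1 a'] by simp
    show "christoffel i x (s *\<^sub>R a) b = s *\<^sub>R christoffel i x a b" for s a
      using l[of s a 0 a] by simp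
  qed
qed

text \<open>
  Coordinate fields have vanishing Lie bracket, so this is the vanishing of the torsion.
\<close>

lemma christoffel_sym: "christoffel i x a b = christoffel i x b a"
proof -
  have "(\<lambda>c. D x (const_field i a x) (const_field i b) c - D x (const_field i b x) (const_field i a) c)
    = lie_bracket A (const_field i a) (const_field i b) x"
    by (rule torsion_free[OF open_cdom[OF i] const_fieldV const_fieldV x])
  then have "christoffel i x a b - christoffel i x b a = lie_bracket A (const_field i a) (const_field i b) x i"
    unfolding christoffel_def by (rule fun_cong)
  also have "\<dots> = 0"
  proof -
    have "dder (\<lambda>y. const_field i b (cinv i y) i) (cmap i x) = dder (\<lambda>y. b) (cmap i x)" for b
      by (rule dder_cong[OF open_cimage[OF i]]) (use x const_field_self[OF i cinv_in_cdom[OF i]] in auto)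
    then show ?thesis unfolding lie_bracket_def by simp
  qed
  finally show ?thesis by simp
qed

lemma linear_christoffel: "linear (christoffel i x a)"
proof -
  have "christoffel i x a = (\<lambda>b. christoffel i x b a)"
    by (rule ext) (rule christoffel_sym)
  then show ?thesis using linear_christoffel_left by simp
qed

end

lemma smooth_christoffel:
  assumes i: "i \<in> A"
  shows "smooth_on (cmap i ` cdom i) (\<lambda>q. christoffel i (cinv i q) a b)"
proof -
  note V = vector_field_const_field[OF i open_cdom[OF i] order_refl]
  have "smooth_on (cmap i ` (cdom i \<inter> cdom i)) (\<lambda>q. D (cinv i q) (const_field i a (cinv i q)) (const_field i b) i)"
    by (rule vector_field_chart[OF conn_smooth[OF open_cdom[OF i] V V] i])
  then show ?thesis unfolding christoffel_def by simp
qed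

text \<open>
  The Leibniz rule, summed over the basis.  It expresses the covariant derivative of a field by the
  derivatives of its coefficients and the Christoffel symbols.
\<close>

lemma conn_sum_const_field:
  assumes i: "i \<in> A" and U: "open U" "U \<subseteq> cdom i" and x: "x \<in> U" and v: "v \<in> tangent_space A x"
    and h: "\<And>k. smooth_on (cmap i ` U) (\<lambda>y. h k (cinv i y))" and F: "finite F"
  shows "D x v (\<lambda>z. const_field i (\<Sum>k\<in>F. h k z *\<^sub>R k) z) i =
    (\<Sum>k\<in>F. dder (\<lambda>y. h k (cinv i y)) (cmap i x) (v i) *\<^sub>R k) + christoffel i x (v i) (\<Sum>k\<in>F. h k x *\<^sub>R k)"
  using F
proof (induction F rule: finite_induct)
  case empty
  have xi: "x \<in> cdom i" using x U by blast
  have "D x v (const_field i 0) i = christoffel i x (v i) 0" by (rule conn_const_field[OF i xi v])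
  then show ?case by simp
next
  case (insert k F)
  have xi: "x \<in> cdom i" using x U by blast
  have oU: "open (cmap i ` U)" using open_cimage_Int[OF i U(1)] U(2) by (simp add: Int_absorb1)
  let ?s = "\<lambda>z. const_field i (\<Sum>k\<in>F. h k z *\<^sub>R k) z"
  let ?t = "\<lambda>z j. h k z *\<^sub>R const_field i k z j"
  have ti: "?t z = const_field i (h k z *\<^sub>R k) z" if "z \<in> U" for z
    using const_field_linear[OF i, of z "h k z" k 0 k] that U by auto
  have Vs: "vector_field A U ?s"
    by (intro vector_field_of_component i U smooth_on_sum oU smooth_on_scaleR smooth_on_const h)
  have Vk: "vector_field A U (const_field i k)" by (rule vector_field_const_field[OF i U])
  have Vh: "vector_field A U (\<lambda>z. const_field i (h k z *\<^sub>R k) z)"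
    by (intro vector_field_of_component i U smooth_on_scaleR oU smooth_on_const h)
  have hs: "smooth_fun A U (h k)" by (rule smooth_fun_chartI[OF i U h])
  have "D x v (\<lambda>z. const_field i (\<Sum>k\<in>insert k F. h k z *\<^sub>R k) z) = D x v (\<lambda>z j. const_field i (h k z *\<^sub>R k) z j + ?s z j)"
  proof (rule conn_local[OF U(1) _ x v, symmetric])
    show "vector_field A U (\<lambda>z. const_field i (\<Sum>k\<in>insert k F. h k z *\<^sub>R k) z)"
      by (intro vector_field_of_component i U smooth_on_sum oU smooth_on_scaleR smooth_on_const h)
    fix z assume "z \<in> U"
    then have z: "z \<in> cdom i" using U by blast
    show "(\<lambda>j. const_field i (h k z *\<^sub>R k) z j + ?s z j) = const_field i (\<Sum>k\<in>insert k F. h k z *\<^sub>R k) z"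
      using const_field_linear[OF i z, of 1 "h k z *\<^sub>R k" 1 "\<Sum>k\<in>F. h k z *\<^sub>R k"] insert.hyps by simp
  qed
  also have "\<dots> = (\<lambda>j. D x v (\<lambda>z. const_field i (h k z *\<^sub>R k) z) j + D x v ?s j)"
    by (rule conn_add[OF U(1) Vh x v Vs])
  also have "D x v (\<lambda>z. const_field i (h k z *\<^sub>R k) z) = D x v ?t"
    by (rule conn_local[OF U(1) Vh x v ti, symmetric])
  also have "\<dots> = (\<lambda>j. dfun A (h k) x v *\<^sub>R const_field i k x j + h k x *\<^sub>R D x v (const_field i k) j)"
    by (rule conn_Leibniz[OF U(1) Vk x v hs])
  finally have "D x v (\<lambda>z. const_field i (\<Sum>k\<in>insert k F. h k z *\<^sub>R k) z) i =
    (dfun A (h k) x v *\<^sub>R const_field i k x i + h k x *\<^sub>R D x v (const_field i k) i) + D x v ?s i"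
    by simp
  also have "dfun A (h k) x v = dder (\<lambda>y. h k (cinv i y)) (cmap i x) (v i)"
    by (rule dfun_chart[OF i xi v smooth_on_differentiable[OF h]]) (use x in blast)
  also have "const_field i k x i = k" by (rule const_field_self[OF i xi])
  also have "D x v (const_field i k) i = christoffel i x (v i) k" by (rule conn_const_field[OF i xi v])
  also note insert.IH
  finally show ?case
    using insert.hyps linear_christoffel[OF i xi, of "v i"]
    by (simp add: linear_add linear_cmul algebra_simps)
qed

lemma conn_chart:
  assumes i: "i \<in> A" and U: "open U" "U \<subseteq> cdom i" and s: "vector_field A U s"
    and x: "x \<in> U" and v: "v \<in> tangent_space A x"
  shows "D x v s i = dder (\<lambda>y. s (cinv i y) i) (cmap i x) (v i) + christoffel i x (v i) (s x i)"
proof -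
  have xi: "x \<in> cdom i" using x U by blast
  have cx: "cmap i x \<in> cmap i ` U" using x by blast
  have oU: "open (cmap i ` U)" using open_cimage_Int[OF i U(1)] U(2) by (simp add: Int_absorb1)
  define h where "h k z = coord k (s z i)" for k z
  have si: "smooth_on (cmap i ` U) (\<lambda>y. s (cinv i y) i)"
    using vector_field_chart[OF s i] U(2) by (simp add: Int_absorb1)
  have hs: "smooth_on (cmap i ` U) (\<lambda>y. h k (cinv i y))" for k
    unfolding h_def by (rule smooth_on_bounded_linear_comp[OF bounded_linear_coord oU si])
  have dh: "dder (\<lambda>y. h k (cinv i y)) (cmap i x) = (\<lambda>v. coord k (dder (\<lambda>y. s (cinv i y) i) (cmap i x) v))" for k
    unfolding h_def
    by (rule dderI[OF bounded_linear.has_derivative[OF bounded_linear_coord has_derivative_dder[OF smooth_on_differentiable[OF si cx]]]])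
  have "D x v s = D x v (\<lambda>z. const_field i (\<Sum>k\<in>fbasis. h k z *\<^sub>R k) z)"
  proof (rule conn_local[OF U(1) s x v, symmetric])
    fix z assume z: "z \<in> U"
    show "const_field i (\<Sum>k\<in>fbasis. h k z *\<^sub>R k) z = s z"
      unfolding h_def sum_coord
      by (rule tangent_eq_const_field[OF vector_field_tangent[OF s z] i, symmetric]) (use z U in blast)
  qed
  then show ?thesis
    using conn_sum_const_field[OF i U x v hs fbasis(1)]
    unfolding dh by (simp add: sum_coord) (simp add: h_def sum_coord)
qed

text \<open>
  The familiar transformation law of Christoffel symbols, with the second derivative of the coordinate
  change as inhomogeneous term.  Both sides are the components, in chart i, of the covariant
  derivative of a coordinate field of chart d.
\<close>

lemma christoffel_change_chart:
  assumes d: "d \<in> A" "x \<in> cdom d" and i: "i \<in> A" "x \<in> cdom i"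
  shows "trans d i x (christoffel d x a b) =
    dder (\<lambda>q. dder (\<lambda>y. cmap i (cinv d y)) q b) (cmap d x) a + christoffel i x (trans d i x a) (trans d i x b)"
proof -
  let ?U = "cdom d \<inter> cdom i"
  have U: "open ?U" "?U \<subseteq> cdom i" "?U \<subseteq> cdom d" "x \<in> ?U"
    using open_Int[OF open_cdom[OF d(1)] open_cdom[OF i(1)]] d i by auto
  let ?s = "const_field d b" and ?w = "const_field d a x"
  have s: "vector_field A ?U ?s" by (rule vector_field_const_field[OF d(1) U(1,3)])
  have w: "?w \<in> tangent_space A x" by (rule const_field_tangent[OF d])
  have comp: "const_field d b z i = trans d i z b" if "z \<in> ?U" for b z
    using that d(1) i(1) by (simp add: const_field_eq)
  have S: "open (cmap d ` (cdom d \<inter> cdom i))" by (intro open_cimage_Int d open_cdom i)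
  have cS: "cmap d x \<in> cmap d ` (cdom d \<inter> cdom i)" using U by blast
  have sd: "smooth_on (cmap d ` (cdom d \<inter> cdom i)) (\<lambda>y. ?s (cinv d y) i)"
    by (rule smooth_on_subset[OF vector_field_component[OF s i(1), unfolded smooth_fun_def, THEN bspec, OF d(1)]]) auto
  have "dder (\<lambda>y. ?s (cinv i y) i) (cmap i x) (?w i) = dder (\<lambda>y. ?s (cinv d y) i) (cmap d x) (?w d)"
    unfolding dderI[OF has_derivative_change_chart[OF d(1) i(1) d(2) i(2), of "\<lambda>z. ?s z i",
        OF smooth_on_differentiable[OF sd cS]]]
    using tangent_spaceD(2)[OF w i(1) d(1) i(2) d(2)] by simp
  also have "\<dots> = dder (\<lambda>q. dder (\<lambda>y. cmap i (cinv d y)) q b) (cmap d x) a"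
  proof -
    have "dder (\<lambda>y. ?s (cinv d y) i) (cmap d x) = dder (\<lambda>q. dder (\<lambda>y. cmap i (cinv d y)) q b) (cmap d x)"
    proof (rule dder_cong[OF S cS])
      fix y assume y: "y \<in> cmap d ` (cdom d \<inter> cdom i)"
      then have "cinv d y \<in> ?U" "cmap d (cinv d y) = y" using cinv_cmap[OF d(1)] by auto
      then show "?s (cinv d y) i = dder (\<lambda>y. cmap i (cinv d y)) y b" by (simp add: comp)
    qed
    then show ?thesis unfolding const_field_self[OF d] by simp
  qed
  finally have 1: "dder (\<lambda>y. ?s (cinv i y) i) (cmap i x) (?w i) = dder (\<lambda>q. dder (\<lambda>y. cmap i (cinv d y)) q b) (cmap d x) a" .
  have "D x ?w ?s i = dder (\<lambda>y. ?s (cinv i y) i) (cmap i x) (?w i) + christoffel i x (?w i) (?s x i)"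
    by (rule conn_chart[OF i(1) U(1,2) s U(4) w])
  moreover have "D x ?w ?s i = trans d i x (D x ?w ?s d)"
    by (rule tangent_spaceD(2)[OF conn_fibre[OF U(1) s U(4) w] d(1) i(1) d(2) i(2)])
  moreover have "D x ?w ?s d = christoffel d x a b"
    unfolding christoffel_def ..
  ultimately show ?thesis unfolding 1[symmetric] comp[OF U(4)] by simp
qed

end


section \<open>The connection Lie derivative of the differential\<close>

text \<open>
  The value w t is transported along a curve for the time -t by the linear equation with coefficient
  \<open>- \<kappa>\<close>.  To first order this adds \<open>t\<close> times the value of \<open>\<kappa> \<xi>\<close> at w 0, because curve and
  transported vector stay within a distance of order t from \<open>\<xi>\<close> and w 0.
\<close>

lemma transport_back_derivative:
  fixes \<kappa> :: "'a::real_normed_vector \<Rightarrow> 'b::real_normed_vector \<Rightarrow> 'b"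
  assumes lin: "\<And>y. y \<in> B \<Longrightarrow> linear (\<kappa> y)"
    and K: "\<And>y b. y \<in> B \<Longrightarrow> norm (\<kappa> y b) \<le> K * norm b" "K \<ge> 0" "K * \<delta> \<le> 1/2"
    and cont: "\<And>b. continuous_on B (\<lambda>y. \<kappa> y b)" and \<xi>: "\<xi> \<in> B" and \<delta>: "\<delta> > 0"
    and w: "(w has_vector_derivative w') (at 0)"
    and p: "\<And>t s. \<bar>t\<bar> < \<delta> \<Longrightarrow> \<bar>s\<bar> \<le> \<bar>t\<bar> \<Longrightarrow> p t s \<in> B \<and> norm (p t s - \<xi>) \<le> M * \<bar>t\<bar>" "M \<ge> 0"
    and \<beta>: "\<And>t. \<bar>t\<bar> < \<delta> \<Longrightarrow> \<beta> t 0 = w t"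
    "\<And>t s. \<bar>t\<bar> < \<delta> \<Longrightarrow> s \<in> closed_segment 0 (- t) \<Longrightarrow>
      (\<beta> t has_vector_derivative - \<kappa> (p t s) (\<beta> t s)) (at s within closed_segment 0 (- t))"
  shows "((\<lambda>t. \<beta> t (- t)) has_vector_derivative w' + \<kappa> \<xi> (w 0)) (at 0)"
proof -
  have "((\<lambda>t. \<beta> t (- t) - w t) has_derivative (\<lambda>t. t *\<^sub>R \<kappa> \<xi> (w 0))) (at 0)"
    unfolding has_derivative_at_alt
  proof (intro conjI allI impI)
    show "bounded_linear (\<lambda>t. t *\<^sub>R \<kappa> \<xi> (w 0))" by (rule bounded_linear_scaleR_left)
    fix e :: real assume e: "e > 0"
    have "continuous (at 0) w" using has_vector_derivative_continuous[OF w] .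
    then obtain d1 where d1: "d1 > 0" "\<And>t. norm (t - 0) < d1 \<Longrightarrow> norm (w t - w 0) < min 1 (e / (4 * (K + 1)))"
      unfolding continuous_at_eps_delta using e K(2)
      by (metis (no_types, opaque_lifting) add_nonneg_pos dist_norm divide_pos_pos min_less_iff_conj mult_pos_pos zero_less_numeral zero_less_one)
    obtain d2 where d2: "d2 > 0" "\<And>y. y \<in> B \<Longrightarrow> norm (y - \<xi>) < d2 \<Longrightarrow> norm (\<kappa> y (w 0) - \<kappa> \<xi> (w 0)) < e/2"
      using cont[of "w 0"] \<xi> e unfolding continuous_on_iff dist_norm by (meson half_gt_zero)
    define W where "W = norm (w 0) + 1"
    have W: "W > 0" unfolding W_def by (simp add: add_nonneg_pos)
    \<comment> \<open>The last two bounds keep the curve in the d2-ball, and the transported vector close to w t.\<close>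
    define d where "d = Min {\<delta>, d1, d2 / (M + 1), e / (8 * (K + 1) * (K + 1) * W)}"
    have dpos: "d > 0" unfolding d_def using \<delta> d1 d2 e K(2) W p(2) by simp
    have dle: "d \<le> \<delta>" "d \<le> d1" "d \<le> d2 / (M + 1)" "d \<le> e / (8 * (K + 1) * (K + 1) * W)" unfolding d_def by auto
    have "norm ((\<beta> t (- t) - w t) - (\<beta> 0 (- 0) - w 0) - (t - 0) *\<^sub>R \<kappa> \<xi> (w 0)) \<le> e * norm (t - 0)"
      if t: "norm (t - 0) < d" for t
    proof -
      let ?S = "closed_segment 0 (- t)"
      have t\<delta>: "\<bar>t\<bar> < \<delta>" and td: "\<bar>t\<bar> < d" using t dle by auto
      have S: "\<bar>s\<bar> \<le> \<bar>t\<bar>" if "s \<in> ?S" for s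
        using that by (auto simp: closed_segment_eq_real_ivl split: if_splits)
      have pB: "p t s \<in> B" "norm (p t s - \<xi>) \<le> M * \<bar>t\<bar>" if "s \<in> ?S" for s
        using p(1)[OF t\<delta> S[OF that]] by auto
      have wt: "norm (w t - w 0) < 1" "norm (w t - w 0) < e / (4 * (K + 1))"
        using d1(2)[of t] td dle by auto
      have wW: "norm (w t) \<le> W"
        using wt(1) norm_triangle_ineq[of "w 0" "w t - w 0"] unfolding W_def by simp
      have b2: "norm (\<beta> t s) \<le> 2 * W" if s: "s \<in> ?S" for s
      proof -
        have "norm (\<beta> t s) \<le> 2 * norm (\<beta> t 0) + 2 * \<delta> * 0"
        proof (rule small_gronwall[of ?S 0 \<delta> "\<beta> t" "\<lambda>s. - \<kappa> (p t s) (\<beta> t s)" K])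
          show "\<bar>s - 0\<bar> \<le> \<delta>" if "s \<in> ?S" for s using S[OF that] t\<delta> by simp
          show "norm (- \<kappa> (p t s) (\<beta> t s)) \<le> K * norm (\<beta> t s) + 0" if "s \<in> ?S" for s
            using K(1)[OF pB(1)[OF that]] by simp
        qed (use \<beta>(2)[OF t\<delta>] K s in auto)
        then show ?thesis using \<beta>(1)[OF t\<delta>] wW by simp
      qed
      have bw: "norm (\<beta> t s - w t) \<le> (K * (2 * W)) * \<bar>t\<bar>" if s: "s \<in> ?S" for s
      proof -
        have "norm (\<beta> t s - \<beta> t 0) \<le> (K * (2 * W)) * \<bar>s - 0\<bar>"
        proof (rule real_mean_value_bound[where T="?S" and f'="\<lambda>s. - \<kappa> (p t s) (\<beta> t s)"])
          fix s assume s: "s \<in> ?S"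
          have "norm (\<kappa> (p t s) (\<beta> t s)) \<le> K * norm (\<beta> t s)" by (rule K(1)[OF pB(1)[OF s]])
          also have "\<dots> \<le> K * (2 * W)" using b2[OF s] K(2) by (rule mult_left_mono)
          finally show "norm (- \<kappa> (p t s) (\<beta> t s)) \<le> K * (2 * W)" by simp
        qed (use \<beta>(2)[OF t\<delta>] s in auto)
        also have "\<dots> \<le> (K * (2 * W)) * \<bar>t\<bar>"
          using S[OF s] K(2) W by (intro mult_left_mono) auto
        finally show ?thesis using \<beta>(1)[OF t\<delta>] by simp
      qed
      have kd: "norm (- \<kappa> (p t s) (\<beta> t s) + \<kappa> \<xi> (w 0)) \<le> e" if s: "s \<in> ?S" for s
      proof -
        have "(K * (2 * W)) * \<bar>t\<bar> \<le> (K * (2 * W)) * (e / (8 * (K + 1) * (K + 1) * W))"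
          using td dle(4) K(2) W by (intro mult_left_mono) auto
        also have "\<dots> = (K / (K + 1)) * (e / (4 * (K + 1)))"
          using K(2) W by (simp add: divide_simps)
        also have "\<dots> \<le> 1 * (e / (4 * (K + 1)))"
          using K(2) e by (intro mult_right_mono) auto
        also have "\<dots> = e / (4 * (K + 1))" by simp
        finally have q1: "norm (\<beta> t s - w t) \<le> e / (4 * (K + 1))" using bw[OF s] by linarith
        have "norm (\<beta> t s - w 0) \<le> norm (\<beta> t s - w t) + norm (w t - w 0)"
          using norm_triangle_ineq[of "\<beta> t s - w t" "w t - w 0"] by simp
        also have "\<dots> \<le> e / (4 * (K + 1)) + e / (4 * (K + 1))"
          by (rule add_mono[OF q1 less_imp_le[OF wt(2)]])
        also have "\<dots> = e / (2 * (K + 1))"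
          using K(2) by (simp add: divide_simps)
        finally have "norm (\<beta> t s - w 0) \<le> e / (2 * (K + 1))" .
        then have "K * norm (\<beta> t s - w 0) \<le> K * (e / (2 * (K + 1)))"
          using K(2) by (rule mult_left_mono)
        also have "\<dots> \<le> e / 2" using K(2) e by (simp add: field_simps)
        finally have 1: "norm (\<kappa> (p t s) (\<beta> t s - w 0)) \<le> e / 2"
          using K(1)[OF pB(1)[OF s], of "\<beta> t s - w 0"] by linarith
        have "M * \<bar>t\<bar> \<le> (M + 1) * \<bar>t\<bar>" by (simp add: mult_right_mono)
        also have "(M + 1) * \<bar>t\<bar> < (M + 1) * (d2 / (M + 1))"
          using td dle(3) p(2) by (intro mult_strict_left_mono) auto
        also have "\<dots> = d2" using p(2) by simp
        finally have "norm (p t s - \<xi>) < d2" using pB(2)[OF s] by linarith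
        from d2(2)[OF pB(1)[OF s] this] have 2: "norm (\<kappa> (p t s) (w 0) - \<kappa> \<xi> (w 0)) < e/2" .
        have eq: "- \<kappa> (p t s) (\<beta> t s) + \<kappa> \<xi> (w 0) = - (\<kappa> (p t s) (\<beta> t s - w 0) + (\<kappa> (p t s) (w 0) - \<kappa> \<xi> (w 0)))"
          using linear_diff[OF lin[OF pB(1)[OF s]], of "\<beta> t s" "w 0"] by simp
        show ?thesis unfolding eq norm_minus_cancel
          using norm_triangle_ineq[of "\<kappa> (p t s) (\<beta> t s - w 0)" "\<kappa> (p t s) (w 0) - \<kappa> \<xi> (w 0)"] 1 2 by linarith
      qed
      have "norm ((\<beta> t (- t) + (- t) *\<^sub>R \<kappa> \<xi> (w 0)) - (\<beta> t 0 + 0 *\<^sub>R \<kappa> \<xi> (w 0))) \<le> e * \<bar>- t - 0\<bar>"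
      proof (rule real_mean_value_bound[where T="?S" and f="\<lambda>s. \<beta> t s + s *\<^sub>R \<kappa> \<xi> (w 0)"
            and f'="\<lambda>s. - \<kappa> (p t s) (\<beta> t s) + \<kappa> \<xi> (w 0)"])
        fix s assume s: "s \<in> ?S"
        have "((\<lambda>s. s *\<^sub>R \<kappa> \<xi> (w 0)) has_vector_derivative \<kappa> \<xi> (w 0)) (at s within ?S)"
          unfolding has_vector_derivative_def by (auto intro!: derivative_eq_intros)
        then show "((\<lambda>s. \<beta> t s + s *\<^sub>R \<kappa> \<xi> (w 0)) has_vector_derivative - \<kappa> (p t s) (\<beta> t s) + \<kappa> \<xi> (w 0)) (at s within ?S)"
          by (rule has_vector_derivative_add[OF \<beta>(2)[OF t\<delta> s]])
      qed (use kd in auto)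
      moreover have "\<beta> 0 0 = w 0" using \<beta>(1)[of 0] \<delta> by simp
      ultimately show ?thesis using \<beta>(1)[OF t\<delta>] by (simp add: algebra_simps)
    qed
    then show "\<exists>d>0. \<forall>y. norm (y - 0) < d \<longrightarrow> norm (\<beta> y (- y) - w y - (\<beta> 0 (- 0) - w 0) - (y - 0) *\<^sub>R \<kappa> \<xi> (w 0)) \<le> e * norm (y - 0)"
      using dpos by blast
  qed
  then have "((\<lambda>t. \<beta> t (- t) - w t) has_vector_derivative \<kappa> \<xi> (w 0)) (at 0)"
    unfolding has_vector_derivative_def .
  from has_vector_derivative_add[OF w this] show ?thesis by simp
qed

locale pullback_setting = smooth_manifold_map A B u + F: smooth_field A X + C: torsion_free_connection B D
  for A :: "('m::{t2_space,second_countable_topology}, 'a::{real_normed_vector,heine_borel}) chart set"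
    and B :: "('n::{t2_space,second_countable_topology}, 'b::{real_normed_vector,heine_borel}) chart set"
    and u :: "'m \<Rightarrow> 'n" and X :: "'m \<Rightarrow> ('m, 'a) tvec" and D :: "('n, 'b, ('n, 'b) chart, 'b) conn" +
  fixes D' :: "('m, 'a, ('n, 'b) chart, 'b) conn"
  assumes pullback: "pullback_connection A B u (tangent_bundle B) D D'"
begin

abbreviation E' :: "('m, ('n, 'b) chart, 'b) vbundle" where
  "E' \<equiv> pullback_bundle u (tangent_bundle B)"

lemma fibre_pullback: "fibre E' x = tangent_space B (u x)"
  unfolding fibre_def pullback_bundle_def by simp

lemma mem_bdom_pullback: "x \<in> bdom E' i \<longleftrightarrow> i \<in> B \<and> u x \<in> cdom i"
  unfolding pullback_bundle_def by (simp add: N.mem_bdom)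

lemma const_section_pullback: "const_section E' i b x = N.const_field i b (u x)"
  unfolding const_section_def pullback_bundle_def by (simp cong: if_cong)

text \<open>
  Since sections with constant components are pulled back from the target, the pull-back connection is
  determined by the Christoffel symbols of the target and the differential of u.
\<close>

lemma pullback_const_section:
  assumes v: "v \<in> tangent_space A x" and i: "i \<in> B" "u x \<in> cdom i"
  shows "D' x v (const_section E' i b) i = C.christoffel i (u x) (differential A B u x v i) b"
proof -
  have "D' x v (\<lambda>y. N.const_field i b (u y)) = D (u x) (differential A B u x v) (N.const_field i b)"
    by (rule pullback[unfolded pullback_connection_def, THEN conjunct2, THEN spec, THEN spec, THEN mp,
          THEN spec, THEN mp, OF _ i(2), THEN bspec, OF _ v])
       (use N.open_cdom[OF i(1)] N.vector_field_const_field[OF i(1) N.open_cdom[OF i(1)] order_refl] in blast)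
  then have "D' x v (const_section E' i b) = D (u x) (differential A B u x v) (N.const_field i b)"
    unfolding const_section_pullback[abs_def] .
  then show ?thesis using C.conn_const_field[OF i differential_tangent[OF v]] by simp
qed

text \<open>
  The components of the section \<open>du(X)\<close>, and the connection form of the pull-back connection evaluated
  on X, in the charts c and d.
\<close>

abbreviation wrep :: "('m,'a) chart \<Rightarrow> ('n,'b) chart \<Rightarrow> 'a \<Rightarrow> 'b" where
  "wrep c d y \<equiv> dder (rep c d) y (F.frep c y)"

abbreviation krep :: "('m,'a) chart \<Rightarrow> ('n,'b) chart \<Rightarrow> 'a \<Rightarrow> 'b \<Rightarrow> 'b" where
  "krep c d y b \<equiv> C.christoffel d (u (cinv c y)) (wrep c d y) b"

lemma smooth_frep: "c \<in> A \<Longrightarrow> smooth_on (repdom c d) (F.frep c)"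
  by (rule smooth_on_subset[OF F.field_smooth]) auto

lemma smooth_wrep:
  assumes "c \<in> A" "d \<in> B"
  shows "smooth_on (repdom c d) (wrep c d)"
proof (rule smooth_on_bilinear_family[OF open_repdom[OF assms], where N="dder (rep c d)"])
  show "linear (dder (rep c d) y)" if "y \<in> repdom c d" for y
    by (rule linear_dder[OF rep_differentiable[OF assms that]])
  show "smooth_on (repdom c d) (\<lambda>y. dder (rep c d) y b)" for b
    by (rule smooth_on_dder[OF smooth_rep[OF assms]])
  show "smooth_on (repdom c d) (F.frep c)" by (rule smooth_frep[OF assms(1)])
qed

lemma smooth_christoffel_rep:
  assumes "c \<in> A" "d \<in> B"
  shows "smooth_on (repdom c d) (\<lambda>y. C.christoffel d (u (cinv c y)) a b)"
proof -
  have "smooth_on (repdom c d) (\<lambda>y. C.christoffel d (cinv d (rep c d y)) a b)"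
    by (rule smooth_on_compose[OF open_repdom[OF assms] N.open_cimage[OF assms(2)] _ C.smooth_christoffel[OF assms(2)] smooth_rep[OF assms]])
       (use mem_repdom[OF assms(1)] in blast)
  then show ?thesis
  proof (rule smooth_on_cong[OF open_repdom[OF assms], rotated])
    fix y assume "y \<in> repdom c d"
    then have "u (cinv c y) \<in> cdom d" using mem_repdom[OF assms(1)] by blast
    then show "C.christoffel d (cinv d (rep c d y)) a b = C.christoffel d (u (cinv c y)) a b"
      using N.cinv_cmap[OF assms(2)] by simp
  qed
qed

lemma smooth_krep:
  assumes "c \<in> A" "d \<in> B"
  shows "smooth_on (repdom c d) (\<lambda>y. krep c d y b)"
proof (rule smooth_on_bilinear_family[OF open_repdom[OF assms], where N="\<lambda>y a. C.christoffel d (u (cinv c y)) a b"])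
  show "linear (\<lambda>a. C.christoffel d (u (cinv c y)) a b)" if "y \<in> repdom c d" for y
    by (rule C.linear_christoffel_left[OF assms(2)]) (use that mem_repdom[OF assms(1)] in blast)
qed (intro smooth_christoffel_rep smooth_wrep assms)+

lemma linear_krep: "c \<in> A \<Longrightarrow> d \<in> B \<Longrightarrow> y \<in> repdom c d \<Longrightarrow> linear (krep c d y)"
  by (rule C.linear_christoffel) (use mem_repdom in blast)+

end


text \<open>
  The local flow of X near x0, in the chart c, with all the estimates needed to compute a Lie derivative
  at x0 in the trivialisation given by the chart d.  For base points within r/2 of x0 and times up to \<open>\<delta>\<close> the flow
  stays in the r-ball, where \<open>K\<close> bounds the connection form; \<open>M * \<delta> \<le> r/2\<close> ensures that the flow
  may be restarted at any point of the orbit of x0.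
\<close>

locale flow_box = pullback_setting +
  fixes c :: "('a, 'b) chart" and d :: "('c, 'd) chart" and x0 :: 'a
    and r \<delta> L M K :: real and \<phi> :: "'b \<Rightarrow> real \<Rightarrow> 'b" and Z :: "real \<Rightarrow> 'b \<Rightarrow> 'b"
  assumes c: "c \<in> A" "x0 \<in> cdom c" and d: "d \<in> B" "u x0 \<in> cdom d"
    and r: "r > 0" and \<delta>: "\<delta> > 0" and box: "cball (cmap c x0) r \<subseteq> repdom c d"
    and Lip: "L-lipschitz_on (cball (cmap c x0) r) (F.frep c)"
    and M: "M \<ge> 0" "M * \<delta> \<le> r/2"
    and \<phi>0: "\<And>\<xi>. \<xi> \<in> cball (cmap c x0) (r/2) \<Longrightarrow> \<phi> \<xi> 0 = \<xi>"
    and \<phi>ball: "\<And>\<xi> t. \<xi> \<in> cball (cmap c x0) (r/2) \<Longrightarrow> t \<in> {-\<delta>..\<delta>} \<Longrightarrow> \<phi> \<xi> t \<in> ball (cmap c x0) r"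
    and \<phi>M: "\<And>\<xi> t. \<xi> \<in> cball (cmap c x0) (r/2) \<Longrightarrow> t \<in> {-\<delta>..\<delta>} \<Longrightarrow> norm (\<phi> \<xi> t - \<xi>) \<le> M * \<bar>t\<bar>"
    and \<phi>': "\<And>\<xi> t. \<xi> \<in> cball (cmap c x0) (r/2) \<Longrightarrow> t \<in> {-\<delta>..\<delta>} \<Longrightarrow>
       (\<phi> \<xi> has_vector_derivative F.frep c (\<phi> \<xi> t)) (at t within {-\<delta>..\<delta>})"
    and Zder: "\<And>t. t \<in> {-\<delta>..\<delta>} \<Longrightarrow> ((\<lambda>\<xi>. \<phi> \<xi> t) has_derivative Z t) (at (cmap c x0))"
    and Z0: "\<And>v. Z 0 v = v"
    and Z': "\<And>v. ((\<lambda>t. Z t v) has_vector_derivative dder (F.frep c) (cmap c x0) v) (at 0)"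
    and K: "K \<ge> 0" "\<And>y b. y \<in> cball (cmap c x0) r \<Longrightarrow> norm (krep c d y b) \<le> K * norm b" "K * \<delta> \<le> 1/2"
begin

abbreviation "\<xi>0 \<equiv> cmap c x0"
abbreviation "T \<equiv> {-\<delta>..\<delta>}"

lemma base: "\<xi>0 \<in> cball \<xi>0 (r/2)" "\<xi>0 \<in> cball \<xi>0 r" "\<xi>0 \<in> repdom c d" "0 \<in> T"
  using r box \<delta> by auto

lemma \<phi>_rep: "\<xi> \<in> cball \<xi>0 (r/2) \<Longrightarrow> t \<in> T \<Longrightarrow> \<phi> \<xi> t \<in> repdom c d"
  using \<phi>ball box by force

lemma \<phi>_img: "\<xi> \<in> cball \<xi>0 (r/2) \<Longrightarrow> t \<in> T \<Longrightarrow> \<phi> \<xi> t \<in> cmap c ` cdom c"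
  using \<phi>_rep by blast

lemma \<phi>_cdom: "\<xi> \<in> cball \<xi>0 (r/2) \<Longrightarrow> t \<in> T \<Longrightarrow> cinv c (\<phi> \<xi> t) \<in> cdom c"
  using M.cinv_in_cdom[OF c(1) \<phi>_img] .

lemma \<phi>_target: "\<xi> \<in> cball \<xi>0 (r/2) \<Longrightarrow> t \<in> T \<Longrightarrow> u (cinv c (\<phi> \<xi> t)) \<in> cdom d"
  using \<phi>_rep mem_repdom[OF c(1)] by blast

lemma flow_in_box:
  assumes "\<xi> \<in> cball \<xi>0 (r/2)" "t \<in> T"
  shows "flow A X t (cinv c \<xi>) = cinv c (\<phi> \<xi> t)"
proof -
  have b: "ball \<xi>0 r \<subseteq> cmap c ` cdom c"
    using order_trans[OF ball_subset_cball box] by blast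
  have L': "L-lipschitz_on (ball \<xi>0 r) (F.frep c)" by (rule lipschitz_on_subset[OF Lip]) auto
  have "flow A X t (cinv c (\<phi> \<xi> 0)) = cinv c (\<phi> \<xi> t)"
    by (rule F.flow_chart[OF c(1) b L' \<phi>ball[OF assms(1)] \<phi>'[OF assms(1)] assms(2)])
  then show ?thesis unfolding \<phi>0[OF assms(1)] .
qed

lemma flow_x0: "t \<in> T \<Longrightarrow> flow A X t x0 = cinv c (\<phi> \<xi>0 t)"
  using flow_in_box[OF base(1)] M.cinv_cmap[OF c] by simp

lemma \<phi>_half: "t \<in> T \<Longrightarrow> \<phi> \<xi>0 t \<in> cball \<xi>0 (r/2)"
proof -
  assume t: "t \<in> T"
  have "norm (\<phi> \<xi>0 t - \<xi>0) \<le> M * \<bar>t\<bar>" by (rule \<phi>M[OF base(1) t])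
  also have "\<dots> \<le> M * \<delta>" using t M(1) by (intro mult_left_mono) auto
  finally show ?thesis using M(2) by (simp add: dist_norm norm_minus_commute)
qed

lemma differential_flow:
  assumes t: "t \<in> T" and v: "v \<in> tangent_space A x0"
  shows "differential A A (flow A X t) x0 v = M.const_field c (Z t (v c)) (flow A X t x0)"
proof
  fix e
  let ?x = "flow A X t x0"
  have xe: "?x = cinv c (\<phi> \<xi>0 t)" by (rule flow_x0[OF t])
  have xc: "?x \<in> cdom c" "cmap c ?x = \<phi> \<xi>0 t"
    unfolding xe by (rule \<phi>_cdom[OF base(1) t], rule M.cmap_cinv[OF c(1) \<phi>_img[OF base(1) t]])
  show "differential A A (flow A X t) x0 v e = M.const_field c (Z t (v c)) ?x e"
  proof (cases "e \<in> A \<and> ?x \<in> cdom e")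
    case True
    then have e: "e \<in> A" "?x \<in> cdom e" by blast+
    have "(\<lambda>y. cmap e (cinv c y)) differentiable (at (\<phi> \<xi>0 t))"
      using M.transition_differentiable[OF c(1) e(1) xc(1) e(2)] unfolding xc(2) .
    from has_derivative_compose[OF Zder[OF t] has_derivative_dder[OF this]]
    have "((\<lambda>y. cmap e (cinv c (\<phi> y t))) has_derivative (\<lambda>w. M.trans c e ?x (Z t w))) (at \<xi>0)"
      unfolding xc(2) .
    then have D: "((\<lambda>y. cmap e (flow A X t (cinv c y))) has_derivative (\<lambda>w. M.trans c e ?x (Z t w))) (at \<xi>0)"
    proof (rule has_derivative_transform_within_open[of _ _ _ _ "ball \<xi>0 (r/2)"])
      fix y assume "y \<in> ball \<xi>0 (r/2)"
      then have "y \<in> cball \<xi>0 (r/2)" by simp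
      from flow_in_box[OF this t] show "cmap e (cinv c (\<phi> y t)) = cmap e (flow A X t (cinv c y))" by simp
    qed (use r in auto)
    have "differential A A (flow A X t) x0 v e = dder (\<lambda>y. cmap e (flow A X t (cinv c y))) \<xi>0 (v c)"
      by (rule M.differential_chart[where u="flow A X t", OF c v e]) (use D in \<open>auto simp: differentiable_def\<close>)
    also have "\<dots> = M.trans c e ?x (Z t (v c))" unfolding dderI[OF D] ..
    also have "\<dots> = M.const_field c (Z t (v c)) ?x e" using c e xc by (simp add: M.const_field_eq)
    finally show ?thesis .
  next
    case False
    have "differential A A (flow A X t) x0 v e = 0" unfolding differential_def using False by (rule if_not_P)
    moreover have "M.const_field c (Z t (v c)) ?x e = 0" unfolding M.const_field_eq using False by (intro if_not_P) blast
    ultimately show ?thesis by simp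
  qed
qed

definition w :: "'b \<Rightarrow> real \<Rightarrow> 'd" where
  "w v t = dder (rep c d) (\<phi> \<xi>0 t) (Z t v)"

text \<open>
  The vector that the Lie derivative transports back, with its components w in the chart d.
\<close>

lemma differential_along_flow:
  assumes t: "t \<in> T" and v: "v \<in> tangent_space A x0"
  shows "differential A B u (flow A X t x0) (differential A A (flow A X t) x0 v) =
    N.const_field d (w (v c) t) (u (flow A X t x0))"
proof -
  let ?x = "flow A X t x0"
  have xe: "?x = cinv c (\<phi> \<xi>0 t)" by (rule flow_x0[OF t])
  have xc: "?x \<in> cdom c" "cmap c ?x = \<phi> \<xi>0 t" "u ?x \<in> cdom d"
    unfolding xe by (rule \<phi>_cdom[OF base(1) t], rule M.cmap_cinv[OF c(1) \<phi>_img[OF base(1) t]], rule \<phi>_target[OF base(1) t])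
  let ?z = "M.const_field c (Z t (v c)) ?x"
  have z: "?z \<in> tangent_space A ?x" by (rule M.const_field_tangent[OF c(1) xc(1)])
  have "differential A B u ?x ?z = N.const_field d (differential A B u ?x ?z d) (u ?x)"
    by (rule N.tangent_eq_const_field[OF differential_tangent[OF z] d(1) xc(3)])
  also have "differential A B u ?x ?z d = w (v c) t"
    unfolding differential_rep[OF c(1) xc(1) z d(1) xc(3)] M.const_field_self[OF c(1) xc(1)] xc(2) w_def ..
  finally show ?thesis unfolding differential_flow[OF t v] .
qed

lemma velocity_flow:
  assumes \<xi>: "\<xi> \<in> cball \<xi>0 (r/2)" and s: "\<bar>s\<bar> < \<delta>"
  shows "velocity A (\<lambda>s. flow A X s (cinv c \<xi>)) s = X (cinv c (\<phi> \<xi> s))"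
proof
  fix e
  let ?\<gamma> = "\<lambda>s. flow A X s (cinv c \<xi>)"
  have sT: "s \<in> T" using s by auto
  have x: "?\<gamma> s = cinv c (\<phi> \<xi> s)" by (rule flow_in_box[OF \<xi> sT])
  show "velocity A ?\<gamma> s e = X (cinv c (\<phi> \<xi> s)) e"
  proof (cases "e \<in> A \<and> ?\<gamma> s \<in> cdom e")
    case True
    have I: "integral_curve A X T (\<lambda>t. cinv c (\<phi> \<xi> t))"
      by (rule F.integral_curve_chart[OF c(1) \<phi>_img[OF \<xi>] \<phi>'[OF \<xi>]])
    have "((\<lambda>r. cmap e (cinv c (\<phi> \<xi> r))) has_vector_derivative X (cinv c (\<phi> \<xi> s)) e) (at s within T)"
      using I sT True unfolding integral_curve_def x by blast
    moreover have "at s within T = at s" using s by (intro at_within_interior) auto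
    ultimately have "((\<lambda>r. cmap e (cinv c (\<phi> \<xi> r))) has_vector_derivative X (cinv c (\<phi> \<xi> s)) e) (at s)" by simp
    then have "((\<lambda>r. cmap e (?\<gamma> r)) has_vector_derivative X (cinv c (\<phi> \<xi> s)) e) (at s)"
    proof (rule has_vector_derivative_transform_within_open[of _ _ _ "{-\<delta><..<\<delta>}"])
      fix t assume "t \<in> {-\<delta><..<\<delta>}"
      then have "t \<in> T" by auto
      from flow_in_box[OF \<xi> this] show "cmap e (cinv c (\<phi> \<xi> t)) = cmap e (?\<gamma> t)" by simp
    qed (use s in auto)
    from vector_derivative_at[OF this] show ?thesis
      unfolding velocity_def using True by simp
  next
    case False
    have "velocity A ?\<gamma> s e = 0" unfolding velocity_def using False by (rule if_not_P)
    moreover have "X (cinv c (\<phi> \<xi> s)) e = 0"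
      by (rule M.tangent_spaceD(1)[OF F.field_tangent]) (use False x in simp)
    ultimately show ?thesis by simp
  qed
qed

lemma pullback_conn_along_flow:
  assumes \<xi>: "\<xi> \<in> cball \<xi>0 (r/2)" and s: "\<bar>s\<bar> < \<delta>" and i: "i \<in> B" "u (cinv c (\<phi> \<xi> s)) \<in> cdom i"
  shows "D' (flow A X s (cinv c \<xi>)) (velocity A (\<lambda>s. flow A X s (cinv c \<xi>)) s) (const_section E' i b) i =
    C.christoffel i (u (cinv c (\<phi> \<xi> s))) (N.trans d i (u (cinv c (\<phi> \<xi> s))) (wrep c d (\<phi> \<xi> s))) b"
proof -
  let ?x = "cinv c (\<phi> \<xi> s)"
  have sT: "s \<in> T" using s by auto
  have x: "?x \<in> cdom c" "cmap c ?x = \<phi> \<xi> s" "u ?x \<in> cdom d"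
    by (rule \<phi>_cdom[OF \<xi> sT], rule M.cmap_cinv[OF c(1) \<phi>_img[OF \<xi> sT]], rule \<phi>_target[OF \<xi> sT])
  have T: "differential A B u ?x (X ?x) \<in> tangent_space B (u ?x)" by (rule differential_tangent[OF F.field_tangent])
  have "differential A B u ?x (X ?x) i = N.trans d i (u ?x) (differential A B u ?x (X ?x) d)"
    by (rule N.tangent_spaceD(2)[OF T d(1) i(1) x(3) i(2)])
  also have "differential A B u ?x (X ?x) d = wrep c d (\<phi> \<xi> s)"
    unfolding differential_rep[OF c(1) x(1) F.field_tangent d(1) x(3)] x(2) ..
  finally show ?thesis
    unfolding velocity_flow[OF \<xi> s] flow_in_box[OF \<xi> sT] pullback_const_section[OF F.field_tangent i] by simp
qed

text \<open>
  A parallel field must satisfy its equation in every trivialisation.  A solution of the equation in the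
  trivialisation d satisfies it in any other one by the transformation law of the Christoffel symbols.
\<close>

lemma parallel_field_exists:
  assumes \<xi>: "\<xi> \<in> cball \<xi>0 (r/2)" and S: "S \<subseteq> {-\<delta><..<\<delta>}"
    and \<beta>: "\<And>s. s \<in> S \<Longrightarrow> (\<beta> has_vector_derivative - krep c d (\<phi> \<xi> s) (\<beta> s)) (at s within S)"
  shows "parallel_along A E' D' (\<lambda>s. flow A X s (cinv c \<xi>)) S (\<lambda>s. N.const_field d (\<beta> s) (u (flow A X s (cinv c \<xi>))))"
  unfolding parallel_along_def fibre_pullback mem_bdom_pullback
proof (intro ballI conjI allI impI)
  fix s assume s: "s \<in> S"
  have ST: "t \<in> T" if "t \<in> S" for t using that S by auto
  have "s \<in> {-\<delta><..<\<delta>}" using s S by blast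
  then have sd: "\<bar>s\<bar> < \<delta>" by auto
  have fl: "flow A X t (cinv c \<xi>) = cinv c (\<phi> \<xi> t)" if "t \<in> S" for t by (rule flow_in_box[OF \<xi> ST[OF that]])
  let ?x = "cinv c (\<phi> \<xi> s)"
  have x: "u ?x \<in> cdom d" by (rule \<phi>_target[OF \<xi> ST[OF s]])
  show "N.const_field d (\<beta> s) (u (flow A X s (cinv c \<xi>))) \<in> tangent_space B (u (flow A X s (cinv c \<xi>)))"
    unfolding fl[OF s] by (rule N.const_field_tangent[OF d(1) x])
  fix i assume "i \<in> B \<and> u (flow A X s (cinv c \<xi>)) \<in> cdom i"
  then have i: "i \<in> B" "u ?x \<in> cdom i" unfolding fl[OF s] by blast+
  let ?\<tau> = "\<lambda>y. cmap i (cinv d y)"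
  let ?\<eta> = "\<lambda>t. rep c d (\<phi> \<xi> t)"
  let ?W = "cmap d ` (cdom d \<inter> cdom i)"
  have oW: "open ?W" by (intro N.open_cimage_Int d(1) N.open_cdom i(1))
  have \<eta>s: "?\<eta> s \<in> ?W" using x i(2) by blast
  have \<phi>S: "(\<phi> \<xi> has_vector_derivative F.frep c (\<phi> \<xi> s)) (at s within S)"
    by (rule has_vector_derivative_within_subset[OF \<phi>'[OF \<xi> ST[OF s]]]) (use ST in blast)
  have \<eta>': "(?\<eta> has_vector_derivative wrep c d (\<phi> \<xi> s)) (at s within S)"
    by (rule has_vector_derivative_chain[OF \<phi>S rep_differentiable[OF c(1) d(1) \<phi>_rep[OF \<xi> ST[OF s]]]])
  have "continuous (at s within S) ?\<eta>" by (rule has_vector_derivative_continuous[OF \<eta>'])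
  then have "\<forall>\<^sub>F t in at s within S. ?\<eta> t \<in> ?W"
    unfolding continuous_within by (rule topological_tendstoD[OF _ oW \<eta>s])
  then obtain e where e: "e > 0" "\<And>t. t \<in> S \<Longrightarrow> dist t s < e \<Longrightarrow> ?\<eta> t \<in> ?W"
    unfolding eventually_at using \<eta>s by metis
  \<comment> \<open>Near time s the curve stays in the domain of chart i, where the field is the transported solution.\<close>
  let ?S = "S \<inter> ball s e"
  have sS: "s \<in> ?S" using s e(1) by simp
  have at: "at s within ?S = at s within S"
    by (rule at_within_nhd[of _ "ball s e"]) (use e(1) in auto)
  have in_i: "u (cinv c (\<phi> \<xi> t)) \<in> cdom i" if "t \<in> ?S" for t
  proof -
    have "?\<eta> t \<in> ?W" using e(2) that by (auto simp: dist_commute)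
    then have "cinv d (?\<eta> t) \<in> cdom i" using N.mem_cimage_Int[OF d(1)] by blast
    then show ?thesis using N.cinv_cmap[OF d(1) \<phi>_target[OF \<xi> ST]] that by auto
  qed
  have \<tau>2: "Ck_on 2 ?W ?\<tau>" by (rule smooth_on_Ck[OF N.smooth_transition[OF d(1) i(1)]])
  have \<eta>W: "?\<eta> t \<in> ?W" if "t \<in> ?S" for t using e(2) that by (auto simp: dist_commute)
  let ?a = "wrep c d (\<phi> \<xi> s)" and ?b = "\<beta> s"
  have "((\<lambda>t. dder ?\<tau> (?\<eta> t) (\<beta> t)) has_vector_derivative
      dder (\<lambda>q. dder ?\<tau> q (\<beta> s)) (?\<eta> s) ?a + dder ?\<tau> (?\<eta> s) (- krep c d (\<phi> \<xi> s) (\<beta> s))) (at s within ?S)"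
    by (rule has_vector_derivative_differential_along[OF oW \<tau>2 \<eta>W sS])
       (use \<eta>' \<beta>[OF s] in \<open>simp_all only: at\<close>)
  also have "dder ?\<tau> (?\<eta> s) (- krep c d (\<phi> \<xi> s) (\<beta> s)) = - N.trans d i (u ?x) (C.christoffel d (u ?x) ?a ?b)"
    using linear_neg[OF N.linear_trans[OF d(1) i(1) x i(2)]] .
  also have "dder (\<lambda>q. dder ?\<tau> q ?b) (?\<eta> s) ?a + - N.trans d i (u ?x) (C.christoffel d (u ?x) ?a ?b) =
      - C.christoffel i (u ?x) (N.trans d i (u ?x) ?a) (N.trans d i (u ?x) ?b)"
    unfolding C.christoffel_change_chart[OF d(1) x i] by simp
  finally have "((\<lambda>t. dder ?\<tau> (?\<eta> t) (\<beta> t)) has_vector_derivative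
      - C.christoffel i (u ?x) (N.trans d i (u ?x) ?a) (N.trans d i (u ?x) ?b)) (at s within ?S)" .
  note 1 = this
  let ?V = "\<lambda>s. N.const_field d (\<beta> s) (u (flow A X s (cinv c \<xi>)))"
  have V: "?V t i = dder ?\<tau> (?\<eta> t) (\<beta> t)" if "t \<in> ?S" for t
    using in_i[OF that] \<phi>_target[OF \<xi> ST] d(1) i(1) that by (simp add: fl N.const_field_eq)
  have "((\<lambda>t. ?V t i) has_vector_derivative
      - C.christoffel i (u ?x) (N.trans d i (u ?x) ?a) (N.trans d i (u ?x) ?b)) (at s within ?S)"
    by (rule has_vector_derivative_transform[OF sS _ 1]) (rule V)
  then show "((\<lambda>t. ?V t i) has_vector_derivative
      - D' (flow A X s (cinv c \<xi>)) (velocity A (\<lambda>s. flow A X s (cinv c \<xi>)) s) (const_section E' i (?V s i)) i) (at s within S)"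
    unfolding at pullback_conn_along_flow[OF \<xi> sd i] V[OF sS] .
qed

lemma parallel_field_unique:
  assumes \<xi>: "\<xi> \<in> cball \<xi>0 (r/2)" and S: "S \<subseteq> {-\<delta><..<\<delta>}" "convex S" "compact S" "0 \<in> S"
    and \<beta>: "\<And>s. s \<in> S \<Longrightarrow> (\<beta> has_vector_derivative - krep c d (\<phi> \<xi> s) (\<beta> s)) (at s within S)"
    and V: "parallel_along A E' D' (\<lambda>s. flow A X s (cinv c \<xi>)) S V" "V 0 d = \<beta> 0" and s: "s \<in> S"
  shows "V s = N.const_field d (\<beta> s) (u (flow A X s (cinv c \<xi>)))"
proof -
  have "t \<in> {-\<delta><..<\<delta>}" if "t \<in> S" for t using that S(1) by blast
  then have ST: "t \<in> T" "\<bar>t\<bar> < \<delta>" if "t \<in> S" for t using that by force+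
  have fl: "flow A X t (cinv c \<xi>) = cinv c (\<phi> \<xi> t)" if "t \<in> S" for t by (rule flow_in_box[OF \<xi> ST(1)[OF that]])
  have tg: "u (cinv c (\<phi> \<xi> t)) \<in> cdom d" if "t \<in> S" for t by (rule \<phi>_target[OF \<xi> ST(1)[OF that]])
  have VT: "V t \<in> tangent_space B (u (flow A X t (cinv c \<xi>)))" if "t \<in> S" for t
    using V(1) that unfolding parallel_along_def fibre_pullback by blast
  have Vd: "((\<lambda>t. V t d) has_vector_derivative - krep c d (\<phi> \<xi> t) (V t d)) (at t within S)" if t: "t \<in> S" for t
  proof -
    have "((\<lambda>t. V t d) has_vector_derivative - D' (flow A X t (cinv c \<xi>)) (velocity A (\<lambda>s. flow A X s (cinv c \<xi>)) t)
        (const_section E' d (V t d)) d) (at t within S)"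
      using V(1) t d(1) tg[OF t] unfolding parallel_along_def mem_bdom_pullback fl[OF t, symmetric] by blast
    then show ?thesis
      unfolding pullback_conn_along_flow[OF \<xi> ST(2)[OF t] d(1) tg[OF t]] N.trans_refl[OF d(1) tg[OF t]] .
  qed
  have \<phi>c: "\<phi> \<xi> t \<in> cball \<xi>0 r" if "t \<in> S" for t using \<phi>ball[OF \<xi> ST(1)[OF that]] by auto
  have "V s d = \<beta> s"
  proof (rule ode_unique_small[where T=S and ?t0.0=0 and \<delta>=\<delta> and L=K and F="\<lambda>t b. - krep c d (\<phi> \<xi> t) b"
      and p="\<lambda>t. V t d" and q=\<beta> and t=s])
    fix t assume t: "t \<in> S"
    have l: "linear (krep c d (\<phi> \<xi> t))" by (rule linear_krep[OF c(1) d(1) \<phi>_rep[OF \<xi> ST(1)[OF t]]])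
    have "- krep c d (\<phi> \<xi> t) (V t d) - - krep c d (\<phi> \<xi> t) (\<beta> t) = - krep c d (\<phi> \<xi> t) (V t d - \<beta> t)"
      using linear_diff[OF l] by simp
    then show "norm (- krep c d (\<phi> \<xi> t) (V t d) - - krep c d (\<phi> \<xi> t) (\<beta> t)) \<le> K * norm (V t d - \<beta> t)"
      using K(2)[OF \<phi>c[OF t], of "V t d - \<beta> t"] by simp
  next
    show "\<bar>t - 0\<bar> \<le> \<delta>" if "t \<in> S" for t using ST(2)[OF that] by simp
  qed (use S K V(2) s Vd \<beta> in auto)
  then show ?thesis
    using N.tangent_eq_const_field[OF VT[OF s] d(1)] tg[OF s] fl[OF s] by simp
qed

lemma parallel_transport_flow:
  assumes \<xi>: "\<xi> \<in> cball \<xi>0 (r/2)" and t: "\<bar>t\<bar> < \<delta>"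
    and \<beta>: "\<And>s. s \<in> closed_segment 0 t \<Longrightarrow>
      (\<beta> has_vector_derivative - krep c d (\<phi> \<xi> s) (\<beta> s)) (at s within closed_segment 0 t)"
  shows "horizontal_lift A E' D' X t (cinv c \<xi>) (N.const_field d (\<beta> 0) (u (cinv c \<xi>))) d = \<beta> t"
proof -
  let ?S = "closed_segment 0 t"
  let ?\<gamma> = "\<lambda>s. flow A X s (cinv c \<xi>)"
  let ?V = "\<lambda>s. N.const_field d (\<beta> s) (u (?\<gamma> s))"
  have S: "?S \<subseteq> {-\<delta><..<\<delta>}" using t by (auto simp: closed_segment_eq_real_ivl split: if_splits)
  have tT: "t \<in> T" "0 \<in> T" using t by auto
  have \<gamma>0: "?\<gamma> 0 = cinv c \<xi>" using flow_in_box[OF \<xi> tT(2)] \<phi>0[OF \<xi>] by simp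
  have tg: "u (cinv c \<xi>) \<in> cdom d" using \<phi>_target[OF \<xi> tT(2)] \<phi>0[OF \<xi>] by simp
  have tgt: "u (?\<gamma> t) \<in> cdom d" using \<phi>_target[OF \<xi> tT(1)] flow_in_box[OF \<xi> tT(1)] by simp
  have "horizontal_lift A E' D' X t (cinv c \<xi>) (N.const_field d (\<beta> 0) (u (cinv c \<xi>))) = ?V t"
    unfolding horizontal_lift_def parallel_transport_def
  proof (rule the_equality)
    show "\<exists>V. parallel_along A E' D' ?\<gamma> ?S V \<and> V 0 = N.const_field d (\<beta> 0) (u (cinv c \<xi>)) \<and> V t = ?V t"
      using parallel_field_exists[OF \<xi> S \<beta>] \<gamma>0 by (intro exI[of _ ?V]) simp
    fix y assume "\<exists>V. parallel_along A E' D' ?\<gamma> ?S V \<and> V 0 = N.const_field d (\<beta> 0) (u (cinv c \<xi>)) \<and> V t = y"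
    then obtain V where V: "parallel_along A E' D' ?\<gamma> ?S V" "V 0 = N.const_field d (\<beta> 0) (u (cinv c \<xi>))" "V t = y" by blast
    have "V 0 d = \<beta> 0" unfolding V(2) by (rule N.const_field_self[OF d(1) tg])
    from parallel_field_unique[OF \<xi> S _ _ _ \<beta> V(1) this, of t] show "y = ?V t" using V(3) by simp
  qed
  then show ?thesis using N.const_field_self[OF d(1) tgt] by simp
qed

text \<open>
  The right-hand side is the covariant derivative of \<open>du(X)\<close> in the direction of Y.  The symmetry of
  the second derivative and of the Christoffel symbols exchanges the roles of X and Y.
\<close>

lemma conn_lie_deriv_differential:
  assumes v: "Y x0 \<in> tangent_space A x0"
  shows "conn_lie_deriv A E' D' X (differential_one_form A B u) [Y] x0 d =
    dder (wrep c d) \<xi>0 (Y x0 c) + C.christoffel d (u x0) (dder (rep c d) \<xi>0 (Y x0 c)) (wrep c d \<xi>0)"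
proof -
  let ?v = "Y x0 c"
  let ?w = "w ?v"
  have oR: "open (repdom c d)" by (rule open_repdom[OF c(1) d(1)])
  have rep2: "Ck_on 2 (repdom c d) (rep c d)" by (rule smooth_on_Ck[OF smooth_rep[OF c(1) d(1)]])
  have atT: "at 0 within T = at 0" using \<delta> by (intro at_within_interior) simp
  \<comment> \<open>For each t, the solution along the flow line that starts at time 0 from the flow of x0 at time t.\<close>
  have "\<exists>\<beta>. \<beta> 0 = b \<and> (\<forall>s\<in>T. (\<beta> has_vector_derivative - krep c d (\<phi> \<xi> s) (\<beta> s)) (at s within T))"
    if \<xi>: "\<xi> \<in> cball \<xi>0 (r/2)" for \<xi> b
  proof (rule picard_linear[of \<delta> "\<lambda>s b. - krep c d (\<phi> \<xi> s) b" K])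
    show "linear (\<lambda>b. - krep c d (\<phi> \<xi> s) b)" if "s \<in> T" for s
      by (rule linear_compose_neg[OF linear_krep[OF c(1) d(1) \<phi>_rep[OF \<xi> that]]])
    show "norm (- krep c d (\<phi> \<xi> s) b) \<le> K * norm b" if "s \<in> T" for s b
      using K(2)[of "\<phi> \<xi> s" b] \<phi>ball[OF \<xi> that] by simp
    show "continuous_on T (\<lambda>s. - krep c d (\<phi> \<xi> s) (\<beta> s))" if "continuous_on T \<beta>" for \<beta>
    proof (rule continuous_on_minus[OF continuous_on_linear_family[where N="\<lambda>s. krep c d (\<phi> \<xi> s)", OF _ _ that]])
      show "linear (krep c d (\<phi> \<xi> s))" if "s \<in> T" for s
        by (rule linear_krep[OF c(1) d(1) \<phi>_rep[OF \<xi> that]])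
      show "continuous_on T (\<lambda>s. krep c d (\<phi> \<xi> s) b)" for b
        by (rule continuous_on_compose2[OF smooth_on_continuous[OF smooth_krep[OF c(1) d(1)]]
              has_vector_derivative_imp_continuous_on[OF \<phi>'[OF \<xi>]]])
           (use \<phi>_rep[OF \<xi>] in auto)
    qed
  qed (use K \<delta> in auto)
  then have "\<forall>t\<in>T. \<exists>\<beta>. \<beta> 0 = ?w t \<and> (\<forall>s\<in>T. (\<beta> has_vector_derivative - krep c d (\<phi> (\<phi> \<xi>0 t) s) (\<beta> s)) (at s within T))"
    using \<phi>_half by blast
  from bchoice[OF this] obtain \<beta> where \<beta>0: "\<forall>t\<in>T. \<beta> t 0 = ?w t \<and>
      (\<forall>s\<in>T. (\<beta> t has_vector_derivative - krep c d (\<phi> (\<phi> \<xi>0 t) s) (\<beta> t s)) (at s within T))"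
    by (elim exE) (rule that)
  have seg: "closed_segment 0 (- t) \<subseteq> T" if "\<bar>t\<bar> < \<delta>" for t
    using that by (auto simp: closed_segment_eq_real_ivl split: if_splits)
  have tT: "t \<in> T" if "\<bar>t\<bar> < \<delta>" for t using that by auto
  have \<beta>: "\<beta> t 0 = ?w t"
    "s \<in> closed_segment 0 (- t) \<Longrightarrow>
      (\<beta> t has_vector_derivative - krep c d (\<phi> (\<phi> \<xi>0 t) s) (\<beta> t s)) (at s within closed_segment 0 (- t))"
    if t: "\<bar>t\<bar> < \<delta>" for t s
  proof -
    show "\<beta> t 0 = ?w t" using \<beta>0 tT[OF t] by blast
    assume s: "s \<in> closed_segment 0 (- t)"
    have "(\<beta> t has_vector_derivative - krep c d (\<phi> (\<phi> \<xi>0 t) s) (\<beta> t s)) (at s within T)"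
      using \<beta>0 tT[OF t] seg[OF t] s by blast
    then show "(\<beta> t has_vector_derivative - krep c d (\<phi> (\<phi> \<xi>0 t) s) (\<beta> t s)) (at s within closed_segment 0 (- t))"
      by (rule has_vector_derivative_within_subset[OF _ seg[OF t]])
  qed
  \<comment> \<open>Going back for the time t along that line gives the curve that has to be differentiated.\<close>
  have L: "horizontal_lift A E' D' X (- t) (flow A X t x0)
      (differential_one_form A B u (flow A X t x0) (map (\<lambda>Y. differential A A (flow A X t) x0 (Y x0)) [Y])) d = \<beta> t (- t)"
    if t: "\<bar>t\<bar> < \<delta>" for t
  proof -
    have t': "\<bar>- t\<bar> < \<delta>" using t by simp
    have "differential_one_form A B u (flow A X t x0) (map (\<lambda>Y. differential A A (flow A X t) x0 (Y x0)) [Y])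
      = N.const_field d (\<beta> t 0) (u (cinv c (\<phi> \<xi>0 t)))"
      unfolding differential_one_form_def list.map list.sel differential_along_flow[OF tT[OF t] v] \<beta>(1)[OF t]
      unfolding flow_x0[OF tT[OF t]] ..
    then show ?thesis
      unfolding flow_x0[OF tT[OF t]]
      using parallel_transport_flow[OF \<phi>_half[OF tT[OF t]] t' \<beta>(2)[OF t]] by simp
  qed
  \<comment> \<open>Without transport, the derivative combines those of the base point and of the flowed vector.\<close>
  have \<phi>0': "(\<phi> \<xi>0 has_vector_derivative F.frep c \<xi>0) (at 0 within T)"
    using \<phi>'[OF base(1,4)] \<phi>0[OF base(1)] by simp
  have Z0': "((\<lambda>t. Z t ?v) has_vector_derivative dder (F.frep c) \<xi>0 ?v) (at 0 within T)"
    unfolding atT by (rule Z')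
  have "(?w has_vector_derivative
     dder (\<lambda>q. dder (rep c d) q (Z 0 ?v)) (\<phi> \<xi>0 0) (F.frep c \<xi>0) + dder (rep c d) (\<phi> \<xi>0 0) (dder (F.frep c) \<xi>0 ?v)) (at 0 within T)"
    unfolding w_def[abs_def]
    by (rule has_vector_derivative_differential_along[OF oR rep2 \<phi>_rep[OF base(1)] base(4) \<phi>0' Z0'])
  then have w': "(?w has_vector_derivative
     dder (\<lambda>q. dder (rep c d) q ?v) \<xi>0 (F.frep c \<xi>0) + dder (rep c d) \<xi>0 (dder (F.frep c) \<xi>0 ?v)) (at 0)"
    unfolding Z0 \<phi>0[OF base(1)] atT .
  have w0: "?w 0 = dder (rep c d) \<xi>0 ?v" unfolding w_def Z0 \<phi>0[OF base(1)] ..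
  have "((\<lambda>t. \<beta> t (- t)) has_vector_derivative
     (dder (\<lambda>q. dder (rep c d) q ?v) \<xi>0 (F.frep c \<xi>0) + dder (rep c d) \<xi>0 (dder (F.frep c) \<xi>0 ?v)) + krep c d \<xi>0 (?w 0)) (at 0)"
  proof (rule transport_back_derivative[where B="cball \<xi>0 r" and \<kappa>="krep c d" and K=K and \<delta>=\<delta> and M="2 * M"
      and p="\<lambda>t s. \<phi> (\<phi> \<xi>0 t) s", OF _ K(2) K(1) K(3) _ base(2) \<delta> w'])
    show "linear (krep c d y)" if "y \<in> cball \<xi>0 r" for y
      by (rule linear_krep[OF c(1) d(1)]) (use that box in blast)
    show "continuous_on (cball \<xi>0 r) (\<lambda>y. krep c d y b)" for b
      by (rule continuous_on_subset[OF smooth_on_continuous[OF smooth_krep[OF c(1) d(1)]] box])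
    fix t s :: real assume t: "\<bar>t\<bar> < \<delta>"
    show "\<beta> t 0 = ?w t" by (rule \<beta>(1)[OF t])
    show "(\<beta> t has_vector_derivative - krep c d (\<phi> (\<phi> \<xi>0 t) s) (\<beta> t s)) (at s within closed_segment 0 (- t))"
      if "s \<in> closed_segment 0 (- t)" by (rule \<beta>(2)[OF t that])
    assume s: "\<bar>s\<bar> \<le> \<bar>t\<bar>"
    have sT: "s \<in> T" using s t by auto
    have "norm (\<phi> (\<phi> \<xi>0 t) s - \<phi> \<xi>0 t) \<le> M * \<bar>s\<bar>" by (rule \<phi>M[OF \<phi>_half[OF tT[OF t]] sT])
    also have "\<dots> \<le> M * \<bar>t\<bar>" using s M(1) by (rule mult_left_mono)
    finally have "norm (\<phi> (\<phi> \<xi>0 t) s - \<xi>0) \<le> 2 * M * \<bar>t\<bar>"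
      using \<phi>M[OF base(1) tT[OF t]] norm_triangle_ineq[of "\<phi> (\<phi> \<xi>0 t) s - \<phi> \<xi>0 t" "\<phi> \<xi>0 t - \<xi>0"] by simp
    moreover have "\<phi> (\<phi> \<xi>0 t) s \<in> cball \<xi>0 r"
      using \<phi>ball[OF \<phi>_half[OF tT[OF t]] sT] by simp
    ultimately show "\<phi> (\<phi> \<xi>0 t) s \<in> cball \<xi>0 r \<and> norm (\<phi> (\<phi> \<xi>0 t) s - \<xi>0) \<le> 2 * M * \<bar>t\<bar>" by blast
  next
    have "0 \<le> M" by (rule M(1))
    then show "0 \<le> 2 * M" by simp
  qed
  then have "((\<lambda>t. horizontal_lift A E' D' X (- t) (flow A X t x0)
      (differential_one_form A B u (flow A X t x0) (map (\<lambda>Y. differential A A (flow A X t) x0 (Y x0)) [Y])) d) has_vector_derivative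
     (dder (\<lambda>q. dder (rep c d) q ?v) \<xi>0 (F.frep c \<xi>0) + dder (rep c d) \<xi>0 (dder (F.frep c) \<xi>0 ?v)) + krep c d \<xi>0 (?w 0)) (at 0)"
  proof (rule has_vector_derivative_transform_within_open[of _ _ _ "{-\<delta><..<\<delta>}"])
    fix t assume "t \<in> {-\<delta><..<\<delta>}"
    then have "\<bar>t\<bar> < \<delta>" by auto
    from L[OF this] show "\<beta> t (- t) = horizontal_lift A E' D' X (- t) (flow A X t x0)
      (differential_one_form A B u (flow A X t x0) (map (\<lambda>Y. differential A A (flow A X t) x0 (Y x0)) [Y])) d" by simp
  qed (use \<delta> in auto)
  from vector_derivative_at[OF this]
  have 1: "conn_lie_deriv A E' D' X (differential_one_form A B u) [Y] x0 d =
     (dder (\<lambda>q. dder (rep c d) q ?v) \<xi>0 (F.frep c \<xi>0) + dder (rep c d) \<xi>0 (dder (F.frep c) \<xi>0 ?v)) + krep c d \<xi>0 (?w 0)"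
    unfolding conn_lie_deriv_def .
  \<comment> \<open>The same terms arise when du(X) is differentiated along a straight line in the direction of Y.\<close>
  have 2: "dder (wrep c d) \<xi>0 ?v = dder (\<lambda>q. dder (rep c d) q (F.frep c \<xi>0)) \<xi>0 ?v + dder (rep c d) \<xi>0 (dder (F.frep c) \<xi>0 ?v)"
  proof -
    define I where "I = {s. \<xi>0 + s *\<^sub>R ?v \<in> repdom c d}"
    have "open ((\<lambda>s. \<xi>0 + s *\<^sub>R ?v) -` repdom c d)"
      by (rule open_vimage[OF oR]) (intro continuous_intros)
    then have I: "open I" "0 \<in> I" unfolding I_def vimage_def using base(3) by auto
    have e0: "\<xi>0 + 0 *\<^sub>R ?v = \<xi>0" by simp
    have l: "((\<lambda>s. \<xi>0 + s *\<^sub>R ?v) has_vector_derivative ?v) (at 0 within I)"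
      unfolding has_vector_derivative_def by (auto intro!: derivative_eq_intros)
    have fd: "F.frep c differentiable (at (\<xi>0 + 0 *\<^sub>R ?v))"
      using smooth_on_differentiable[OF smooth_frep[OF c(1)] base(3)] by simp
    have wd: "wrep c d differentiable (at (\<xi>0 + 0 *\<^sub>R ?v))"
      using smooth_on_differentiable[OF smooth_wrep[OF c(1) d(1)] base(3)] by simp
    have "((\<lambda>s. wrep c d (\<xi>0 + s *\<^sub>R ?v)) has_vector_derivative
        dder (\<lambda>q. dder (rep c d) q (F.frep c (\<xi>0 + 0 *\<^sub>R ?v))) (\<xi>0 + 0 *\<^sub>R ?v) ?v
        + dder (rep c d) (\<xi>0 + 0 *\<^sub>R ?v) (dder (F.frep c) (\<xi>0 + 0 *\<^sub>R ?v) ?v)) (at 0 within I)"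
      by (rule has_vector_derivative_differential_along[OF oR rep2 _ I(2) l has_vector_derivative_line[OF fd]])
         (simp add: I_def)
    moreover have "((\<lambda>s. wrep c d (\<xi>0 + s *\<^sub>R ?v)) has_vector_derivative dder (wrep c d) (\<xi>0 + 0 *\<^sub>R ?v) ?v) (at 0 within I)"
      by (rule has_vector_derivative_line[OF wd])
    ultimately show ?thesis
      unfolding at_within_open[OF I(2,1)] e0 by (rule vector_derivative_unique_at[symmetric])
  qed
  have 3: "dder (\<lambda>q. dder (rep c d) q ?v) \<xi>0 (F.frep c \<xi>0) = dder (\<lambda>q. dder (rep c d) q (F.frep c \<xi>0)) \<xi>0 ?v"
    by (rule second_derivative_symmetric[OF oR rep2 base(3)])
  have 4: "krep c d \<xi>0 (?w 0) = C.christoffel d (u x0) (dder (rep c d) \<xi>0 ?v) (wrep c d \<xi>0)"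
    unfolding w0 M.cinv_cmap[OF c] by (rule C.christoffel_sym[OF d])
  show ?thesis unfolding 1 2 3 4 ..
qed

end


context pullback_setting begin

text \<open>
  The local flow is shrunk in time until the bounds required by a flow box hold.
\<close>

lemma conn_lie_deriv_chart:
  assumes c: "c \<in> A" "x0 \<in> cdom c" and d: "d \<in> B" "u x0 \<in> cdom d" and v: "Y x0 \<in> tangent_space A x0"
  shows "conn_lie_deriv A E' D' X (differential_one_form A B u) [Y] x0 d =
    dder (wrep c d) (cmap c x0) (Y x0 c) +
    C.christoffel d (u x0) (dder (rep c d) (cmap c x0) (Y x0 c)) (wrep c d (cmap c x0))"
proof (rule smooth_local_flow[OF open_repdom[OF c(1) d(1)] smooth_on_Ck[OF smooth_frep[OF c(1)]], where ?\<xi>0.0="cmap c x0"])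
  show "cmap c x0 \<in> repdom c d" using c d by blast
  fix r \<delta> L M :: real and \<phi> :: "'a \<Rightarrow> real \<Rightarrow> 'a" and Z :: "real \<Rightarrow> 'a \<Rightarrow> 'a"
  assume H: "r > 0" "\<delta> > 0" "cball (cmap c x0) r \<subseteq> repdom c d" "L-lipschitz_on (cball (cmap c x0) r) (F.frep c)"
    "M \<ge> 0"
    and \<phi>0: "\<And>\<xi>. \<xi> \<in> cball (cmap c x0) (r/2) \<Longrightarrow> \<phi> \<xi> 0 = \<xi>"
    and \<phi>1: "\<And>\<xi> t. \<xi> \<in> cball (cmap c x0) (r/2) \<Longrightarrow> t \<in> {-\<delta>..\<delta>} \<Longrightarrow> \<phi> \<xi> t \<in> ball (cmap c x0) r"
    and \<phi>2: "\<And>\<xi> t. \<xi> \<in> cball (cmap c x0) (r/2) \<Longrightarrow> t \<in> {-\<delta>..\<delta>} \<Longrightarrow> norm (\<phi> \<xi> t - \<xi>) \<le> M * \<bar>t\<bar>"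
    and \<phi>3: "\<And>\<xi> t. \<xi> \<in> cball (cmap c x0) (r/2) \<Longrightarrow> t \<in> {-\<delta>..\<delta>} \<Longrightarrow>
       (\<phi> \<xi> has_vector_derivative F.frep c (\<phi> \<xi> t)) (at t within {-\<delta>..\<delta>})"
    and Z1: "\<And>t. t \<in> {-\<delta>..\<delta>} \<Longrightarrow> ((\<lambda>\<xi>. \<phi> \<xi> t) has_derivative Z t) (at (cmap c x0))"
    and Z2: "\<And>v. Z 0 v = v"
    and Z3: "\<And>v. ((\<lambda>t. Z t v) has_vector_derivative dder (F.frep c) (cmap c x0) v) (at 0)"
  have "\<exists>K\<ge>0. \<forall>y\<in>cball (cmap c x0) r. \<forall>b. norm (krep c d y b) \<le> K * norm b"
  proof (rule linear_family_bounded_on_compact)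
    show "linear (krep c d y)" if "y \<in> cball (cmap c x0) r" for y
      by (rule linear_krep[OF c(1) d(1)]) (use that H(3) in blast)
    show "continuous_on (cball (cmap c x0) r) (\<lambda>y. krep c d y b)" for b
      by (rule continuous_on_subset[OF smooth_on_continuous[OF smooth_krep[OF c(1) d(1)]] H(3)])
  qed simp
  then obtain K where K: "K \<ge> 0" "\<And>y b. y \<in> cball (cmap c x0) r \<Longrightarrow> norm (krep c d y b) \<le> K * norm b" by blast
  define \<epsilon> where "\<epsilon> = min \<delta> (min (1 / (2 * (K + 1))) (r / (2 * (M + 1))))"
  have \<epsilon>: "\<epsilon> > 0" "\<epsilon> \<le> \<delta>" unfolding \<epsilon>_def using H K by auto
  have sub: "{-\<epsilon>..\<epsilon>} \<subseteq> {-\<delta>..\<delta>}" using \<epsilon>(2) by auto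
  have K\<epsilon>: "K * \<epsilon> \<le> 1/2"
  proof -
    have "K * \<epsilon> \<le> K * (1 / (2 * (K + 1)))" using K unfolding \<epsilon>_def by (intro mult_left_mono) auto
    also have "\<dots> \<le> 1/2" using K by (simp add: field_simps)
    finally show ?thesis .
  qed
  have M\<epsilon>: "M * \<epsilon> \<le> r/2"
  proof -
    have "M * \<epsilon> \<le> M * (r / (2 * (M + 1)))" using H unfolding \<epsilon>_def by (intro mult_left_mono) auto
    also have "\<dots> \<le> r/2" using H by (simp add: field_simps)
    finally show ?thesis .
  qed
  interpret flow_box A B u X D D' c d x0 r \<epsilon> L M K \<phi> Z
  proof unfold_locales
    fix \<xi> t assume xi: "\<xi> \<in> cball (cmap c x0) (r/2)" and t: "t \<in> {-\<epsilon>..\<epsilon>}"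
    have t': "t \<in> {-\<delta>..\<delta>}" using t sub by blast
    show "\<phi> \<xi> t \<in> ball (cmap c x0) r" by (rule \<phi>1[OF xi t'])
    show "norm (\<phi> \<xi> t - \<xi>) \<le> M * \<bar>t\<bar>" by (rule \<phi>2[OF xi t'])
    show "(\<phi> \<xi> has_vector_derivative F.frep c (\<phi> \<xi> t)) (at t within {-\<epsilon>..\<epsilon>})"
      by (rule has_vector_derivative_within_subset[OF \<phi>3[OF xi t'] sub])
  next
    show "((\<lambda>\<xi>. \<phi> \<xi> t) has_derivative Z t) (at (cmap c x0))" if "t \<in> {-\<epsilon>..\<epsilon>}" for t
      by (rule Z1) (use that sub in blast)
  qed (fact c d \<epsilon>(1) H(1,3,4,5) M\<epsilon> \<phi>0 Z2 Z3 K K\<epsilon>)+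
  show ?thesis by (rule conn_lie_deriv_differential[where Y=Y, OF v])
qed

section \<open>Zeros of parallel sections\<close>

lemma open_chart_vimage: "c \<in> A \<Longrightarrow> open V \<Longrightarrow> open (cdom c \<inter> cmap c -` V)"
  by (rule continuous_open_preimage[OF M.continuous_cmap M.open_cdom])

lemma differential_field_zero_iff:
  assumes "c \<in> A" "x \<in> cdom c" "d \<in> B" "u x \<in> cdom d"
  shows "differential A B u x (X x) = (\<lambda>_. 0) \<longleftrightarrow> wrep c d (cmap c x) = 0"
  using N.tangent_zero_iff[OF differential_tangent[OF F.field_tangent] assms(3,4)]
    differential_rep[OF assms(1,2) F.field_tangent assms(3,4)] M.cinv_cmap[OF assms(1,2)] by simp

text \<open>
  Along the straight segments that start at x0, a section w with vanishing covariant derivative satisfies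
  \<open>norm w' \<le> L * norm w\<close>.  Points close to x0 are reached from it within time \<open>\<delta>\<close> with a velocity
  of norm at most r, so that L can be chosen uniformly.
\<close>

lemma zero_set_locally_open:
  assumes c: "c \<in> A" "x0 \<in> cdom c" and d: "d \<in> B" "u x0 \<in> cdom d"
    and parallel: "\<And>x v. x \<in> cdom c \<Longrightarrow> u x \<in> cdom d \<Longrightarrow> dder (wrep c d) (cmap c x) v +
      C.christoffel d (u x) (dder (rep c d) (cmap c x) v) (wrep c d (cmap c x)) = 0"
    and zero: "wrep c d (cmap c x0) = 0"
  shows "\<exists>e>0. \<forall>y\<in>ball (cmap c x0) e. wrep c d y = 0"
proof -
  let ?\<xi> = "cmap c x0"
  obtain r where r: "r > 0" "cball ?\<xi> r \<subseteq> repdom c d"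
    using open_contains_cball open_repdom[OF c(1) d(1)] c d by blast
  let ?T = "cball ?\<xi> r \<times> cball (0::'a) r"
  let ?N = "\<lambda>t. C.christoffel d (u (cinv c (fst t))) (dder (rep c d) (fst t) (snd t))"
  have R: "fst t \<in> repdom c d" if "t \<in> ?T" for t using that r(2) by auto
  have tg: "u (cinv c (fst t)) \<in> cdom d" if "t \<in> ?T" for t using R[OF that] mem_repdom[OF c(1)] by blast
  have "\<exists>L\<ge>0. \<forall>t\<in>?T. \<forall>b. norm (?N t b) \<le> L * norm b"
  proof (rule linear_family_bounded_on_compact)
    show "compact ?T" by (intro compact_Times compact_cball)
    show "linear (?N t)" if "t \<in> ?T" for t by (rule C.linear_christoffel[OF d(1) tg[OF that]])
    show "continuous_on ?T (\<lambda>t. ?N t b)" for b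
    proof (rule continuous_on_linear_family[where N="\<lambda>t a. C.christoffel d (u (cinv c (fst t))) a b"])
      show "linear (\<lambda>a. C.christoffel d (u (cinv c (fst t))) a b)" if "t \<in> ?T" for t
        by (rule C.linear_christoffel_left[OF d(1) tg[OF that]])
      have cf: "continuous_on ?T fst" by (intro continuous_intros)
      show "continuous_on ?T (\<lambda>t. C.christoffel d (u (cinv c (fst t))) a b)" for a
        by (rule continuous_on_compose2[OF smooth_on_continuous[OF smooth_christoffel_rep[OF c(1) d(1)]] cf])
           (rule image_subsetI, erule R)
      show "continuous_on ?T (\<lambda>t. dder (rep c d) (fst t) (snd t))"
        by (rule continuous_on_dder_along[OF smooth_on_Ck[OF smooth_rep[OF c(1) d(1)]] cf R])
           (auto intro!: continuous_intros)
    qed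
  qed
  then obtain L where L: "L \<ge> 0" "\<And>t b. t \<in> ?T \<Longrightarrow> norm (?N t b) \<le> L * norm b" by blast
  define \<delta> where "\<delta> = min 1 (1 / (2 * (L + 1)))"
  have \<delta>: "\<delta> > 0" "\<delta> \<le> 1" unfolding \<delta>_def using L by auto
  have L\<delta>: "L * \<delta> \<le> 1/2"
  proof -
    have "L * \<delta> \<le> L * (1 / (2 * (L + 1)))" using L unfolding \<delta>_def by (intro mult_left_mono) auto
    also have "\<dots> \<le> 1/2" using L by (simp add: field_simps)
    finally show ?thesis .
  qed
  have "wrep c d y = 0" if y: "y \<in> ball ?\<xi> (\<delta> * r)" for y
  proof -
    define v where "v = (1 / \<delta>) *\<^sub>R (y - ?\<xi>)"
    have v: "v \<in> cball 0 r" "?\<xi> + \<delta> *\<^sub>R v = y"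
    proof -
      have "norm v = norm (y - ?\<xi>) / \<delta>" unfolding v_def using \<delta> by simp
      then have "norm v < r"
        using y \<delta> by (simp add: dist_norm norm_minus_commute pos_divide_less_eq mult.commute)
      then show "v \<in> cball 0 r" by simp
      show "?\<xi> + \<delta> *\<^sub>R v = y" unfolding v_def using \<delta> by simp
    qed
    have in_ball: "?\<xi> + s *\<^sub>R v \<in> cball ?\<xi> r" if "s \<in> {0..\<delta>}" for s
    proof -
      have "s * norm v \<le> 1 * r" using that v \<delta> r by (intro mult_mono) auto
      then show ?thesis using that by (simp add: dist_norm)
    qed
    let ?w = "\<lambda>s. wrep c d (?\<xi> + s *\<^sub>R v)"
    have "norm (?w \<delta>) \<le> 2 * norm (?w 0) + 2 * \<delta> * 0"
    proof (rule small_gronwall[of "{0..\<delta>}" 0 \<delta> ?w "\<lambda>s. dder (wrep c d) (?\<xi> + s *\<^sub>R v) v" L])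
      fix s assume s: "s \<in> {0..\<delta>}"
      let ?y = "?\<xi> + s *\<^sub>R v"
      have yR: "?y \<in> repdom c d" using in_ball[OF s] r(2) by blast
      then obtain x where x: "x \<in> cdom c" "u x \<in> cdom d" "?y = cmap c x" by blast
      have "wrep c d differentiable (at ?y)" by (rule smooth_on_differentiable[OF smooth_wrep[OF c(1) d(1)] yR])
      then show "(?w has_vector_derivative dder (wrep c d) ?y v) (at s within {0..\<delta>})"
        by (rule has_vector_derivative_line)
      have "dder (wrep c d) ?y v = - ?N (?y, v) (?w s)"
        using parallel[OF x(1,2), of v] M.cinv_cmap[OF c(1) x(1)] unfolding x(3)
        by (simp add: eq_neg_iff_add_eq_0)
      then show "norm (dder (wrep c d) ?y v) \<le> L * norm (?w s) + 0"
        using L(2)[of "(?y, v)" "?w s"] in_ball[OF s] v(1) by simp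
    qed (use \<delta> L L\<delta> in auto)
    then show ?thesis using zero v(2) by simp
  qed
  then show ?thesis using \<delta> r by (intro exI[of _ "\<delta> * r"]) simp
qed

text \<open>
  The zero set of \<open>du(X)\<close> is open by the previous lemma, and its complement is open by continuity.
\<close>

lemma differential_of_field_vanishes:
  assumes conn: "connected (UNIV :: 'm set)"
    and lie: "\<And>Y x. vector_field A UNIV Y \<Longrightarrow> conn_lie_deriv A E' D' X (differential_one_form A B u) [Y] x = (\<lambda>_. 0)"
    and x1: "X x1 = (\<lambda>_. 0)"
  shows "differential A B u x (X x) = (\<lambda>_. 0)"
proof -
  define S where "S = {x. differential A B u x (X x) = (\<lambda>_. 0)}"
  have parallel: "dder (wrep c d) (cmap c x) v +
      C.christoffel d (u x) (dder (rep c d) (cmap c x) v) (wrep c d (cmap c x)) = 0"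
    if H: "c \<in> A" "d \<in> B" "x \<in> cdom c" "u x \<in> cdom d" for c d x v
  proof -
    obtain Y where Y: "vector_field A UNIV Y \<and> Y x c = v"
      using M.vector_field_exists[OF H(1,3), of v] by blast
    have "Y x \<in> tangent_space A x" using M.vector_field_tangent Y by blast
    from conn_lie_deriv_chart[OF H(1,3,2,4), of Y, OF this] show ?thesis
      using lie[of Y x] Y by simp
  qed
  have loc: "\<exists>U. open U \<and> x \<in> U \<and> (U \<subseteq> S \<or> U \<subseteq> - S)" for x
  proof -
    obtain c d where c: "c \<in> A" "x \<in> cdom c" and d: "d \<in> B" "u x \<in> cdom d"
      using M.chart_exists N.chart_exists by metis
    have "\<exists>e>0. ball (cmap c x) e \<subseteq> repdom c d \<and>
      ((\<forall>y\<in>ball (cmap c x) e. wrep c d y = 0) \<or> (\<forall>y\<in>ball (cmap c x) e. wrep c d y \<noteq> 0))"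
    proof -
      obtain r where r: "r > 0" "ball (cmap c x) r \<subseteq> repdom c d"
        using open_contains_ball open_repdom[OF c(1) d(1)] c d by blast
      show ?thesis
      proof (cases "wrep c d (cmap c x) = 0")
        case True
        obtain e where "e > 0" "\<forall>y\<in>ball (cmap c x) e. wrep c d y = 0"
          using zero_set_locally_open[OF c d parallel[OF c(1) d(1)] True] by blast
        then show ?thesis using r by (intro exI[of _ "min e r"]) (auto simp: subset_iff)
      next
        case False
        have "open (repdom c d \<inter> wrep c d -` (- {0}))"
          by (rule continuous_open_preimage[OF smooth_on_continuous[OF smooth_wrep[OF c(1) d(1)]] open_repdom[OF c(1) d(1)]]) auto
        moreover have "cmap c x \<in> repdom c d \<inter> wrep c d -` (- {0})" using False c d by auto
        ultimately obtain e where "e > 0" "ball (cmap c x) e \<subseteq> repdom c d \<inter> wrep c d -` (- {0})"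
          using open_contains_ball by blast
        then show ?thesis by (intro exI[of _ e]) auto
      qed
    qed
    then obtain e where e: "e > 0" "ball (cmap c x) e \<subseteq> repdom c d"
      "(\<forall>y\<in>ball (cmap c x) e. wrep c d y = 0) \<or> (\<forall>y\<in>ball (cmap c x) e. wrep c d y \<noteq> 0)" by blast
    let ?U = "cdom c \<inter> cmap c -` ball (cmap c x) e"
    have "z \<in> S \<longleftrightarrow> wrep c d (cmap c z) = 0" if "z \<in> ?U" for z
    proof -
      have z: "z \<in> cdom c" using that by blast
      have "cmap c z \<in> repdom c d" using that e(2) by blast
      then have "u z \<in> cdom d" using mem_repdom[OF c(1)] M.cinv_cmap[OF c(1) z] by metis
      from differential_field_zero_iff[OF c(1) z d(1) this] show ?thesis unfolding S_def by simp
    qed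
    then have "?U \<subseteq> S \<or> ?U \<subseteq> - S" using e(3) by auto
    moreover have "open ?U" by (rule open_chart_vimage[OF c(1)]) simp
    moreover have "x \<in> ?U" using c e by simp
    ultimately show ?thesis by blast
  qed
  have "open S"
  proof (rule Topological_Spaces.openI)
    fix x assume "x \<in> S"
    then show "\<exists>U. open U \<and> x \<in> U \<and> U \<subseteq> S" using loc[of x] by blast
  qed
  moreover have "open (- S)"
  proof (rule Topological_Spaces.openI)
    fix x assume "x \<in> - S"
    then show "\<exists>U. open U \<and> x \<in> U \<and> U \<subseteq> - S" using loc[of x] by blast
  qed
  moreover have "x1 \<in> S"
  proof -
    obtain c d where c: "c \<in> A" "x1 \<in> cdom c" and d: "d \<in> B" "u x1 \<in> cdom d"
      using M.chart_exists N.chart_exists by metis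
    have "linear (dder (rep c d) (cmap c x1))" by (rule linear_dder[OF rep_differentiable[OF c(1) d(1)]]) (use c d in blast)
    then have "wrep c d (cmap c x1) = 0" using x1 linear_0 M.cinv_cmap[OF c] by simp
    then show ?thesis using differential_field_zero_iff[OF c d] unfolding S_def by simp
  qed
  ultimately have "S = UNIV"
    using connectedD[OF conn, of S "- S"] by auto
  then show ?thesis unfolding S_def by blast
qed

text \<open>
  The flow line through x0 does not leave the fibre of u, so f restricted to it has a maximum at time 0.
\<close>

lemma max_on_fibre:
  assumes zero: "\<And>x. differential A B u x (X x) = (\<lambda>_. 0)"
    and f: "smooth_fun A UNIV f" and max: "\<And>x. u x = u x0 \<Longrightarrow> f x \<le> f x0"
  shows "dfun A f x0 (X x0) = 0"
proof -
  obtain c d where c: "c \<in> A" "x0 \<in> cdom c" and d: "d \<in> B" "u x0 \<in> cdom d"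
    using M.chart_exists N.chart_exists by metis
  show ?thesis
  proof (rule smooth_local_flow[OF open_repdom[OF c(1) d(1)] smooth_on_Ck[OF smooth_frep[OF c(1)]], where ?\<xi>0.0="cmap c x0"])
    show "cmap c x0 \<in> repdom c d" using c d by blast
    fix r \<delta> L M :: real and \<phi> :: "'a \<Rightarrow> real \<Rightarrow> 'a"
    assume r: "r > 0" "\<delta> > 0" "cball (cmap c x0) r \<subseteq> repdom c d"
      and \<phi>0: "\<And>\<xi>. \<xi> \<in> cball (cmap c x0) (r/2) \<Longrightarrow> \<phi> \<xi> 0 = \<xi>"
      and \<phi>1: "\<And>\<xi> t. \<xi> \<in> cball (cmap c x0) (r/2) \<Longrightarrow> t \<in> {-\<delta>..\<delta>} \<Longrightarrow> \<phi> \<xi> t \<in> ball (cmap c x0) r"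
      and \<phi>3: "\<And>\<xi> t. \<xi> \<in> cball (cmap c x0) (r/2) \<Longrightarrow> t \<in> {-\<delta>..\<delta>} \<Longrightarrow>
         (\<phi> \<xi> has_vector_derivative F.frep c (\<phi> \<xi> t)) (at t within {-\<delta>..\<delta>})"
    let ?T = "{-\<delta>..\<delta>}"
    let ?\<xi> = "cmap c x0"
    let ?p = "\<phi> ?\<xi>"
    have xi: "?\<xi> \<in> cball ?\<xi> (r/2)" using r by simp
    have T0: "0 \<in> ?T" using r by simp
    have pR: "?p t \<in> repdom c d" if "t \<in> ?T" for t using \<phi>1[OF xi that] r(3) ball_subset_cball by blast
    have fs: "smooth_on (cmap c ` cdom c) (\<lambda>y. f (cinv c y))"
      using f c(1) unfolding smooth_fun_def by force
    have "wrep c d y = 0" if y: "y \<in> repdom c d" for y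
    proof -
      obtain x where x: "x \<in> cdom c" "u x \<in> cdom d" "y = cmap c x" using y by blast
      then show ?thesis using differential_field_zero_iff[OF c(1) x(1) d(1) x(2)] zero by simp
    qed
    then have rd: "((\<lambda>t. rep c d (?p t)) has_vector_derivative 0) (at t within ?T)" if "t \<in> ?T" for t
      using has_vector_derivative_chain[OF \<phi>3[OF xi that] rep_differentiable[OF c(1) d(1) pR[OF that]]] pR[OF that] by simp
    have le: "f (cinv c (?p t)) \<le> f (cinv c (?p 0))" if t: "t \<in> ?T" for t
    proof -
      have "norm (rep c d (?p t) - rep c d (?p 0)) \<le> 0 * \<bar>t - 0\<bar>"
        by (rule real_mean_value_bound[OF _ rd _ t T0]) auto
      then have "rep c d (?p t) = rep c d (?p 0)" by simp
      then have "cinv d (rep c d (?p t)) = cinv d (rep c d (?p 0))" by simp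
      then have "u (cinv c (?p t)) = u (cinv c (?p 0))"
        using N.cinv_cmap[OF d(1)] pR[OF t] pR[OF T0] mem_repdom[OF c(1)] by metis
      then show ?thesis using max \<phi>0[OF xi] M.cinv_cmap[OF c] by simp
    qed
    have fd: "(\<lambda>y. f (cinv c y)) differentiable (at (?p 0))"
      by (rule smooth_on_differentiable[OF fs]) (use pR[OF T0] in blast)
    have at: "at 0 within ?T = at 0" using r by (intro at_within_interior) simp
    have "((\<lambda>t. f (cinv c (?p t))) has_vector_derivative dder (\<lambda>y. f (cinv c y)) (?p 0) (F.frep c (?p 0))) (at 0)"
      using has_vector_derivative_chain[OF \<phi>3[OF xi T0] fd] unfolding at .
    then have "DERIV (\<lambda>t. f (cinv c (?p t))) 0 :> dder (\<lambda>y. f (cinv c y)) (?p 0) (F.frep c (?p 0))"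
      unfolding has_real_derivative_iff_has_vector_derivative .
    then have "dder (\<lambda>y. f (cinv c y)) (?p 0) (F.frep c (?p 0)) = 0"
      by (rule DERIV_local_max[OF _ r(2)]) (auto intro!: le)
    then have z: "dder (\<lambda>y. f (cinv c y)) ?\<xi> (X x0 c) = 0" unfolding \<phi>0[OF xi] M.cinv_cmap[OF c] .
    have "(\<lambda>y. f (cinv c y)) differentiable (at ?\<xi>)" using fd unfolding \<phi>0[OF xi] .
    from M.dfun_chart[OF c F.field_tangent this] show ?thesis using z by simp
  qed
qed

end

section \<open>Critical points of a Morse function\<close>

text \<open>
  A non-degenerate Hessian satisfies a lower bound \<open>m * norm v \<le> \<Phi> v\<close>, while at another critical
  point y the Taylor estimate bounds \<open>\<Phi> (y - \<xi>)\<close> by a multiple of the square of the distance.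
\<close>

lemma nondegenerate_zero_isolated:
  fixes f :: "'a::{real_normed_vector,heine_borel} \<Rightarrow> real"
  assumes S: "open S" "\<xi> \<in> S" and f: "smooth_on S f"
    and nondeg: "\<And>a. (\<And>b. dder (\<lambda>y. dder f y b) \<xi> a = 0) \<Longrightarrow> a = 0"
    and crit: "\<And>b. dder f \<xi> b = 0"
  shows "\<exists>e>0. \<forall>y\<in>ball \<xi> e. (\<forall>b. dder f y b = 0) \<longrightarrow> y = \<xi>"
proof -
  obtain r where r: "r > 0" "cball \<xi> r \<subseteq> S" using S open_contains_cball by blast
  let ?g = "\<lambda>b y. dder f y b"
  have gs: "smooth_on S (?g b)" for b by (rule smooth_on_dder[OF f])
  have "\<forall>b. \<exists>M. M \<ge> 0 \<and> (\<forall>p\<in>cball \<xi> r. \<forall>q\<in>cball \<xi> r.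
      norm (?g b p - ?g b q - dder (?g b) q (p - q)) \<le> M * (norm (p - q))\<^sup>2)"
  proof
    fix b
    show "\<exists>M. M \<ge> 0 \<and> (\<forall>p\<in>cball \<xi> r. \<forall>q\<in>cball \<xi> r.
      norm (?g b p - ?g b q - dder (?g b) q (p - q)) \<le> M * (norm (p - q))\<^sup>2)"
      by (rule C2_taylor_on_compact_convex[OF smooth_on_Ck[OF gs] compact_cball convex_cball r(2), of b])
         (intro exI conjI ballI; assumption)
  qed
  from choice[OF this] obtain M where M0: "\<forall>b. M b \<ge> 0 \<and> (\<forall>p\<in>cball \<xi> r. \<forall>q\<in>cball \<xi> r.
      norm (?g b p - ?g b q - dder (?g b) q (p - q)) \<le> M b * (norm (p - q))\<^sup>2)"
    by (elim exE) (rule that)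
  have M: "M b \<ge> 0" "p \<in> cball \<xi> r \<Longrightarrow> q \<in> cball \<xi> r \<Longrightarrow>
      norm (?g b p - ?g b q - dder (?g b) q (p - q)) \<le> M b * (norm (p - q))\<^sup>2" for b p q
    using M0 by blast+
  define \<Phi> where "\<Phi> v = (\<Sum>b\<in>fbasis. \<bar>dder (?g b) \<xi> v\<bar>)" for v
  have lg: "linear (dder (?g b) \<xi>)" for b by (rule linear_dder[OF smooth_on_differentiable[OF gs S(2)]])
  have \<Phi>0: "v = 0" if "\<Phi> v = 0" for v
  proof (rule nondeg)
    fix b
    have "\<forall>b\<in>fbasis. \<bar>dder (?g b) \<xi> v\<bar> = 0"
      using that fbasis(1) unfolding \<Phi>_def by (subst (asm) sum_nonneg_eq_0_iff) auto
    then show "dder (?g b) \<xi> v = 0"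
      unfolding dder_dder_expand_coord[OF S(1) smooth_on_Ck[OF f] S(2), of b v] by simp
  qed
  have \<Phi>s: "\<Phi> (k *\<^sub>R v) = \<bar>k\<bar> * \<Phi> v" for k v
    unfolding \<Phi>_def using linear_cmul[OF lg] by (simp add: abs_mult sum_distrib_left)
  have \<Phi>n: "\<Phi> v \<ge> 0" for v unfolding \<Phi>_def by (intro sum_nonneg) simp
  have \<Phi>c: "continuous_on (sphere 0 1) \<Phi>"
    unfolding \<Phi>_def by (intro continuous_intros bounded_linear.continuous_on[OF linear_imp_bounded_linear[OF lg]])
  have "closed (norm -` {1::real} :: 'a set)" by (intro closed_vimage continuous_intros)
  then have "compact (cball (0::'a) 1 \<inter> norm -` {1})" by (rule compact_Int_closed[OF compact_cball])
  also have "cball (0::'a) 1 \<inter> norm -` {1} = sphere 0 1" by auto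
  finally have sph: "compact (sphere (0::'a) 1)" .
  have "\<exists>m>0. \<forall>v\<in>sphere 0 1. m \<le> \<Phi> v"
  proof (cases "sphere (0::'a) 1 = {}")
    case False
    then obtain w where w: "w \<in> sphere 0 1" "\<And>v. v \<in> sphere 0 1 \<Longrightarrow> \<Phi> w \<le> \<Phi> v"
      using continuous_attains_inf[OF sph False \<Phi>c] by blast
    have "w \<noteq> 0" using w(1) by auto
    then have "\<Phi> w > 0" using \<Phi>0[of w] \<Phi>n[of w] by fastforce
    then show ?thesis using w(2) by blast
  qed (auto intro: exI[of _ 1])
  then obtain m where m: "m > 0" "\<And>v. v \<in> sphere 0 1 \<Longrightarrow> m \<le> \<Phi> v" by blast
  have mb: "m * norm v \<le> \<Phi> v" for v
  proof (cases "v = 0")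
    case False
    then have "(1 / norm v) *\<^sub>R v \<in> sphere 0 1" by simp
    from m(2)[OF this] show ?thesis using False by (simp add: \<Phi>s field_simps)
  qed (simp add: \<Phi>n)
  define K where "K = (\<Sum>b\<in>(fbasis::'a set). M b)"
  have K: "K \<ge> 0" unfolding K_def using M(1) by (intro sum_nonneg)
  define e where "e = min r (m / (K + 1))"
  have e: "e > 0" unfolding e_def using r m K by simp
  have "y = \<xi>" if y: "y \<in> ball \<xi> e" and yc: "\<forall>b. dder f y b = 0" for y
  proof (rule ccontr)
    assume "y \<noteq> \<xi>"
    then have n: "norm (y - \<xi>) > 0" by simp
    have yr: "y \<in> cball \<xi> r" "\<xi> \<in> cball \<xi> r" using y r unfolding e_def by auto
    have "\<bar>dder (?g b) \<xi> (y - \<xi>)\<bar> \<le> M b * (norm (y - \<xi>))\<^sup>2" for b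
      using M(2)[OF yr, of b] yc crit by simp
    then have "\<Phi> (y - \<xi>) \<le> K * (norm (y - \<xi>))\<^sup>2"
      unfolding \<Phi>_def K_def sum_distrib_right by (intro sum_mono)
    with mb[of "y - \<xi>"] have "m * norm (y - \<xi>) \<le> (K * norm (y - \<xi>)) * norm (y - \<xi>)"
      by (simp add: power2_eq_square mult_ac)
    then have "m \<le> K * norm (y - \<xi>)" using n by simp
    also have "\<dots> \<le> (K + 1) * norm (y - \<xi>)" by (simp add: mult_right_mono)
    also have "\<dots> < (K + 1) * (m / (K + 1))"
      using y K unfolding e_def by (intro mult_strict_left_mono) (auto simp: dist_norm norm_minus_commute)
    also have "\<dots> = m" using K by simp
    finally show False by simp
  qed
  then show ?thesis using e by blast
qed

context smooth_manifold begin

lemma critical_point_chart: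
  assumes f: "smooth_on (cmap c ` cdom c) (\<lambda>y. f (cinv c y))" and c: "c \<in> A" "x \<in> cdom c"
  shows "critical_point A f x \<longleftrightarrow> (\<forall>b. dder (\<lambda>y. f (cinv c y)) (cmap c x) b = 0)"
proof -
  have "(\<lambda>y. f (cinv c y)) differentiable (at (cmap c x))"
    by (rule smooth_on_differentiable[OF f]) (use c in blast)
  note df = dfun_chart[OF c _ this]
  show ?thesis
  proof
    assume "critical_point A f x"
    then have "dfun A f x (const_field c b x) = 0" for b
      unfolding critical_point_def using const_field_tangent[OF c] by blast
    then show "\<forall>b. dder (\<lambda>y. f (cinv c y)) (cmap c x) b = 0"
      using df[OF const_field_tangent[OF c]] const_field_self[OF c] by simp
  next
    assume "\<forall>b. dder (\<lambda>y. f (cinv c y)) (cmap c x) b = 0"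
    then show "critical_point A f x" unfolding critical_point_def using df by simp
  qed
qed

lemma smooth_fun_chart: "smooth_fun A UNIV f \<Longrightarrow> c \<in> A \<Longrightarrow> smooth_on (cmap c ` cdom c) (\<lambda>y. f (cinv c y))"
  unfolding smooth_fun_def by force

text \<open>
  Stated for all points, critical or not, so that the neighbourhoods form a cover of the manifold.
\<close>

lemma morse_critical_points_isolated:
  assumes f: "morse_function A f"
  shows "\<exists>U. open U \<and> x \<in> U \<and> (\<forall>y\<in>U. critical_point A f y \<longrightarrow> y = x)"
proof -
  define c where "c = chart_at A x"
  have c: "c \<in> A" "x \<in> cdom c" unfolding c_def by (rule chart_at)+
  let ?f = "\<lambda>y. f (cinv c y)"
  let ?S = "cmap c ` cdom c"
  have fs: "smooth_on ?S ?f" using f c(1) unfolding morse_function_def by (intro smooth_fun_chart) auto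
  have S: "open ?S" "cmap c x \<in> ?S" using open_cimage c by auto
  have "\<exists>e>0. \<forall>y\<in>ball (cmap c x) e. (\<forall>b. dder ?f y b = 0) \<longrightarrow> y = cmap c x"
  proof (cases "critical_point A f x")
    case True
    show ?thesis
    proof (rule nondegenerate_zero_isolated[OF S fs])
      show "dder ?f (cmap c x) b = 0" for b using True critical_point_chart[OF fs c] by blast
      fix a assume a: "\<And>b. dder (\<lambda>y. dder ?f y b) (cmap c x) a = 0"
      have "hessian A f x (const_field c a x) w = 0" for w
        unfolding hessian_def Let_def c_def[symmetric] const_field_self[OF c] by (rule a)
      then have "const_field c a x = (\<lambda>_. 0)"
        using f True const_field_tangent[OF c] unfolding morse_function_def by blast
      then show "a = 0" using const_field_self[OF c, of a] by simp
    qed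
  next
    case False
    then obtain b where b: "dder ?f (cmap c x) b \<noteq> 0" using critical_point_chart[OF fs c] by blast
    have "open (?S \<inter> (\<lambda>y. dder ?f y b) -` (- {0}))"
      by (rule continuous_open_preimage[OF smooth_on_continuous[OF smooth_on_dder[OF fs]] S(1)]) auto
    then obtain e where "e > 0" "ball (cmap c x) e \<subseteq> ?S \<inter> (\<lambda>y. dder ?f y b) -` (- {0})"
      using open_contains_ball b S(2) by blast
    then show ?thesis by (intro exI[of _ e]) auto
  qed
  then obtain e where e: "e > 0" "\<And>y. y \<in> ball (cmap c x) e \<Longrightarrow> (\<forall>b. dder ?f y b = 0) \<Longrightarrow> y = cmap c x" by blast
  let ?U = "cdom c \<inter> cmap c -` ball (cmap c x) e"
  have "open ?U" by (rule continuous_open_preimage[OF continuous_cmap[OF c(1)] open_cdom[OF c(1)]]) simp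
  moreover have "x \<in> ?U" using c e by simp
  moreover have "y = x" if y: "y \<in> ?U" "critical_point A f y" for y
  proof -
    have yc: "y \<in> cdom c" using y by blast
    have "cmap c y = cmap c x" using e(2) y critical_point_chart[OF fs c(1) yc] by blast
    then show ?thesis using cinv_cmap[OF c] cinv_cmap[OF c(1) yc] by simp
  qed
  ultimately show ?thesis by blast
qed

lemma morse_critical_points_finite:
  assumes cpt: "compact (UNIV :: 'm set)" and f: "morse_function A f"
  shows "finite {x. critical_point A f x}"
proof -
  have "\<forall>x. \<exists>U. open U \<and> x \<in> U \<and> (\<forall>y\<in>U. critical_point A f y \<longrightarrow> y = x)"
    using morse_critical_points_isolated[OF f] by blast
  then obtain U where U: "\<And>x. open (U x)" "\<And>x. x \<in> U x" "\<And>x y. y \<in> U x \<Longrightarrow> critical_point A f y \<Longrightarrow> y = x"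
    by metis
  obtain F where F: "F \<subseteq> UNIV" "finite F" "UNIV \<subseteq> (\<Union>x\<in>F. U x)"
    by (rule compactE_image[OF cpt, of UNIV U]) (use U in auto)
  have "{x. critical_point A f x} \<subseteq> F"
  proof
    fix y assume "y \<in> {x. critical_point A f x}"
    moreover obtain x where "x \<in> F" "y \<in> U x" using F(3) by blast
    ultimately show "y \<in> F" using U(3)[of y x] by simp
  qed
  then show ?thesis using F(2) finite_subset by blast
qed

lemma smooth_fun_continuous:
  assumes f: "smooth_fun A UNIV f"
  shows "continuous_on UNIV f"
  unfolding continuous_on_eq_continuous_at[OF open_UNIV]
proof
  fix x
  obtain c where c: "c \<in> A" "x \<in> cdom c" using chart_exists by blast
  have "continuous_on (cdom c) (\<lambda>y. f (cinv c (cmap c y)))"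
    by (rule continuous_on_compose2[OF smooth_on_continuous[OF smooth_fun_chart[OF f c(1)]] continuous_cmap[OF c(1)]]) auto
  then have "continuous_on (cdom c) f"
    by (rule continuous_on_eq) (simp add: cinv_cmap[OF c(1)])
  then show "isCont f x" using continuous_on_eq_continuous_at[OF open_cdom[OF c(1)]] c(2) by blast
qed

lemma critical_point_of_max:
  assumes f: "smooth_fun A UNIV f" and max: "\<And>y. f y \<le> f x"
  shows "critical_point A f x"
proof -
  obtain c where c: "c \<in> A" "x \<in> cdom c" using chart_exists by blast
  let ?f = "\<lambda>y. f (cinv c y)"
  have fs: "smooth_on (cmap c ` cdom c) ?f" by (rule smooth_fun_chart[OF f c(1)])
  have "(?f has_derivative dder ?f (cmap c x)) (at (cmap c x))"
    by (rule has_derivative_dder[OF smooth_on_differentiable[OF fs]]) (use c in blast)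
  moreover have "\<forall>\<^sub>F y in at (cmap c x). ?f y \<le> ?f (cmap c x)"
    using max cinv_cmap[OF c] by simp
  ultimately have "dder ?f (cmap c x) = (\<lambda>h. 0)" by (rule has_derivative_local_max)
  then show ?thesis using critical_point_chart[OF fs c] by simp
qed

end

lemma connected_finite_imp_constant:
  fixes u :: "'m::topological_space \<Rightarrow> 'n::t1_space"
  assumes "connected (UNIV :: 'm set)" "continuous_on UNIV u" "finite (range u)"
  shows "u x = u y"
proof (rule ccontr)
  assume ne: "u x \<noteq> u y"
  have "connected (range u)" using connected_continuous_image[OF assms(2,1)] .
  moreover have "closed {u x}" "closed (range u - {u x})"
    using assms(3) by (auto intro: finite_imp_closed)
  moreover have "range u \<subseteq> {u x} \<union> (range u - {u x})" "{u x} \<inter> (range u - {u x}) \<inter> range u = {}" by auto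
  ultimately have "{u x} \<inter> range u = {} \<or> (range u - {u x}) \<inter> range u = {}"
    using connected_closedD by metis
  moreover have "u x \<in> {u x} \<inter> range u" "u y \<in> (range u - {u x}) \<inter> range u" using ne by auto
  ultimately show False by (metis empty_iff)
qed

theorem proposition3p3:
  fixes A :: "('m::{t2_space,second_countable_topology}, 'a::{real_normed_vector,heine_borel}) chart set"
    and g :: "'m \<Rightarrow> ('m, 'a) tvec \<Rightarrow> ('m, 'a) tvec \<Rightarrow> real"
    and B :: "('n::{t2_space,second_countable_topology}, 'b::{real_normed_vector,heine_borel}) chart set"
    and h :: "'n \<Rightarrow> ('n, 'b) tvec \<Rightarrow> ('n, 'b) tvec \<Rightarrow> real"
    and D :: "('n, 'b, ('n, 'b) chart, 'b) conn"
    and D' :: "('m, 'a, ('n, 'b) chart, 'b) conn"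
    and u :: "'m \<Rightarrow> 'n"
    and f :: "'m \<Rightarrow> real"
  assumes "riemannian_manifold A g"
    and "connected (UNIV :: 'm set)"
    and "compact (UNIV :: 'm set)"
    and "riemannian_manifold B h"
    and "smooth_map A B u"
    and "levi_civita B h D"
    and "pullback_connection A B u (tangent_bundle B) D D'"
    and "morse_function A f"
    and "\<forall>Y. vector_field A UNIV Y \<longrightarrow>
           (\<forall>x. conn_lie_deriv A (pullback_bundle u (tangent_bundle B)) D'
                  (gradient A g f) (differential_one_form A B u) [Y] x = (\<lambda>_. 0))"
  shows "u constant_on UNIV"
proof -
  interpret R: riemannian A g
    using assms(1) unfolding riemannian_manifold_def by unfold_locales auto
  have f: "smooth_fun A UNIV f" using assms(8) unfolding morse_function_def by blast
  interpret smooth_field A "gradient A g f"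
    by unfold_locales (rule R.gradient_tangent[OF f], rule R.gradient_smooth[OF f])
  have sB: "smooth_atlas B" using assms(4) unfolding riemannian_manifold_def by blast
  interpret smooth_manifold_map A B u
    by unfold_locales (fact sB, fact assms(5))
  have "connection B (tangent_bundle B) D" using assms(6) unfolding levi_civita_def by (rule conjunct1)
  moreover have "(\<lambda>c. D x (X x) Y c - D x (Y x) X c) = lie_bracket B X Y x"
    if "open U" "vector_field B U X" "vector_field B U Y" "x \<in> U" for U X Y x
    using assms(6)[unfolded levi_civita_def, THEN conjunct2, THEN conjunct1] that by blast
  ultimately interpret torsion_free_connection B D by unfold_locales
  interpret P: pullback_setting A B u "gradient A g f" D D'
    by unfold_locales (fact assms(7))
  have fc: "continuous_on UNIV f" by (rule R.smooth_fun_continuous[OF f])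
  obtain x1 where x1: "\<And>y. f y \<le> f x1"
    using continuous_attains_sup[OF assms(3) _ fc] by auto
  have "gradient A g f x1 = (\<lambda>_. 0)"
    using R.gradient_eq_0_iff[OF f] R.critical_point_of_max[OF f x1] by blast
  then have zero: "differential A B u x (gradient A g f x) = (\<lambda>_. 0)" for x
    by (rule P.differential_of_field_vanishes[OF assms(2), rotated]) (use assms(9) in blast)
  have "u x \<in> u ` {p. critical_point A f p}" for x
  proof -
    have "closed (u -` {u x})" using continuous_map by (intro closed_vimage) auto
    then have "compact (u -` {u x})" using compact_Int_closed[OF assms(3)] by simp
    then obtain p where p: "p \<in> u -` {u x}" "\<And>y. y \<in> u -` {u x} \<Longrightarrow> f y \<le> f p"
      using continuous_attains_sup[OF _ _ continuous_on_subset[OF fc subset_UNIV], of "u -` {u x}"] by blast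
    have "dfun A f p (gradient A g f p) = 0"
      by (rule P.max_on_fibre[OF zero f]) (use p in auto)
    then have "g p (gradient A g f p) (gradient A g f p) = 0"
      using R.gradient_inner[OF f R.gradient_tangent[OF f]] by simp
    then have "gradient A g f p = (\<lambda>_. 0)"
      using R.metric_pos[OF R.gradient_tangent[OF f, of p]] by fastforce
    then have "critical_point A f p" using R.gradient_eq_0_iff[OF f] by blast
    then show ?thesis using p(1) by (intro image_eqI[of "u x" u p]) auto
  qed
  then have "range u \<subseteq> u ` {p. critical_point A f p}" by blast
  then have "finite (range u)"
    using R.morse_critical_points_finite[OF assms(3,8)] finite_subset by blast
  then have "u x = u y" for x y
    by (rule connected_finite_imp_constant[OF assms(2) continuous_map])
  then show ?thesis unfolding constant_on_def by blast
qed

end
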